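(* Let $\Omega$ be a countably infinite set and let $G\leq\mathrm{Sym}(\Omega)$ be a closed permutation group. The following are equivalent. (i) Every unitary representation of $G$ is dissociated. (ii) Every Boolean p.m.p. action of $G$ (on a standard probability space) is dissociated.
   Context: $\mathrm{Sym}(\Omega)$ is the group of all permutations of the countably infinite set $\Omega$ with the topology of pointwise convergence; a closed permutation group on $\Omega$ is a closed subgroup $G\leq\mathrm{Sym}(\Omega)$. For $A\subseteq\Omega$, $G_A=\{g\in G: g(a)=a \text{ for all } a\in A\}$ is the pointwise stabilizer. Unitary representations. A unitary representation of $G$ on a Hilbert space $\mathcal{H}$ is a group homomorphism $\pi:G\to\mathcal{U}(\mathcal{H})$ such that $g\mapsto\pi(g)\xi$ is continuous for every $\xi\in\mathcal{H}$. For finite $A\subseteq\Omega$, $\mathcal{H}_A=\{\xi\in\mathcal{H}:\pi(g)\xi=\xi\text{ for all }g\in G_A\}$ and $p_A$ is the orthogonal projection onto $\mathcal{H}_A$. The representation $\pi$ is dissociated if $p_Ap_B=p_{A\cap B}$ for all finite $A,B\subseteq\Omega$. Boolean p.m.p. actions. For a standard probability space $(X,\mu)$, $\mathrm{Aut}(X,\mu)$ is the group of measure-preserving bijections of $(X,\mu)$, identified up to measure zero, with the weak topology ($T_n\to T$ iff $\mu(T_n(Y)\triangle T(Y))\to0$ for all measurable $Y\subseteq X$). A Boolean p.m.p. action of $G$ is a continuous homomorphism $\alpha:G\to\mathrm{Aut}(X,\mu)$. For finite $A\subseteq\Omega$, $\mathcal{F}_A$ is the $\sigma$-algebra of measurable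 $Y\subseteq X$ such that $\mu(gY\triangle Y)=0$ for all $g\in G_A$. The action is dissociated if for all finite $A,B\subseteq\Omega$, $\mathcal{F}_A$ and $\mathcal{F}_B$ are independent conditionally on $\mathcal{F}_{A\cap B}$, i.e. $\mathbb{E}[f\mid\mathcal{F}_A]=\mathbb{E}[f\mid\mathcal{F}_{A\cap B}]$ for every $\mathcal{F}_B$-measurable $f\in L^2(X,\mu)$. *)

theory Defs
  imports "HOL-Probability.Probability" "HOL-Algebra.Algebra"
begin

section \<open>Closed permutation groups\<close>

text \<open>Elements of \<^const>\<open>BijGroup\<close> are extensional functions, so they are points of the product
  space below, whose underlying set is the set of all extensional functions
  from \<open>\<Omega>\<close> to \<open>\<Omega>\<close>.\<close>

definition sym_topology :: "'w set \<Rightarrow> ('w \<Rightarrow> 'w) topology" where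
  "sym_topology \<Omega> =
     subtopology (product_topology (\<lambda>_. discrete_topology \<Omega>) \<Omega>) (carrier (BijGroup \<Omega>))"

definition closed_permutation_group :: "'w set \<Rightarrow> ('w \<Rightarrow> 'w) set \<Rightarrow> bool" where
  "closed_permutation_group \<Omega> G \<longleftrightarrow>
     subgroup G (BijGroup \<Omega>) \<and> closedin (sym_topology \<Omega>) G"

definition pointwise_stabilizer :: "('w \<Rightarrow> 'w) set \<Rightarrow> 'w set \<Rightarrow> ('w \<Rightarrow> 'w) set" where
  "pointwise_stabilizer G A = {g \<in> G. \<forall>a\<in>A. g a = a}"


section \<open>Complex Hilbert spaces and unitary representations\<close>

definition complex_ring :: "complex ring" where
  "complex_ring = \<lparr>carrier = UNIV, mult = (*), one = 1, ring.zero = 0, ring.add = (+)\<rparr>"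

text \<open>The fields \<^const>\<open>mult\<close> and \<^const>\<open>one\<close> inherited from the ring record are unused
  (as in every \<^locale>\<open>module\<close>).\<close>

record 'h hilbert = "(complex, 'h) module" +
  ip :: "'h \<Rightarrow> 'h \<Rightarrow> complex"

definition hnorm :: "'h hilbert \<Rightarrow> 'h \<Rightarrow> real" where
  "hnorm H x = sqrt (Re (ip H x x))"

text \<open>The value \<open>0\<close> outside the carrier is needed because \<^locale>\<open>Metric_space\<close> demands
  nonnegativity and symmetry of the distance on the whole type.\<close>

definition hdist :: "'h hilbert \<Rightarrow> 'h \<Rightarrow> 'h \<Rightarrow> real" where
  "hdist H x y =
     (if x \<in> carrier H \<and> y \<in> carrier H then hnorm H (x \<ominus>\<^bsub>H\<^esub> y) else 0)"

locale complex_hilbert_space = module complex_ring H for H :: "'h hilbert" +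
  assumes ip_add_left:
      "\<lbrakk>x \<in> carrier H; y \<in> carrier H; z \<in> carrier H\<rbrakk> \<Longrightarrow> ip H (x \<oplus>\<^bsub>H\<^esub> y) z = ip H x z + ip H y z"
    and ip_smult_left:
      "\<lbrakk>x \<in> carrier H; y \<in> carrier H\<rbrakk> \<Longrightarrow> ip H (c \<odot>\<^bsub>H\<^esub> x) y = c * ip H x y"
    and ip_commute:
      "\<lbrakk>x \<in> carrier H; y \<in> carrier H\<rbrakk> \<Longrightarrow> ip H y x = cnj (ip H x y)"
    and ip_pos:
      "\<lbrakk>x \<in> carrier H; x \<noteq> \<zero>\<^bsub>H\<^esub>\<rbrakk> \<Longrightarrow> 0 < Re (ip H x x)"
    and complete:
      "Metric_space.mcomplete (carrier H) (hdist H)"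

definition unitary_group :: "'h hilbert \<Rightarrow> ('h \<Rightarrow> 'h) monoid" where
  "unitary_group H = (BijGroup (carrier H))\<lparr>carrier :=
     {U \<in> Bij (carrier H).
        (\<forall>x\<in>carrier H. \<forall>y\<in>carrier H. U (x \<oplus>\<^bsub>H\<^esub> y) = U x \<oplus>\<^bsub>H\<^esub> U y) \<and>
        (\<forall>c. \<forall>x\<in>carrier H. U (c \<odot>\<^bsub>H\<^esub> x) = c \<odot>\<^bsub>H\<^esub> U x) \<and>
        (\<forall>x\<in>carrier H. \<forall>y\<in>carrier H. ip H (U x) (U y) = ip H x y)}\<rparr>"

definition unitary_representation ::
    "'w set \<Rightarrow> ('w \<Rightarrow> 'w) set \<Rightarrow> 'h hilbert \<Rightarrow> (('w \<Rightarrow> 'w) \<Rightarrow> 'h \<Rightarrow> 'h) \<Rightarrow> bool" where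
  "unitary_representation \<Omega> G H \<pi> \<longleftrightarrow>
     \<pi> \<in> hom ((BijGroup \<Omega>)\<lparr>carrier := G\<rparr>) (unitary_group H) \<and>
     (\<forall>\<xi>\<in>carrier H. continuous_map (subtopology (sym_topology \<Omega>) G)
        (Metric_space.mtopology (carrier H) (hdist H)) (\<lambda>g. \<pi> g \<xi>))"

definition fixed_vectors ::
    "('w \<Rightarrow> 'w) set \<Rightarrow> 'h hilbert \<Rightarrow> (('w \<Rightarrow> 'w) \<Rightarrow> 'h \<Rightarrow> 'h) \<Rightarrow> 'w set \<Rightarrow> 'h set" where
  "fixed_vectors G H \<pi> A = {\<xi> \<in> carrier H. \<forall>g\<in>pointwise_stabilizer G A. \<pi> g \<xi> = \<xi>}"

text \<open>Meant for closed linear subspaces \<open>K\<close>, where the described vector exists and is unique.\<close>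

definition orth_proj :: "'h hilbert \<Rightarrow> 'h set \<Rightarrow> 'h \<Rightarrow> 'h" where
  "orth_proj H K \<xi> = (THE \<eta>. \<eta> \<in> K \<and> (\<forall>\<zeta>\<in>K. ip H (\<xi> \<ominus>\<^bsub>H\<^esub> \<eta>) \<zeta> = 0))"

definition dissociated_rep ::
    "'w set \<Rightarrow> ('w \<Rightarrow> 'w) set \<Rightarrow> 'h hilbert \<Rightarrow> (('w \<Rightarrow> 'w) \<Rightarrow> 'h \<Rightarrow> 'h) \<Rightarrow> bool" where
  "dissociated_rep \<Omega> G H \<pi> \<longleftrightarrow>
     (\<forall>A B. finite A \<longrightarrow> A \<subseteq> \<Omega> \<longrightarrow> finite B \<longrightarrow> B \<subseteq> \<Omega> \<longrightarrow>
        (\<forall>\<xi>\<in>carrier H.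
           orth_proj H (fixed_vectors G H \<pi> A) (orth_proj H (fixed_vectors G H \<pi> B) \<xi>) =
           orth_proj H (fixed_vectors G H \<pi> (A \<inter> B)) \<xi>))"


section \<open>Boolean p.m.p. actions\<close>

text \<open>A standard probability space is a standard Borel space (the Borel space of a Polish
  topology on the underlying set) with a probability measure; atoms are allowed.\<close>

definition standard_prob_space :: "'x measure \<Rightarrow> bool" where
  "standard_prob_space M \<longleftrightarrow> prob_space M \<and>
     (\<exists>\<tau>. completely_metrizable_space \<tau> \<and> second_countable \<tau> \<and> topspace \<tau> = space M \<and>
          sets M = sigma_sets (space M) {U. openin \<tau> U})"

definition mp_group :: "'x measure \<Rightarrow> ('x \<Rightarrow> 'x) monoid" where
  "mp_group M = (BijGroup (space M))\<lparr>carrier :=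
     {T \<in> Bij (space M). T \<in> measurable M M \<and> inv_into (space M) T \<in> measurable M M \<and>
        distr M M T = M}\<rparr>"

definition ae_identity :: "'x measure \<Rightarrow> ('x \<Rightarrow> 'x) set" where
  "ae_identity M = {T \<in> carrier (mp_group M). AE x in M. T x = x}"

text \<open>The coset of \<open>T\<close> modulo \<^const>\<open>ae_identity\<close> consists of all elements
  of \<^const>\<open>mp_group\<close> that agree with \<open>T\<close> almost everywhere.\<close>

definition Aut :: "'x measure \<Rightarrow> ('x \<Rightarrow> 'x) set monoid" where
  "Aut M = mp_group M Mod ae_identity M"

text \<open>The weak topology is the one induced by the pseudometrics
  \<open>\<mu>(S Y \<triangle> T Y)\<close>, for \<open>Y\<close> measurable; the
  balls of these pseudometrics form a subbase. The values do not depend on the chosen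
  representatives \<open>S\<close> and \<open>T\<close>.\<close>

definition weak_ball ::
    "'x measure \<Rightarrow> ('x \<Rightarrow> 'x) set \<Rightarrow> 'x set \<Rightarrow> real \<Rightarrow> ('x \<Rightarrow> 'x) set set" where
  "weak_ball M C Y \<epsilon> =
     {D \<in> carrier (Aut M). \<forall>S\<in>D. \<forall>T\<in>C. measure M (sym_diff (S ` Y) (T ` Y)) < \<epsilon>}"

definition weak_topology :: "'x measure \<Rightarrow> ('x \<Rightarrow> 'x) set topology" where
  "weak_topology M =
     topology_generated_by {weak_ball M C Y \<epsilon> | C Y \<epsilon>. C \<in> carrier (Aut M) \<and> Y \<in> sets M \<and> 0 < \<epsilon>}"

definition boolean_pmp_action ::
    "'w set \<Rightarrow> ('w \<Rightarrow> 'w) set \<Rightarrow> 'x measure \<Rightarrow> (('w \<Rightarrow> 'w) \<Rightarrow> ('x \<Rightarrow> 'x) set) \<Rightarrow> bool" where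
  "boolean_pmp_action \<Omega> G M \<alpha> \<longleftrightarrow>
     \<alpha> \<in> hom ((BijGroup \<Omega>)\<lparr>carrier := G\<rparr>) (Aut M) \<and>
     continuous_map (subtopology (sym_topology \<Omega>) G) (weak_topology M) \<alpha>"

text \<open>The family of sets below is already a \<open>\<sigma>\<close>-algebra;
  \<^const>\<open>sigma\<close> only packages it as a measurable space, which is the form in
  which \<^const>\<open>real_cond_exp\<close> takes a sub-\<open>\<sigma>\<close>-algebra.\<close>

definition fixed_algebra ::
    "('w \<Rightarrow> 'w) set \<Rightarrow> 'x measure \<Rightarrow> (('w \<Rightarrow> 'w) \<Rightarrow> ('x \<Rightarrow> 'x) set) \<Rightarrow> 'w set \<Rightarrow> 'x measure" where
  "fixed_algebra G M \<alpha> A =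
     sigma (space M) {Y \<in> sets M. \<forall>g\<in>pointwise_stabilizer G A. \<forall>T\<in>\<alpha> g.
                        measure M (sym_diff (T ` Y) Y) = 0}"

definition dissociated_action ::
    "'w set \<Rightarrow> ('w \<Rightarrow> 'w) set \<Rightarrow> 'x measure \<Rightarrow> (('w \<Rightarrow> 'w) \<Rightarrow> ('x \<Rightarrow> 'x) set) \<Rightarrow> bool" where
  "dissociated_action \<Omega> G M \<alpha> \<longleftrightarrow>
     (\<forall>A B. finite A \<longrightarrow> A \<subseteq> \<Omega> \<longrightarrow> finite B \<longrightarrow> B \<subseteq> \<Omega> \<longrightarrow>
        (\<forall>f::'x \<Rightarrow> real. f \<in> borel_measurable (fixed_algebra G M \<alpha> B) \<longrightarrow>
           integrable M (\<lambda>x. (f x)\<^sup>2) \<longrightarrow>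
           (AE x in M. real_cond_exp M (fixed_algebra G M \<alpha> A) f x =
                       real_cond_exp M (fixed_algebra G M \<alpha> (A \<inter> B)) f x)))"

end

theory Submission
  imports Defs
begin

text \<open>
  Both notions of dissociation say that what is fixed by \<open>G\<^sub>A\<close> and what is fixed by \<open>G\<^sub>B\<close>
  interact only through what is fixed by \<open>G\<^sub>A\<^sub>\<inter>\<^sub>B\<close>; one says it about vectors, the other about
  random variables. Two classical constructions translate between them.

  From an action to a representation. A Boolean action on \<open>(X, \<mu>)\<close> acts unitarily on \<open>L\<^sup>2(X, \<mu>)\<close>
  by \<open>f \<mapsto> f \<circ> g\<^sup>-\<^sup>1\<close>, the Koopman representation. The vectors fixed by \<open>G\<^sub>A\<close> are the
  \<open>F\<^sub>A\<close>-measurable functions, so the projection onto them is the conditional expectation on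
  \<open>F\<^sub>A\<close>, and \<open>p\<^sub>A p\<^sub>B = p\<^sub>A\<^sub>\<inter>\<^sub>B\<close> is conditional independence. Only indicators are needed from the
  Hilbert space side (\<open>indicator_cond_exp\<close>); conditional expectation carries the identity over
  to all square-integrable functions (\<open>dissociated_action_of_rep\<close>). Points of the Hilbert space
  must live in the type \<open>'h\<close>; a class of functions is determined by its integrals over a countable
  generator of the \<open>\<sigma>\<close>-algebra, so there are at most continuum many of them
  (\<open>L2_space_exists\<close>).

  From a representation to an action. Let \<open>\<xi>\<close> be fixed by \<open>G\<^sub>A\<close> and let \<open>\<zeta>\<close> be fixed by \<open>G\<^sub>B\<close> and
  orthogonal to the vectors fixed by \<open>G\<^sub>A\<^sub>\<inter>\<^sub>B\<close>; it has to be shown that \<open>\<xi>\<close> and \<open>\<zeta>\<close> are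
  orthogonal (\<open>dissociated_repI\<close>). Both orbits are countable, because \<open>\<pi>(g) \<xi>\<close> depends only on
  the restriction of \<open>g\<close> to the finite set \<open>A\<close>. Take a centred Gaussian family \<open>(X\<^sub>v)\<close> indexed by the
  two orbits with covariance \<open>E[X\<^sub>v X\<^sub>w] = Re \<langle>v, w\<rangle>\<close>. It exists by Gram--Schmidt
  (\<open>gram_factor\<close>), and its law depends on the covariance only, because characteristic
  functions determine joint laws (\<open>joint_law_unique\<close>). So the group, which permutes the index set
  and preserves the covariance, acts on the sequence space by permuting coordinates and preserves
  the law (\<open>gaussian_law_exists\<close>). Stabilizers of indices are open, hence the action is continuous
  (\<open>shift_continuous\<close>).

  In this action \<open>X\<^sub>\<xi>\<close> is \<open>F\<^sub>A\<close>-measurable and \<open>X\<^sub>\<zeta>\<close> is \<open>F\<^sub>B\<close>-measurable. Dissociation of the action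
  gives \<open>E[X\<^sub>\<xi> X\<^sub>\<zeta>] = E[X\<^sub>\<xi> E[X\<^sub>\<zeta> | F\<^sub>A\<^sub>\<inter>\<^sub>B]]\<close>. The inner conditional expectation vanishes: the
  integral of \<open>X\<^sub>v\<close> over a \<open>G\<^sub>A\<^sub>\<inter>\<^sub>B\<close>-invariant set is a bounded functional of \<open>v\<close> which does not change
  along \<open>G\<^sub>A\<^sub>\<inter>\<^sub>B\<close>-orbits, and such a functional kills every vector orthogonal to the fixed ones
  (\<open>mean_zero_on_invariant_sets\<close>). So \<open>Re \<langle>\<xi>, \<zeta>\<rangle> = 0\<close> (\<open>dissociated_orth\<close>).
\<close>

section \<open>Projections and Gram matrices in Hilbert spaces\<close>

lemma complex_ring_simps [simp]:
  "carrier complex_ring = UNIV" "mult complex_ring = (*)" "one complex_ring = 1"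
  "ring.zero complex_ring = 0" "ring.add complex_ring = (+)"
  by (simp_all add: complex_ring_def)

text \<open>Completeness is left out, because verifying it for a concrete space already uses the norm
  and its metric.\<close>

locale complex_inner_space = module complex_ring H for H :: "'h hilbert" +
  assumes inner_add_left:
      "\<lbrakk>x \<in> carrier H; y \<in> carrier H; z \<in> carrier H\<rbrakk> \<Longrightarrow> ip H (x \<oplus>\<^bsub>H\<^esub> y) z = ip H x z + ip H y z"
    and inner_smult_left:
      "\<lbrakk>x \<in> carrier H; y \<in> carrier H\<rbrakk> \<Longrightarrow> ip H (c \<odot>\<^bsub>H\<^esub> x) y = c * ip H x y"
    and inner_commute:
      "\<lbrakk>x \<in> carrier H; y \<in> carrier H\<rbrakk> \<Longrightarrow> ip H y x = cnj (ip H x y)"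
    and inner_pos:
      "\<lbrakk>x \<in> carrier H; x \<noteq> \<zero>\<^bsub>H\<^esub>\<rbrakk> \<Longrightarrow> 0 < Re (ip H x x)"
begin

lemma ip_zero_left [simp]:
  assumes "y \<in> carrier H" shows "ip H \<zero>\<^bsub>H\<^esub> y = 0"
  using inner_add_left[OF zero_closed zero_closed assms] by simp

lemma ip_minus_left [simp]:
  assumes "x \<in> carrier H" "y \<in> carrier H" shows "ip H (\<ominus>\<^bsub>H\<^esub> x) y = - ip H x y"
proof -
  have "ip H x y + ip H (\<ominus>\<^bsub>H\<^esub> x) y = ip H (x \<oplus>\<^bsub>H\<^esub> (\<ominus>\<^bsub>H\<^esub> x)) y"
    using assms by (simp add: inner_add_left del: M.r_neg)
  also have "\<dots> = 0" using assms by (simp add: M.r_neg)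
  finally show ?thesis by (simp add: add_eq_0_iff2)
qed

lemma smult_in [simp, intro]: "x \<in> carrier H \<Longrightarrow> c \<odot>\<^bsub>H\<^esub> x \<in> carrier H"
  by (rule smult_closed) simp_all

lemma ip_diff_left [simp]:
  assumes "x \<in> carrier H" "y \<in> carrier H" "z \<in> carrier H"
  shows "ip H (x \<ominus>\<^bsub>H\<^esub> y) z = ip H x z - ip H y z"
  using assms by (simp add: a_minus_def inner_add_left)

lemma ip_add_right:
  assumes "x \<in> carrier H" "y \<in> carrier H" "z \<in> carrier H"
  shows "ip H z (x \<oplus>\<^bsub>H\<^esub> y) = ip H z x + ip H z y"
  using assms inner_commute[of "x \<oplus>\<^bsub>H\<^esub> y" z] inner_commute[of x z] inner_commute[of y z]
  by (simp add: inner_add_left)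

lemma ip_smult_right:
  assumes "x \<in> carrier H" "y \<in> carrier H"
  shows "ip H x (c \<odot>\<^bsub>H\<^esub> y) = cnj c * ip H x y"
  using assms inner_commute[of "c \<odot>\<^bsub>H\<^esub> y" x] inner_commute[of y x]
  by (simp add: inner_smult_left)

lemma ip_diff_right [simp]:
  assumes "x \<in> carrier H" "y \<in> carrier H" "z \<in> carrier H"
  shows "ip H z (x \<ominus>\<^bsub>H\<^esub> y) = ip H z x - ip H z y"
  using assms inner_commute[of "x \<ominus>\<^bsub>H\<^esub> y" z] inner_commute[of x z] inner_commute[of y z] by simp

lemma ip_zero_right [simp]: "y \<in> carrier H \<Longrightarrow> ip H y \<zero>\<^bsub>H\<^esub> = 0"
  using inner_commute[of "\<zero>\<^bsub>H\<^esub>" y] by simp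

lemmas ip_linear = inner_add_left ip_add_right inner_smult_left ip_smult_right

lemma Re_ip_commute: "x \<in> carrier H \<Longrightarrow> y \<in> carrier H \<Longrightarrow> Re (ip H y x) = Re (ip H x y)"
  using inner_commute[of x y] by simp

lemma ip_self_nonneg [simp]: "x \<in> carrier H \<Longrightarrow> 0 \<le> Re (ip H x x)"
  using inner_pos[of x] by (cases "x = \<zero>\<^bsub>H\<^esub>") auto

lemma hnorm_power2 [simp]: "x \<in> carrier H \<Longrightarrow> (hnorm H x)\<^sup>2 = Re (ip H x x)"
  by (simp add: hnorm_def)

lemma hnorm_nonneg [simp]: "0 \<le> hnorm H x" if "x \<in> carrier H"
  using that by (simp add: hnorm_def)

lemma ip_self_eq_0: "x \<in> carrier H \<Longrightarrow> Re (ip H x x) = 0 \<Longrightarrow> x = \<zero>\<^bsub>H\<^esub>"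
  using inner_pos[of x] by fastforce

lemma diff_eq_zero_iff:
  "x \<in> carrier H \<Longrightarrow> y \<in> carrier H \<Longrightarrow> x \<ominus>\<^bsub>H\<^esub> y = \<zero>\<^bsub>H\<^esub> \<longleftrightarrow> x = y"
  by (metis M.minus_equality M.minus_minus M.r_neg a_minus_def M.a_inv_closed)

text \<open>Vector identities are checked by testing against all vectors, which turns them into ring
  identities in \<open>\<complex>\<close>.\<close>

lemma vector_eqI:
  assumes "x \<in> carrier H" "y \<in> carrier H" "\<And>z. z \<in> carrier H \<Longrightarrow> ip H x z = ip H y z"
  shows "x = y"
proof -
  have "Re (ip H (x \<ominus>\<^bsub>H\<^esub> y) (x \<ominus>\<^bsub>H\<^esub> y)) = 0"
    using assms by simp
  then show ?thesis
    using ip_self_eq_0[of "x \<ominus>\<^bsub>H\<^esub> y"] diff_eq_zero_iff assms by simp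
qed

lemma Cauchy_Schwarz:
  assumes x: "x \<in> carrier H" and y: "y \<in> carrier H"
  shows "\<bar>Re (ip H x y)\<bar> \<le> hnorm H x * hnorm H y"
proof (cases "y = \<zero>\<^bsub>H\<^esub>")
  case True
  then show ?thesis using x by simp
next
  case False
  define q where "q = Re (ip H y y)"
  define t where "t = Re (ip H x y) / q"
  have q: "q > 0" using inner_pos[OF y False] by (simp add: q_def)
  let ?w = "x \<ominus>\<^bsub>H\<^esub> (complex_of_real t \<odot>\<^bsub>H\<^esub> y)"
  have "0 \<le> Re (ip H ?w ?w)" using x y by (intro ip_self_nonneg) simp
  also have "Re (ip H ?w ?w) = Re (ip H x x) - 2 * t * Re (ip H x y) + t\<^sup>2 * q"
    using x y Re_ip_commute[OF x y] by (simp add: ip_linear q_def power2_eq_square algebra_simps)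
  also have "\<dots> = Re (ip H x x) - (Re (ip H x y))\<^sup>2 / q"
    using q by (simp add: t_def power2_eq_square)
  finally have "(Re (ip H x y))\<^sup>2 \<le> Re (ip H x x) * q"
    using q by (simp add: divide_le_eq)
  then have "(Re (ip H x y))\<^sup>2 \<le> (hnorm H x * hnorm H y)\<^sup>2"
    using x y by (simp add: power_mult_distrib q_def)
  then show ?thesis
    using x y by (metis abs_le_square_iff abs_of_nonneg hnorm_nonneg mult_nonneg_nonneg)
qed

lemma hnorm_triangle:
  assumes x: "x \<in> carrier H" and y: "y \<in> carrier H"
  shows "hnorm H (x \<oplus>\<^bsub>H\<^esub> y) \<le> hnorm H x + hnorm H y"
proof (rule power2_le_imp_le)
  have "(hnorm H (x \<oplus>\<^bsub>H\<^esub> y))\<^sup>2 = Re (ip H x x) + 2 * Re (ip H x y) + Re (ip H y y)"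
    using x y Re_ip_commute[OF x y] by (simp add: ip_linear)
  also have "\<dots> \<le> Re (ip H x x) + 2 * (hnorm H x * hnorm H y) + Re (ip H y y)"
    using Cauchy_Schwarz[OF x y] by simp
  also have "\<dots> = (hnorm H x + hnorm H y)\<^sup>2"
    using x y by (simp add: power2_sum)
  finally show "(hnorm H (x \<oplus>\<^bsub>H\<^esub> y))\<^sup>2 \<le> (hnorm H x + hnorm H y)\<^sup>2" .
qed (use x y in simp)

lemma hnorm_diff_commute:
  assumes "x \<in> carrier H" "y \<in> carrier H"
  shows "hnorm H (x \<ominus>\<^bsub>H\<^esub> y) = hnorm H (y \<ominus>\<^bsub>H\<^esub> x)"
  unfolding hnorm_def using assms by simp

lemma hnorm_diff_triangle:
  assumes x: "x \<in> carrier H" and y: "y \<in> carrier H" and z: "z \<in> carrier H"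
  shows "hnorm H (x \<ominus>\<^bsub>H\<^esub> z) \<le> hnorm H (x \<ominus>\<^bsub>H\<^esub> y) + hnorm H (y \<ominus>\<^bsub>H\<^esub> z)"
proof -
  have "x \<ominus>\<^bsub>H\<^esub> z = (x \<ominus>\<^bsub>H\<^esub> y) \<oplus>\<^bsub>H\<^esub> (y \<ominus>\<^bsub>H\<^esub> z)"
    by (rule vector_eqI) (use x y z in \<open>auto simp: ip_linear\<close>)
  then show ?thesis
    using hnorm_triangle[of "x \<ominus>\<^bsub>H\<^esub> y" "y \<ominus>\<^bsub>H\<^esub> z"] x y z by simp
qed

lemma hnorm_smult:
  assumes "x \<in> carrier H" shows "hnorm H (c \<odot>\<^bsub>H\<^esub> x) = cmod c * hnorm H x"
proof -
  have "ip H (c \<odot>\<^bsub>H\<^esub> x) (c \<odot>\<^bsub>H\<^esub> x) = (c * cnj c) * ip H x x"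
    using assms by (simp add: ip_linear)
  then have "Re (ip H (c \<odot>\<^bsub>H\<^esub> x) (c \<odot>\<^bsub>H\<^esub> x)) = (cmod c)\<^sup>2 * Re (ip H x x)"
    by (simp add: complex_mult_cnj cmod_power2)
  then show ?thesis
    by (simp add: hnorm_def real_sqrt_mult)
qed

lemma hnorm_eq_0: "x \<in> carrier H \<Longrightarrow> hnorm H x = 0 \<longleftrightarrow> x = \<zero>\<^bsub>H\<^esub>"
  using ip_self_eq_0[of x] by (auto simp: hnorm_def)

lemma Metric_space_hdist: "Metric_space (carrier H) (hdist H)"
proof
  show "0 \<le> hdist H x y" for x y
    by (simp add: hdist_def)
  show "hdist H x y = hdist H y x" for x y
    using hnorm_diff_commute by (simp add: hdist_def)
  show "hdist H x y = 0 \<longleftrightarrow> x = y" if "x \<in> carrier H" "y \<in> carrier H" for x y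
    using that by (simp add: hdist_def hnorm_eq_0 diff_eq_zero_iff)
  show "hdist H x z \<le> hdist H x y + hdist H y z"
    if "x \<in> carrier H" "y \<in> carrier H" "z \<in> carrier H" for x y z
    using that hnorm_diff_triangle by (simp add: hdist_def)
qed

sublocale hm: Metric_space "carrier H" "hdist H"
  by (rule Metric_space_hdist)

definition tends :: "(nat \<Rightarrow> 'h) \<Rightarrow> 'h \<Rightarrow> bool" where
  "tends s x \<longleftrightarrow> range s \<subseteq> carrier H \<and> x \<in> carrier H \<and> (\<lambda>n. hnorm H (s n \<ominus>\<^bsub>H\<^esub> x)) \<longlonglongrightarrow> 0"

text \<open>The family after \<open>k\<close> steps of Gram--Schmidt elimination: step \<open>k\<close> removes from all vectors
  their component along the current \<open>k\<close>-th vector. If that vector is zero, the quotient is \<open>0\<close> by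
  convention and nothing is removed.\<close>

primrec gram_schmidt :: "(nat \<Rightarrow> 'h) \<Rightarrow> nat \<Rightarrow> nat \<Rightarrow> 'h" where
  "gram_schmidt v 0 i = v i"
| "gram_schmidt v (Suc k) i = gram_schmidt v k i \<ominus>\<^bsub>H\<^esub>
     (complex_of_real (Re (ip H (gram_schmidt v k i) (gram_schmidt v k k)) / Re (ip H (gram_schmidt v k k) (gram_schmidt v k k))) \<odot>\<^bsub>H\<^esub> gram_schmidt v k k)"

text \<open>A Cholesky factorization of the real Gram matrix. Step \<open>k\<close> of the elimination lowers the Gram
  matrix by the product of the \<open>k\<close>-th column of \<open>a\<close> with its transpose, and the \<open>i\<close>-th vector is used up
  after step \<open>i\<close>; so \<open>a\<close> is triangular and all sums are finite.\<close>

lemma gram_factor: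
  fixes v :: "nat \<Rightarrow> 'h"
  assumes v: "\<And>n. v n \<in> carrier H"
  shows "\<exists>a. (\<forall>i k. i < k \<longrightarrow> a i k = 0) \<and> (\<forall>i j. Re (ip H (v i) (v j)) = (\<Sum>k\<le>i. a i k * a j k))"
proof -
  have w: "gram_schmidt v k i \<in> carrier H" for k i by (induction k arbitrary: i) (use v in auto)
  define q where "q k = Re (ip H (gram_schmidt v k k) (gram_schmidt v k k))" for k
  define a where "a i k = Re (ip H (gram_schmidt v k i) (gram_schmidt v k k)) / sqrt (q k)" for i k
  have q0: "0 \<le> q k" for k using w by (simp add: q_def)
  have step: "Re (ip H (gram_schmidt v (Suc k) i) (gram_schmidt v (Suc k) j)) = Re (ip H (gram_schmidt v k i) (gram_schmidt v k j)) - a i k * a j k" for k i j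
  proof -
    let ?p = "\<lambda>i. Re (ip H (gram_schmidt v k i) (gram_schmidt v k k))"
    have "Re (ip H (gram_schmidt v (Suc k) i) (gram_schmidt v (Suc k) j)) =
        Re (ip H (gram_schmidt v k i) (gram_schmidt v k j)) - ?p j / q k * ?p i - ?p i / q k * ?p j + (?p i / q k) * (?p j / q k) * q k"
      unfolding gram_schmidt.simps q_def using w[of k i] w[of k j] w[of k k] Re_ip_commute[OF w[of k k] w[of k j]]
      by (simp add: ip_linear algebra_simps)
    also have "\<dots> = Re (ip H (gram_schmidt v k i) (gram_schmidt v k j)) - ?p i * ?p j / q k"
      by (cases "q k = 0") (simp_all add: field_simps)
    also have "?p i * ?p j / q k = a i k * a j k" using q0[of k] by (simp add: a_def)
    finally show ?thesis .
  qed
  have r0: "Re (ip H (gram_schmidt v k i) (gram_schmidt v k i)) = 0" if "i < k" for i k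
    using that
  proof (induction k)
    case (Suc k)
    have nn: "0 \<le> Re (ip H (gram_schmidt v (Suc k) i) (gram_schmidt v (Suc k) i))" by (rule ip_self_nonneg[OF w])
    show ?case
    proof (cases "i = k")
      case True
      have "a k k * a k k = q k" using q0[of k] by (simp add: a_def q_def[symmetric] real_div_sqrt)
      then show ?thesis using step[of k i i] True by (simp add: q_def)
    next
      case False
      then have "Re (ip H (gram_schmidt v k i) (gram_schmidt v k i)) = 0" using Suc by simp
      then show ?thesis using step[of k i i] nn by (smt (verit) zero_le_square)
    qed
  qed simp
  have z: "gram_schmidt v k i = \<zero>\<^bsub>H\<^esub>" if "i < k" for i k using ip_self_eq_0[OF w r0[OF that]] .
  have sum: "Re (ip H (v i) (v j)) = (\<Sum>k<n. a i k * a j k) + Re (ip H (gram_schmidt v n i) (gram_schmidt v n j))" for n i j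
  proof (induction n)
    case (Suc n)
    then show ?case by (simp del: gram_schmidt.simps add: step)
  qed simp
  have "Re (ip H (v i) (v j)) = (\<Sum>k\<le>i. a i k * a j k)" for i j
    using sum[of i j "Suc i"] z[of i "Suc i"] w[of "Suc i" j] by (simp add: lessThan_Suc_atMost del: gram_schmidt.simps)
  moreover have "a i k = 0" if "i < k" for i k
    using z[OF that] w by (simp add: a_def)
  ultimately show ?thesis by blast
qed

end

sublocale complex_hilbert_space \<subseteq> complex_inner_space
  by unfold_locales (fact ip_add_left ip_smult_left ip_commute ip_pos)+

context complex_hilbert_space
begin

lemma Cauchy_tends:
  assumes s: "range s \<subseteq> carrier H"
    and c: "\<And>e. 0 < e \<Longrightarrow> \<exists>N. \<forall>m\<ge>N. \<forall>n\<ge>N. hnorm H (s m \<ominus>\<^bsub>H\<^esub> s n) < e"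
  shows "\<exists>x. tends s x"
proof -
  have d: "hdist H (s m) (s n) = hnorm H (s m \<ominus>\<^bsub>H\<^esub> s n)" for m n
    using s by (auto simp: hdist_def)
  have "hm.MCauchy s"
    unfolding hm.MCauchy_def using s c by (force simp: d)
  then obtain x where x: "limitin hm.mtopology s x sequentially"
    using complete hm.mcomplete_def by blast
  then have xc: "x \<in> carrier H" and
    l: "\<And>e. e > 0 \<Longrightarrow> \<forall>\<^sub>F n in sequentially. s n \<in> carrier H \<and> hdist H (s n) x < e"
    by (auto simp: hm.limitin_metric)
  have "(\<lambda>n. hnorm H (s n \<ominus>\<^bsub>H\<^esub> x)) \<longlonglongrightarrow> 0"
  proof (rule LIMSEQ_I)
    fix r :: real assume "0 < r"
    from l[OF this] obtain N where N: "\<And>n. n \<ge> N \<Longrightarrow> hdist H (s n) x < r"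
      by (auto simp: eventually_sequentially)
    have "norm (hnorm H (s n \<ominus>\<^bsub>H\<^esub> x) - 0) < r" if "n \<ge> N" for n
      using N[OF that] s xc range_subsetD[OF s, of n] by (simp add: hdist_def)
    then show "\<exists>no. \<forall>n\<ge>no. norm (hnorm H (s n \<ominus>\<^bsub>H\<^esub> x) - 0) < r"
      by blast
  qed
  then show ?thesis using s xc by (auto simp: tends_def)
qed

text \<open>The real inner product \<open>Re \<langle>x, y\<rangle>\<close> is the one that matters for Gaussian
  variables, so the projection theorem is stated for real subspaces; it contains the complex one.\<close>

definition closed_real_subspace :: "'h set \<Rightarrow> bool" where
  "closed_real_subspace K \<longleftrightarrow> K \<subseteq> carrier H \<and> \<zero>\<^bsub>H\<^esub> \<in> K \<and>
     (\<forall>x\<in>K. \<forall>y\<in>K. x \<oplus>\<^bsub>H\<^esub> y \<in> K) \<and> (\<forall>t. \<forall>x\<in>K. complex_of_real t \<odot>\<^bsub>H\<^esub> x \<in> K) \<and>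
     (\<forall>s x. range s \<subseteq> K \<longrightarrow> tends s x \<longrightarrow> x \<in> K)"

text \<open>By the parallelogram law a sequence in \<open>K\<close> whose distances to \<open>\<xi>\<close> approach the infimum is
  Cauchy. Its limit is a nearest point, and moving it inside \<open>K\<close> cannot decrease the distance, which
  forces orthogonality.\<close>

lemma projection_exists:
  assumes K: "closed_real_subspace K" and xi: "\<xi> \<in> carrier H"
  shows "\<exists>\<eta>\<in>K. \<forall>\<zeta>\<in>K. Re (ip H (\<xi> \<ominus>\<^bsub>H\<^esub> \<eta>) \<zeta>) = 0"
proof -
  have Kc: "K \<subseteq> carrier H" and K0: "\<zero>\<^bsub>H\<^esub> \<in> K"
    and Kadd: "\<And>x y. x \<in> K \<Longrightarrow> y \<in> K \<Longrightarrow> x \<oplus>\<^bsub>H\<^esub> y \<in> K"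
    and Ksc: "\<And>t x. x \<in> K \<Longrightarrow> complex_of_real t \<odot>\<^bsub>H\<^esub> x \<in> K"
    and Kcl: "\<And>s x. range s \<subseteq> K \<Longrightarrow> tends s x \<Longrightarrow> x \<in> K"
    using K by (auto simp: closed_real_subspace_def)
  define Q where "Q k = (hnorm H (\<xi> \<ominus>\<^bsub>H\<^esub> k))\<^sup>2" for k
  define d where "d = Inf (Q ` K)"
  have bdd: "bdd_below (Q ` K)"
    by (rule bdd_belowI[of _ 0]) (auto simp: Q_def)
  have d_le: "d \<le> Q k" if "k \<in> K" for k
    unfolding d_def using bdd that by (intro cInf_lower) auto
  have "\<exists>k\<in>K. Q k < d + 1 / Suc n" for n
  proof -
    have "\<exists>q\<in>Q ` K. q < d + 1 / Suc n"
      unfolding d_def by (rule cInf_lessD) (use K0 in auto)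
    then show ?thesis by auto
  qed
  then obtain s where sK: "\<And>n. s n \<in> K" and sQ: "\<And>n. Q (s n) < d + 1 / Suc n"
    by metis
  have sc: "s n \<in> carrier H" for n using sK Kc by blast
  have par: "(hnorm H (s m \<ominus>\<^bsub>H\<^esub> s n))\<^sup>2 \<le> 2 / Suc m + 2 / Suc n" for m n
  proof -
    let ?w = "complex_of_real (1/2) \<odot>\<^bsub>H\<^esub> (s m \<oplus>\<^bsub>H\<^esub> s n)"
    have "(hnorm H (s m \<ominus>\<^bsub>H\<^esub> s n))\<^sup>2 = 2 * Q (s m) + 2 * Q (s n) - 4 * Q ?w"
      unfolding Q_def using sc[of m] sc[of n] xi
      by (simp add: ip_linear Re_ip_commute[of "s m" \<xi>] Re_ip_commute[of "s n" \<xi>] Re_ip_commute[of "s n" "s m"] algebra_simps)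
    also have "\<dots> \<le> 2 * Q (s m) + 2 * Q (s n) - 4 * d"
      using d_le[OF Ksc[OF Kadd[OF sK sK]], of "1/2" m n] by simp
    also have "\<dots> \<le> 2 / Suc m + 2 / Suc n"
      using sQ[of m] sQ[of n] by simp
    finally show ?thesis .
  qed
  have "\<exists>N. \<forall>m\<ge>N. \<forall>n\<ge>N. hnorm H (s m \<ominus>\<^bsub>H\<^esub> s n) < e" if e: "0 < e" for e
  proof -
    obtain N where N: "4 / e\<^sup>2 < real (Suc N)"
      by (metis reals_Archimedean2 less_trans lessI of_nat_less_iff)
    show ?thesis
    proof (intro exI allI impI)
      fix m n assume mn: "N \<le> m" "N \<le> n"
      have "2 / real (Suc m) \<le> 2 / real (Suc N)" "2 / real (Suc n) \<le> 2 / real (Suc N)"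
        using mn by (auto intro!: divide_left_mono)
      then have "(hnorm H (s m \<ominus>\<^bsub>H\<^esub> s n))\<^sup>2 \<le> 4 / Suc N"
        using par[of m n] by simp
      also have "\<dots> < e\<^sup>2"
        using N e by (simp add: field_simps)
      finally show "hnorm H (s m \<ominus>\<^bsub>H\<^esub> s n) < e"
        using e by (simp add: power2_less_imp_less)
    qed
  qed
  then obtain \<eta> where t: "tends s \<eta>"
    using Cauchy_tends[of s] sc by blast
  then have eK: "\<eta> \<in> K" using Kcl sK by blast
  then have ec: "\<eta> \<in> carrier H" using Kc by blast
  have lim: "(\<lambda>n. sqrt (d + 1 / Suc n) + hnorm H (s n \<ominus>\<^bsub>H\<^esub> \<eta>)) \<longlonglongrightarrow> sqrt (d + 0) + 0"
    using t by (intro tendsto_intros LIMSEQ_Suc[OF lim_1_over_n]) (auto simp: tends_def)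
  have "hnorm H (\<xi> \<ominus>\<^bsub>H\<^esub> \<eta>) \<le> sqrt (d + 0) + 0"
  proof (rule LIMSEQ_le_const[OF lim], intro exI allI impI)
    fix n
    have "hnorm H (\<xi> \<ominus>\<^bsub>H\<^esub> \<eta>) \<le> hnorm H (\<xi> \<ominus>\<^bsub>H\<^esub> s n) + hnorm H (s n \<ominus>\<^bsub>H\<^esub> \<eta>)"
      using xi ec sc by (intro hnorm_diff_triangle)
    moreover have "hnorm H (\<xi> \<ominus>\<^bsub>H\<^esub> s n) \<le> sqrt (d + 1 / Suc n)"
      using sQ[of n] by (intro real_le_rsqrt) (simp add: Q_def)
    ultimately show "hnorm H (\<xi> \<ominus>\<^bsub>H\<^esub> \<eta>) \<le> sqrt (d + 1 / Suc n) + hnorm H (s n \<ominus>\<^bsub>H\<^esub> \<eta>)"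
      by simp
  qed
  moreover have "0 \<le> d" unfolding d_def by (rule cInf_greatest) (use K0 in \<open>auto simp: Q_def\<close>)
  ultimately have "Q \<eta> \<le> d"
    unfolding Q_def using xi ec
    by (metis add.right_neutral hnorm_nonneg power_mono real_sqrt_pow2 M.minus_closed)
  then have min: "Q \<eta> \<le> Q k" if "k \<in> K" for k using d_le[OF that] by simp
  show ?thesis
  proof (intro bexI[OF _ eK] ballI)
    fix \<zeta> assume z: "\<zeta> \<in> K"
    then have zc: "\<zeta> \<in> carrier H" using Kc by blast
    define a where "a = Re (ip H (\<xi> \<ominus>\<^bsub>H\<^esub> \<eta>) \<zeta>)"
    define b where "b = Re (ip H \<zeta> \<zeta>)"
    have ineq: "0 \<le> t\<^sup>2 * b - 2 * t * a" for t
    proof -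
      have "Q \<eta> \<le> Q (\<eta> \<oplus>\<^bsub>H\<^esub> (complex_of_real t \<odot>\<^bsub>H\<^esub> \<zeta>))"
        using eK z by (intro min Kadd Ksc)
      also have "\<dots> = Q \<eta> + t\<^sup>2 * b - 2 * t * a"
        unfolding Q_def a_def b_def using xi ec zc
        by (simp add: ip_linear Re_ip_commute[of \<eta> \<xi>] Re_ip_commute[of \<zeta> \<xi>] Re_ip_commute[of \<zeta> \<eta>]
            algebra_simps) (simp add: power2_eq_square)
      finally show ?thesis by simp
    qed
    have b0: "0 \<le> b" using zc by (simp add: b_def)
    \<comment> \<open>The denominator \<open>b + 1\<close> in place of \<open>b\<close> covers the case that \<open>\<zeta>\<close> vanishes.\<close>
    define c where "c = a / (b + 1)"
    have a: "a = c * (b + 1)" using b0 by (simp add: c_def)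
    have "0 \<le> c\<^sup>2 * b - 2 * c * a" by (rule ineq)
    also have "\<dots> = - (c\<^sup>2 * (b + 2))"
      by (simp add: a power2_eq_square algebra_simps)
    finally have "c\<^sup>2 * (b + 2) \<le> 0" by simp
    then have "c = 0" using b0 by (simp add: mult_le_0_iff)
    then show "a = 0" by (simp add: a)
  qed
qed

definition norm_closure :: "'h set \<Rightarrow> 'h set" where
  "norm_closure S = {x \<in> carrier H. \<forall>e>0. \<exists>s\<in>S. hnorm H (x \<ominus>\<^bsub>H\<^esub> s) < e}"

lemma norm_closure_superset: "S \<subseteq> carrier H \<Longrightarrow> S \<subseteq> norm_closure S"
proof
  fix x assume "S \<subseteq> carrier H" and x: "x \<in> S"
  then have c: "x \<in> carrier H" by auto
  then have "x \<ominus>\<^bsub>H\<^esub> x = \<zero>\<^bsub>H\<^esub>" by (simp add: diff_eq_zero_iff)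
  then have "hnorm H (x \<ominus>\<^bsub>H\<^esub> x) = 0" by (simp add: hnorm_eq_0)
  then show "x \<in> norm_closure S" using c x by (auto simp: norm_closure_def intro!: bexI[of _ x])
qed

lemma norm_closure_subspace:
  assumes S: "S \<subseteq> carrier H" and zero: "\<zero>\<^bsub>H\<^esub> \<in> S"
    and add: "\<And>x y. x \<in> S \<Longrightarrow> y \<in> S \<Longrightarrow> x \<oplus>\<^bsub>H\<^esub> y \<in> S"
    and scale: "\<And>t x. x \<in> S \<Longrightarrow> complex_of_real t \<odot>\<^bsub>H\<^esub> x \<in> S"
  shows "closed_real_subspace (norm_closure S)"
  unfolding closed_real_subspace_def norm_closure_def
proof (intro conjI ballI allI impI)
  let ?K = "{x \<in> carrier H. \<forall>e>0. \<exists>s\<in>S. hnorm H (x \<ominus>\<^bsub>H\<^esub> s) < e}"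
  show "?K \<subseteq> carrier H" by auto
  show "\<zero>\<^bsub>H\<^esub> \<in> ?K" using norm_closure_superset[OF S] zero by (auto simp: norm_closure_def)
  show "x \<oplus>\<^bsub>H\<^esub> y \<in> ?K" if x: "x \<in> ?K" and y: "y \<in> ?K" for x y
  proof (intro CollectI conjI allI impI)
    show "x \<oplus>\<^bsub>H\<^esub> y \<in> carrier H" using x y by simp
    fix e :: real assume "0 < e"
    then have e2: "0 < e / 2" by simp
    obtain s where s: "s \<in> S" "hnorm H (x \<ominus>\<^bsub>H\<^esub> s) < e / 2" using x e2 by blast
    obtain t where t: "t \<in> S" "hnorm H (y \<ominus>\<^bsub>H\<^esub> t) < e / 2" using y e2 by blast
    have c: "x \<in> carrier H" "y \<in> carrier H" "s \<in> carrier H" "t \<in> carrier H" using x y s t S by auto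
    have "(x \<oplus>\<^bsub>H\<^esub> y) \<ominus>\<^bsub>H\<^esub> (s \<oplus>\<^bsub>H\<^esub> t) = (x \<ominus>\<^bsub>H\<^esub> s) \<oplus>\<^bsub>H\<^esub> (y \<ominus>\<^bsub>H\<^esub> t)"
      by (rule vector_eqI) (use c in \<open>auto simp: ip_linear\<close>)
    then have "hnorm H ((x \<oplus>\<^bsub>H\<^esub> y) \<ominus>\<^bsub>H\<^esub> (s \<oplus>\<^bsub>H\<^esub> t)) < e"
      using hnorm_triangle[of "x \<ominus>\<^bsub>H\<^esub> s" "y \<ominus>\<^bsub>H\<^esub> t"] c s(2) t(2) by simp
    then show "\<exists>u\<in>S. hnorm H ((x \<oplus>\<^bsub>H\<^esub> y) \<ominus>\<^bsub>H\<^esub> u) < e" using add[OF s(1) t(1)] by blast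
  qed
  show "complex_of_real r \<odot>\<^bsub>H\<^esub> x \<in> ?K" if x: "x \<in> ?K" for r x
  proof (intro CollectI conjI allI impI)
    show "complex_of_real r \<odot>\<^bsub>H\<^esub> x \<in> carrier H" using x by simp
    fix e :: real assume e: "0 < e"
    then have "0 < e / (\<bar>r\<bar> + 1)" by (simp add: add_nonneg_pos)
    then obtain s where s: "s \<in> S" "hnorm H (x \<ominus>\<^bsub>H\<^esub> s) < e / (\<bar>r\<bar> + 1)" using x by blast
    have c: "x \<in> carrier H" "s \<in> carrier H" using x s S by auto
    have "(complex_of_real r \<odot>\<^bsub>H\<^esub> x) \<ominus>\<^bsub>H\<^esub> (complex_of_real r \<odot>\<^bsub>H\<^esub> s) = complex_of_real r \<odot>\<^bsub>H\<^esub> (x \<ominus>\<^bsub>H\<^esub> s)"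
      by (rule vector_eqI) (use c in \<open>auto simp: ip_linear algebra_simps\<close>)
    then have "hnorm H ((complex_of_real r \<odot>\<^bsub>H\<^esub> x) \<ominus>\<^bsub>H\<^esub> (complex_of_real r \<odot>\<^bsub>H\<^esub> s)) = \<bar>r\<bar> * hnorm H (x \<ominus>\<^bsub>H\<^esub> s)"
      using c by (simp add: hnorm_smult)
    also have "\<dots> \<le> \<bar>r\<bar> * (e / (\<bar>r\<bar> + 1))" using s(2) by (intro mult_left_mono) auto
    also have "\<dots> < e" using e by (simp add: field_simps)
    finally show "\<exists>u\<in>S. hnorm H ((complex_of_real r \<odot>\<^bsub>H\<^esub> x) \<ominus>\<^bsub>H\<^esub> u) < e" using scale[OF s(1)] by blast
  qed
  show "x \<in> ?K" if u: "range u \<subseteq> ?K" and t: "tends u x" for u x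
  proof (intro CollectI conjI allI impI)
    show x: "x \<in> carrier H" using t by (simp add: tends_def)
    fix e :: real assume "0 < e"
    then have e2: "0 < e / 2" by simp
    have "\<forall>\<^sub>F n in sequentially. hnorm H (u n \<ominus>\<^bsub>H\<^esub> x) < e / 2"
      using t e2 by (intro order_tendstoD(2)[of _ 0]) (auto simp: tends_def)
    then obtain n where n: "hnorm H (u n \<ominus>\<^bsub>H\<^esub> x) < e / 2" by (auto simp: eventually_sequentially)
    have uK: "u n \<in> ?K" using u by blast
    then obtain s where s: "s \<in> S" "hnorm H (u n \<ominus>\<^bsub>H\<^esub> s) < e / 2" using e2 by blast
    have c: "u n \<in> carrier H" "s \<in> carrier H" using uK s S by auto
    have "hnorm H (x \<ominus>\<^bsub>H\<^esub> s) < e"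
      using hnorm_diff_triangle[OF x c] hnorm_diff_commute[OF x c(1)] n s(2) by linarith
    then show "\<exists>s\<in>S. hnorm H (x \<ominus>\<^bsub>H\<^esub> s) < e" using s(1) by blast
  qed
qed

definition closed_subspace :: "'h set \<Rightarrow> bool" where
  "closed_subspace K \<longleftrightarrow> closed_real_subspace K \<and> (\<forall>c. \<forall>x\<in>K. c \<odot>\<^bsub>H\<^esub> x \<in> K)"

lemma Re_orth_imp_orth:
  assumes "x \<in> carrier H" "\<And>z. z \<in> K \<Longrightarrow> Re (ip H x z) = 0" "K \<subseteq> carrier H"
    "\<And>c z. z \<in> K \<Longrightarrow> c \<odot>\<^bsub>H\<^esub> z \<in> K" "z \<in> K"
  shows "ip H x z = 0"
proof -
  have "Re (ip H x (\<i> \<odot>\<^bsub>H\<^esub> z)) = 0" "Re (ip H x z) = 0" using assms by blast+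
  moreover have "ip H x (\<i> \<odot>\<^bsub>H\<^esub> z) = - \<i> * ip H x z"
    using assms by (subst ip_smult_right) auto
  ultimately show ?thesis by (simp add: complex_eq_iff)
qed

lemma orth_proj_eqI:
  assumes K: "closed_subspace K" and xi: "\<xi> \<in> carrier H"
    and e: "\<eta> \<in> K" "\<And>\<zeta>. \<zeta> \<in> K \<Longrightarrow> ip H (\<xi> \<ominus>\<^bsub>H\<^esub> \<eta>) \<zeta> = 0"
  shows "orth_proj H K \<xi> = \<eta>"
  unfolding orth_proj_def
proof (rule the_equality)
  show "\<eta> \<in> K \<and> (\<forall>\<zeta>\<in>K. ip H (\<xi> \<ominus>\<^bsub>H\<^esub> \<eta>) \<zeta> = 0)" using e by blast
next
  fix \<theta> assume t: "\<theta> \<in> K \<and> (\<forall>\<zeta>\<in>K. ip H (\<xi> \<ominus>\<^bsub>H\<^esub> \<theta>) \<zeta> = 0)"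
  have Kc: "K \<subseteq> carrier H" using K by (auto simp: closed_subspace_def closed_real_subspace_def)
  have c: "\<theta> \<in> carrier H" "\<eta> \<in> carrier H" using t e Kc by auto
  have "ip H (\<theta> \<ominus>\<^bsub>H\<^esub> \<eta>) \<zeta> = 0" if "\<zeta> \<in> K" for \<zeta>
    using t e(2)[OF that] that c xi Kc by (auto dest!: bspec[where x=\<zeta>])
  then have "ip H (\<theta> \<ominus>\<^bsub>H\<^esub> \<eta>) \<theta> = 0" "ip H (\<theta> \<ominus>\<^bsub>H\<^esub> \<eta>) \<eta> = 0" using t e by blast+
  then have "Re (ip H (\<theta> \<ominus>\<^bsub>H\<^esub> \<eta>) (\<theta> \<ominus>\<^bsub>H\<^esub> \<eta>)) = 0" using c by simp
  then show "\<theta> = \<eta>" using ip_self_eq_0[of "\<theta> \<ominus>\<^bsub>H\<^esub> \<eta>"] c diff_eq_zero_iff by simp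
qed

lemma orth_proj:
  assumes K: "closed_subspace K" and xi: "\<xi> \<in> carrier H"
  shows orth_proj_in: "orth_proj H K \<xi> \<in> K"
    and orth_proj_orth: "\<And>\<zeta>. \<zeta> \<in> K \<Longrightarrow> ip H (\<xi> \<ominus>\<^bsub>H\<^esub> orth_proj H K \<xi>) \<zeta> = 0"
proof -
  have Kc: "K \<subseteq> carrier H" and sc: "\<And>c z. z \<in> K \<Longrightarrow> c \<odot>\<^bsub>H\<^esub> z \<in> K"
    using K by (auto simp: closed_subspace_def closed_real_subspace_def)
  obtain \<eta> where e: "\<eta> \<in> K" "\<And>\<zeta>. \<zeta> \<in> K \<Longrightarrow> Re (ip H (\<xi> \<ominus>\<^bsub>H\<^esub> \<eta>) \<zeta>) = 0"
    using projection_exists[of K \<xi>] K xi by (auto simp: closed_subspace_def)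
  have o: "ip H (\<xi> \<ominus>\<^bsub>H\<^esub> \<eta>) \<zeta> = 0" if "\<zeta> \<in> K" for \<zeta>
    using e xi Kc that sc by (intro Re_orth_imp_orth[of _ K]) auto
  have eq: "orth_proj H K \<xi> = \<eta>" using orth_proj_eqI[OF K xi e(1) o] .
  show "orth_proj H K \<xi> \<in> K" "\<And>\<zeta>. \<zeta> \<in> K \<Longrightarrow> ip H (\<xi> \<ominus>\<^bsub>H\<^esub> orth_proj H K \<xi>) \<zeta> = 0"
    unfolding eq using e o by auto
qed

end

section \<open>Square-integrable functions as a Hilbert space on a given type\<close>

definition L2 :: "'x measure \<Rightarrow> ('x \<Rightarrow> complex) set" where
  "L2 M = {f \<in> borel_measurable M. integrable M (\<lambda>x. (cmod (f x))\<^sup>2)}"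

lemma cring_complex_ring: "cring complex_ring"
proof (rule cringI)
  show "abelian_group complex_ring"
    by (rule abelian_groupI) (auto intro!: exI[of _ "- _"])
  show "Group.comm_monoid complex_ring"
    by (rule comm_monoidI) auto
qed (auto simp: algebra_simps)

lemma L2_measurable: "f \<in> L2 M \<Longrightarrow> f \<in> borel_measurable M"
  by (simp add: L2_def)

lemma borel_measurable_cnj [measurable]: "cnj \<in> borel_measurable borel"
  by (intro borel_measurable_continuous_onI continuous_intros)

lemma L2_smult:
  assumes "f \<in> L2 M" shows "(\<lambda>x. c * f x) \<in> L2 M"
  using assms by (auto simp: L2_def norm_mult power_mult_distrib)

lemma L2_add:
  assumes f: "f \<in> L2 M" and g: "g \<in> L2 M" shows "(\<lambda>x. f x + g x) \<in> L2 M"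
proof -
  have [measurable]: "f \<in> borel_measurable M" "g \<in> borel_measurable M"
    using f g by (auto simp: L2_def)
  have "integrable M (\<lambda>x. 2 * (cmod (f x))\<^sup>2 + 2 * (cmod (g x))\<^sup>2)"
    using f g by (auto simp: L2_def)
  moreover have "(cmod (f x + g x))\<^sup>2 \<le> 2 * (cmod (f x))\<^sup>2 + 2 * (cmod (g x))\<^sup>2" for x
  proof -
    have "(cmod (f x + g x))\<^sup>2 \<le> (cmod (f x) + cmod (g x))\<^sup>2"
      by (intro power_mono norm_triangle_ineq) simp
    also have "\<dots> \<le> 2 * (cmod (f x))\<^sup>2 + 2 * (cmod (g x))\<^sup>2"
      using sum_squares_bound[of "cmod (f x)" "cmod (g x)"] by (simp add: power2_sum)
    finally show ?thesis .
  qed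
  ultimately have "integrable M (\<lambda>x. (cmod (f x + g x))\<^sup>2)"
    by (auto intro: Bochner_Integration.integrable_bound)
  then show ?thesis by (simp add: L2_def)
qed

lemma L2_diff:
  assumes "f \<in> L2 M" "g \<in> L2 M" shows "(\<lambda>x. f x - g x) \<in> L2 M"
  using L2_add[OF assms(1) L2_smult[OF assms(2), of "-1"]] by simp

lemma L2_prod_integrable:
  assumes f: "f \<in> L2 M" and g: "g \<in> L2 M" shows "integrable M (\<lambda>x. f x * cnj (g x))"
proof -
  have [measurable]: "f \<in> borel_measurable M" "g \<in> borel_measurable M"
    using f g by (auto simp: L2_def)
  have "integrable M (\<lambda>x. (cmod (f x))\<^sup>2 + (cmod (g x))\<^sup>2)"
    using f g by (auto simp: L2_def)
  moreover have "norm (f x * cnj (g x)) \<le> (cmod (f x))\<^sup>2 + (cmod (g x))\<^sup>2" for x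
    using sum_squares_bound[of "cmod (f x)" "cmod (g x)"]
      mult_nonneg_nonneg[OF norm_ge_zero[of "f x"] norm_ge_zero[of "g x"]]
    by (simp only: norm_mult complex_mod_cnj)
  ultimately show ?thesis
    by (auto intro!: Bochner_Integration.integrable_bound[of M "\<lambda>x. (cmod (f x))\<^sup>2 + (cmod (g x))\<^sup>2"])
qed

context prob_space begin

lemma L2_bounded:
  assumes "f \<in> borel_measurable M" "\<And>x. x \<in> space M \<Longrightarrow> cmod (f x) \<le> B"
  shows "f \<in> L2 M"
proof -
  have [measurable]: "f \<in> borel_measurable M" by fact
  have "integrable M (\<lambda>x. (cmod (f x))\<^sup>2)"
    by (rule integrable_const_bound[of _ "B\<^sup>2"]) (auto intro!: AE_I2 power_mono assms(2))
  then show ?thesis by (simp add: L2_def)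
qed

lemma L2_integrable:
  assumes f: "f \<in> L2 M" shows "integrable M f"
proof -
  have "(\<lambda>_. 1) \<in> L2 M" by (rule L2_bounded[of _ 1]) auto
  from L2_prod_integrable[OF f this] show ?thesis by simp
qed

end

text \<open>The points are codes of classes of functions: \<open>enc\<close> is meant to identify exactly the functions
  that agree almost everywhere. The inverse choice of a representative makes the operations
  total functions of codes.\<close>

definition L2_hilbert :: "'x measure \<Rightarrow> (('x \<Rightarrow> complex) \<Rightarrow> 'h) \<Rightarrow> 'h hilbert" where
  "L2_hilbert M enc =
    (let dec = inv_into (L2 M) enc in
     \<lparr>carrier = enc ` L2 M, mult = undefined, one = undefined, ring.zero = enc (\<lambda>_. 0),
      ring.add = (\<lambda>a b. enc (\<lambda>x. dec a x + dec b x)),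
      smult = (\<lambda>c a. enc (\<lambda>x. c * dec a x)),
      ip = (\<lambda>a b. \<integral>x. dec a x * cnj (dec b x) \<partial>M)\<rparr>)"

locale L2_space = prob_space M for M :: "'x measure" +
  fixes enc :: "('x \<Rightarrow> complex) \<Rightarrow> 'h"
  assumes enc_eq_iff: "\<And>f g. f \<in> L2 M \<Longrightarrow> g \<in> L2 M \<Longrightarrow> enc f = enc g \<longleftrightarrow> (AE x in M. f x = g x)"
begin

abbreviation "LH \<equiv> L2_hilbert M enc"

definition dec :: "'h \<Rightarrow> 'x \<Rightarrow> complex" where "dec = inv_into (L2 M) enc"

lemma LH_simps:
  "carrier LH = enc ` L2 M" "\<zero>\<^bsub>LH\<^esub> = enc (\<lambda>_. 0)"
  "a \<oplus>\<^bsub>LH\<^esub> b = enc (\<lambda>x. dec a x + dec b x)"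
  "c \<odot>\<^bsub>LH\<^esub> a = enc (\<lambda>x. c * dec a x)"
  "ip LH a b = (\<integral>x. dec a x * cnj (dec b x) \<partial>M)"
  by (simp_all add: L2_hilbert_def Let_def dec_def)

lemma dec_in: "a \<in> carrier LH \<Longrightarrow> dec a \<in> L2 M"
  by (simp add: LH_simps dec_def inv_into_into)

lemma enc_in [simp]: "f \<in> L2 M \<Longrightarrow> enc f \<in> carrier LH"
  by (simp add: LH_simps)

lemma enc_dec: "a \<in> carrier LH \<Longrightarrow> enc (dec a) = a"
  by (simp add: LH_simps dec_def f_inv_into_f)

lemma dec_enc: "f \<in> L2 M \<Longrightarrow> AE x in M. dec (enc f) x = f x"
  using enc_eq_iff[of "dec (enc f)" f] dec_in[of "enc f"] enc_dec[of "enc f"] by simp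

lemma enc_cong: "f \<in> L2 M \<Longrightarrow> g \<in> L2 M \<Longrightarrow> AE x in M. f x = g x \<Longrightarrow> enc f = enc g"
  using enc_eq_iff by blast

lemma zero_L2 [simp]: "(\<lambda>_. 0) \<in> L2 M"
  by (simp add: L2_def)

lemma enc_add:
  assumes "f \<in> L2 M" "g \<in> L2 M" shows "enc f \<oplus>\<^bsub>LH\<^esub> enc g = enc (\<lambda>x. f x + g x)"
  unfolding LH_simps using dec_enc[OF assms(1)] dec_enc[OF assms(2)]
  by (intro enc_cong L2_add assms dec_in enc_in) auto

lemma enc_smult:
  assumes "f \<in> L2 M" shows "c \<odot>\<^bsub>LH\<^esub> enc f = enc (\<lambda>x. c * f x)"
  unfolding LH_simps using dec_enc[OF assms(1)]
  by (intro enc_cong L2_smult assms dec_in enc_in) auto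

lemma ip_enc:
  assumes f: "f \<in> L2 M" and g: "g \<in> L2 M"
  shows "ip LH (enc f) (enc g) = (\<integral>x. f x * cnj (g x) \<partial>M)"
  unfolding LH_simps
proof (rule integral_cong_AE)
  show "AE x in M. dec (enc f) x * cnj (dec (enc g) x) = f x * cnj (g x)"
    using dec_enc[OF f] dec_enc[OF g] by auto
qed (use L2_measurable[OF f] L2_measurable[OF g] L2_measurable[OF dec_in[OF enc_in[OF f]]]
    L2_measurable[OF dec_in[OF enc_in[OF g]]] in measurable)

lemma abelian_group_LH: "abelian_group LH"
proof (rule abelian_groupI)
  show "\<And>x y. x \<in> carrier LH \<Longrightarrow> y \<in> carrier LH \<Longrightarrow> x \<oplus>\<^bsub>LH\<^esub> y \<in> carrier LH"
    by (auto simp: LH_simps intro!: imageI L2_add dec_in[unfolded LH_simps])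
  show "\<zero>\<^bsub>LH\<^esub> \<in> carrier LH" by (auto simp: LH_simps)
  fix x y z assume c: "x \<in> carrier LH" "y \<in> carrier LH" "z \<in> carrier LH"
  then obtain f g h where f: "f \<in> L2 M" "g \<in> L2 M" "h \<in> L2 M"
    and x: "x = enc f" "y = enc g" "z = enc h" by (auto simp: LH_simps(1))
  show "x \<oplus>\<^bsub>LH\<^esub> y \<oplus>\<^bsub>LH\<^esub> z = x \<oplus>\<^bsub>LH\<^esub> (y \<oplus>\<^bsub>LH\<^esub> z)"
    using f by (simp add: x enc_add L2_add add.assoc)
  show "x \<oplus>\<^bsub>LH\<^esub> y = y \<oplus>\<^bsub>LH\<^esub> x"
    using f by (simp add: x enc_add L2_add add.commute)
  show "\<zero>\<^bsub>LH\<^esub> \<oplus>\<^bsub>LH\<^esub> x = x"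
    using f by (simp add: x enc_add LH_simps(2))
  show "\<exists>y\<in>carrier LH. y \<oplus>\<^bsub>LH\<^esub> x = \<zero>\<^bsub>LH\<^esub>"
    by (rule bexI[of _ "enc (\<lambda>x. -1 * f x)"])
      (use f L2_smult[OF f(1), of "-1"] in \<open>simp_all add: x enc_add LH_simps(2)\<close>)
qed

lemma module_LH: "module complex_ring LH"
proof (rule moduleI[OF cring_complex_ring abelian_group_LH])
  fix a b :: complex and x y assume c: "x \<in> carrier LH" "y \<in> carrier LH"
  then obtain f g where f: "f \<in> L2 M" "g \<in> L2 M"
    and x: "x = enc f" "y = enc g" by (auto simp: LH_simps(1))
  have af: "\<And>a f. f \<in> L2 M \<Longrightarrow> (\<lambda>x. a * f x) \<in> L2 M" by (rule L2_smult)
  show "a \<odot>\<^bsub>LH\<^esub> (x \<oplus>\<^bsub>LH\<^esub> y) = a \<odot>\<^bsub>LH\<^esub> x \<oplus>\<^bsub>LH\<^esub> a \<odot>\<^bsub>LH\<^esub> y"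
    using f by (simp add: x enc_add enc_smult af L2_add distrib_left)
next
  fix a b :: complex and x assume c: "x \<in> carrier LH"
  then obtain f where f: "f \<in> L2 M" and x: "x = enc f" by (auto simp: LH_simps(1))
  have af: "\<And>a f. f \<in> L2 M \<Longrightarrow> (\<lambda>x. a * f x) \<in> L2 M" by (rule L2_smult)
  show "a \<odot>\<^bsub>LH\<^esub> x \<in> carrier LH" using f by (simp add: x enc_smult af)
  show "(a \<oplus>\<^bsub>complex_ring\<^esub> b) \<odot>\<^bsub>LH\<^esub> x = a \<odot>\<^bsub>LH\<^esub> x \<oplus>\<^bsub>LH\<^esub> b \<odot>\<^bsub>LH\<^esub> x"
    using f by (simp add: x enc_add enc_smult af distrib_right)
  show "(a \<otimes>\<^bsub>complex_ring\<^esub> b) \<odot>\<^bsub>LH\<^esub> x = a \<odot>\<^bsub>LH\<^esub> (b \<odot>\<^bsub>LH\<^esub> x)"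
    using f by (simp add: x enc_smult af mult.assoc)
  show "\<one>\<^bsub>complex_ring\<^esub> \<odot>\<^bsub>LH\<^esub> x = x" using f by (simp add: x enc_smult)
qed

lemma ip_enc_self:
  assumes f: "f \<in> L2 M" shows "Re (ip LH (enc f) (enc f)) = (\<integral>x. (cmod (f x))\<^sup>2 \<partial>M)"
proof -
  have "ip LH (enc f) (enc f) = (\<integral>x. complex_of_real ((cmod (f x))\<^sup>2) \<partial>M)"
    using f by (simp add: ip_enc complex_norm_square del: of_real_power)
  then show ?thesis by (simp only: integral_complex_of_real Re_complex_of_real)
qed

lemma inner_LH: "complex_inner_space LH"
proof (intro complex_inner_space.intro[OF module_LH] complex_inner_space_axioms.intro)
  fix x y z and c :: complex
  { assume c: "x \<in> carrier LH" "y \<in> carrier LH" "z \<in> carrier LH"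
    then obtain f g h where f: "f \<in> L2 M" "g \<in> L2 M" "h \<in> L2 M"
      and x: "x = enc f" "y = enc g" "z = enc h" by (auto simp: LH_simps(1))
    show "ip LH (x \<oplus>\<^bsub>LH\<^esub> y) z = ip LH x z + ip LH y z"
      using f by (simp add: x enc_add ip_enc L2_add distrib_right L2_prod_integrable) }
  { assume c: "x \<in> carrier LH" "y \<in> carrier LH"
    then obtain f g where f: "f \<in> L2 M" "g \<in> L2 M"
      and x: "x = enc f" "y = enc g" by (auto simp: LH_simps(1))
    show "ip LH (c \<odot>\<^bsub>LH\<^esub> x) y = c * ip LH x y"
      using f by (simp add: x enc_smult ip_enc L2_smult mult.assoc L2_prod_integrable)
    show "ip LH y x = cnj (ip LH x y)"
      using f Bochner_Integration.integral_cnj[of M "\<lambda>x. f x * cnj (g x)"] by (simp add: x ip_enc mult.commute) }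
  { assume c: "x \<in> carrier LH" "x \<noteq> \<zero>\<^bsub>LH\<^esub>"
    then obtain f where f: "f \<in> L2 M" and x: "x = enc f" by (auto simp: LH_simps(1))
    have "\<not> (AE x in M. (cmod (f x))\<^sup>2 = 0)"
      using c(2) f enc_eq_iff[OF f zero_L2] by (auto simp: x LH_simps(2))
    then have "(\<integral>x. (cmod (f x))\<^sup>2 \<partial>M) \<noteq> 0"
      using f by (subst integral_nonneg_eq_0_iff_AE) (auto simp: L2_def)
    moreover have "(\<integral>x. (cmod (f x))\<^sup>2 \<partial>M) \<ge> 0" by (rule integral_nonneg_AE) simp
    ultimately have "(\<integral>x. (cmod (f x))\<^sup>2 \<partial>M) > 0" by linarith
    then show "0 < Re (ip LH x x)"
      using f by (simp add: x ip_enc_self) }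
qed

sublocale LH: complex_inner_space LH
  by (rule inner_LH)

lemma enc_diff:
  assumes "f \<in> L2 M" "g \<in> L2 M" shows "enc f \<ominus>\<^bsub>LH\<^esub> enc g = enc (\<lambda>x. f x - g x)"
proof (rule LH.vector_eqI)
  fix z assume "z \<in> carrier LH"
  then obtain h where h: "h \<in> L2 M" and z: "z = enc h" by (auto simp: LH_simps(1))
  show "ip LH (enc f \<ominus>\<^bsub>LH\<^esub> enc g) z = ip LH (enc (\<lambda>x. f x - g x)) z"
    using assms h by (simp add: z ip_enc L2_diff left_diff_distrib L2_prod_integrable)
qed (use assms L2_diff[OF assms] in auto)

lemma hnorm_enc: "f \<in> L2 M \<Longrightarrow> hnorm LH (enc f) = sqrt (\<integral>x. (cmod (f x))\<^sup>2 \<partial>M)"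
  by (simp add: hnorm_def ip_enc_self)

text \<open>Riesz--Fischer: an \<open>L\<^sup>2\<close>-Cauchy sequence is \<open>L\<^sup>1\<close>-Cauchy, so a subsequence converges almost
  everywhere, and Fatou's lemma identifies the pointwise limit as the \<open>L\<^sup>2\<close>-limit.\<close>

lemma mcomplete_LH: "Metric_space.mcomplete (carrier LH) (hdist LH)"
  unfolding LH.hm.mcomplete_def
proof (intro allI impI)
  fix \<sigma> assume C: "LH.hm.MCauchy \<sigma>"
  then have sc: "\<sigma> n \<in> carrier LH" for n by (auto simp: LH.hm.MCauchy_def)
  define f where "f n = dec (\<sigma> n)" for n
  have fL: "f n \<in> L2 M" for n using sc by (simp add: f_def dec_in)
  have [measurable]: "f n \<in> borel_measurable M" for n using fL by (rule L2_measurable)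
  have sf: "\<sigma> n = enc (f n)" for n using sc by (simp add: f_def enc_dec)
  have d: "hdist LH (\<sigma> m) (\<sigma> n) = sqrt (\<integral>x. (cmod (f m x - f n x))\<^sup>2 \<partial>M)" for m n
    using fL by (simp add: hdist_def sf enc_diff hnorm_enc L2_diff)
  have c2: "\<exists>N. \<forall>i\<ge>N. \<forall>j\<ge>N. (\<integral>x. (cmod (f i x - f j x))\<^sup>2 \<partial>M) < e\<^sup>2" if e: "e > 0" for e
  proof -
    obtain N where N: "\<And>m n. N \<le> m \<Longrightarrow> N \<le> n \<Longrightarrow> hdist LH (\<sigma> m) (\<sigma> n) < e"
      using C e unfolding LH.hm.MCauchy_def by meson
    have "(\<integral>x. (cmod (f i x - f j x))\<^sup>2 \<partial>M) < e\<^sup>2" if "i \<ge> N" "j \<ge> N" for i j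
    proof -
      have "sqrt (\<integral>x. (cmod (f i x - f j x))\<^sup>2 \<partial>M) < sqrt (e\<^sup>2)"
        using N[OF that] e by (simp add: d)
      then show ?thesis by (simp only: real_sqrt_less_iff)
    qed
    then show ?thesis by blast
  qed
  have i2: "integrable M (\<lambda>x. (cmod (f i x - f j x))\<^sup>2)" for i j
    using L2_diff[OF fL[of i] fL[of j]] by (simp add: L2_def)
  have c1: "\<exists>N. \<forall>i\<ge>N. \<forall>j\<ge>N. (\<integral>x. cmod (f i x - f j x) \<partial>M) < e" if e: "e > 0" for e
  proof -
    obtain N where N: "\<And>i j. N \<le> i \<Longrightarrow> N \<le> j \<Longrightarrow> (\<integral>x. (cmod (f i x - f j x))\<^sup>2 \<partial>M) < e\<^sup>2"
      using c2[OF e] by blast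
    have "(\<integral>x. cmod (f i x - f j x) \<partial>M) < e" if ij: "i \<ge> N" "j \<ge> N" for i j
    proof -
      have "(\<integral>x. cmod (f i x - f j x) \<partial>M) \<le> (\<integral>x. (e + (cmod (f i x - f j x))\<^sup>2 / e) / 2 \<partial>M)"
      proof (rule integral_mono)
        show "cmod (f i x - f j x) \<le> (e + (cmod (f i x - f j x))\<^sup>2 / e) / 2" for x
          using e sum_squares_bound[of e "cmod (f i x - f j x)"]
          by (simp add: field_simps power2_eq_square)
      qed (use i2 L2_integrable[OF L2_diff[OF fL[of i] fL[of j]]] in auto)
      \<comment> \<open>The integrand was bounded by the inequality of the means of \<open>e\<close> and \<open>d\<^sup>2 / e\<close>, with \<open>d\<close> the
        difference of the two functions.\<close>
      also have "\<dots> = (e + (\<integral>x. (cmod (f i x - f j x))\<^sup>2 \<partial>M) / e) / 2"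
        using i2 by (simp add: prob_space)
      also have "\<dots> < (e + e\<^sup>2 / e) / 2"
        using N[OF ij] e by (simp add: divide_strict_right_mono)
      also have "\<dots> = e" using e by (simp add: power2_eq_square)
      finally show ?thesis .
    qed
    then show ?thesis by blast
  qed
  obtain r where r: "strict_mono r" and ae: "AE x in M. Cauchy (\<lambda>i. f (r i) x)"
    by (rule cauchy_L1_AE_cauchy_subseq[of M f])
      (use c1 L2_integrable[OF fL] in auto)
  define F where "F x = lim (\<lambda>i. f (r i) x)" for x
  have [measurable]: "F \<in> borel_measurable M"
    unfolding F_def by measurable
  have lim: "AE x in M. (\<lambda>i. f (r i) x) \<longlonglongrightarrow> F x"
    using ae by eventually_elim (simp add: F_def Cauchy_convergent_iff convergent_LIMSEQ_iff)
  have key: "\<exists>N. \<forall>n\<ge>N. (\<integral>\<^sup>+x. ennreal ((cmod (f n x - F x))\<^sup>2) \<partial>M) \<le> ennreal (e\<^sup>2)" if e: "e > 0" for e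
  proof -
    obtain N where N: "\<And>i j. N \<le> i \<Longrightarrow> N \<le> j \<Longrightarrow> (\<integral>x. (cmod (f i x - f j x))\<^sup>2 \<partial>M) < e\<^sup>2"
      using c2[OF e] by blast
    have "(\<integral>\<^sup>+x. ennreal ((cmod (f n x - F x))\<^sup>2) \<partial>M) \<le> ennreal (e\<^sup>2)" if n: "n \<ge> N" for n
    proof -
      have "(\<integral>\<^sup>+x. ennreal ((cmod (f n x - F x))\<^sup>2) \<partial>M)
          = (\<integral>\<^sup>+x. liminf (\<lambda>i. ennreal ((cmod (f n x - f (r i) x))\<^sup>2)) \<partial>M)"
      proof (rule nn_integral_cong_AE, use lim in eventually_elim)
        fix x assume "(\<lambda>i. f (r i) x) \<longlonglongrightarrow> F x"
        then have "(\<lambda>i. ennreal ((cmod (f n x - f (r i) x))\<^sup>2)) \<longlonglongrightarrow> ennreal ((cmod (f n x - F x))\<^sup>2)"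
          by (intro tendsto_intros) auto
        then show "ennreal ((cmod (f n x - F x))\<^sup>2) = liminf (\<lambda>i. ennreal ((cmod (f n x - f (r i) x))\<^sup>2))"
          by (rule lim_imp_Liminf[OF sequentially_bot, symmetric])
      qed
      also have "\<dots> \<le> liminf (\<lambda>i. \<integral>\<^sup>+x. ennreal ((cmod (f n x - f (r i) x))\<^sup>2) \<partial>M)"
        by (rule nn_integral_liminf) measurable
      also have "\<dots> = liminf (\<lambda>i. ennreal (\<integral>x. (cmod (f n x - f (r i) x))\<^sup>2 \<partial>M))"
        using i2 by (simp add: nn_integral_eq_integral)
      also have "\<dots> \<le> limsup (\<lambda>i. ennreal (\<integral>x. (cmod (f n x - f (r i) x))\<^sup>2 \<partial>M))"
        by (rule Liminf_le_Limsup) simp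
      also have "\<dots> \<le> ennreal (e\<^sup>2)"
      proof (rule Limsup_bounded)
        show "\<forall>\<^sub>F i in sequentially. ennreal (\<integral>x. (cmod (f n x - f (r i) x))\<^sup>2 \<partial>M) \<le> ennreal (e\<^sup>2)"
          using eventually_ge_at_top[of N]
        proof eventually_elim
          fix i assume "N \<le> i"
          then have "N \<le> r i" using strict_mono_imp_increasing[OF r, of i] by simp
          then show "ennreal (\<integral>x. (cmod (f n x - f (r i) x))\<^sup>2 \<partial>M) \<le> ennreal (e\<^sup>2)"
            using N[OF n] by (intro ennreal_leI) (simp add: less_imp_le)
        qed
      qed
      finally show ?thesis .
    qed
    then show ?thesis by blast
  qed
  have dL: "(\<lambda>x. f n x - F x) \<in> L2 M"
    if "(\<integral>\<^sup>+x. ennreal ((cmod (f n x - F x))\<^sup>2) \<partial>M) \<le> ennreal (e\<^sup>2)" for n e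
    unfolding L2_def using that
    by (auto intro!: integrableI_bounded simp: le_less_trans[OF _ ennreal_less_top])
  have FL: "F \<in> L2 M"
  proof -
    obtain N where "(\<integral>\<^sup>+x. ennreal ((cmod (f N x - F x))\<^sup>2) \<partial>M) \<le> ennreal (1\<^sup>2)"
      using key[of 1] by auto
    from L2_diff[OF fL[of N] dL[OF this]] show ?thesis by simp
  qed
  have "limitin LH.hm.mtopology \<sigma> (enc F) sequentially"
    unfolding LH.hm.limitin_metric
  proof (intro conjI allI impI)
    show "enc F \<in> carrier LH" using FL by simp
    fix e :: real assume e: "0 < e"
    obtain N where N: "\<And>n. N \<le> n \<Longrightarrow> (\<integral>\<^sup>+x. ennreal ((cmod (f n x - F x))\<^sup>2) \<partial>M) \<le> ennreal ((e/2)\<^sup>2)"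
      using key[of "e/2"] e by auto
    show "\<forall>\<^sub>F n in sequentially. \<sigma> n \<in> carrier LH \<and> hdist LH (\<sigma> n) (enc F) < e"
      using eventually_ge_at_top[of N]
    proof eventually_elim
      fix n assume n: "N \<le> n"
      have "ennreal (\<integral>x. (cmod (f n x - F x))\<^sup>2 \<partial>M) \<le> ennreal ((e/2)\<^sup>2)"
        using N[OF n] dL[OF N[OF n]] by (subst nn_integral_eq_integral[symmetric]) (auto simp: L2_def)
      then have "(\<integral>x. (cmod (f n x - F x))\<^sup>2 \<partial>M) \<le> (e/2)\<^sup>2" by simp
      then have "sqrt (\<integral>x. (cmod (f n x - F x))\<^sup>2 \<partial>M) \<le> e / 2"
        using e by (intro real_le_lsqrt) simp_all
      then show "\<sigma> n \<in> carrier LH \<and> hdist LH (\<sigma> n) (enc F) < e"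
        using e FL fL by (simp add: hdist_def sf enc_diff hnorm_enc L2_diff)
    qed
  qed
  then show "\<exists>x. limitin LH.hm.mtopology \<sigma> x sequentially" by blast
qed

lemma hilbert_LH: "complex_hilbert_space LH"
  by (intro complex_hilbert_space.intro module_LH complex_hilbert_space_axioms.intro mcomplete_LH)
    (fact LH.inner_add_left LH.inner_smult_left LH.inner_commute LH.inner_pos)+

sublocale LH: complex_hilbert_space LH
  by (rule hilbert_LH)

end

text \<open>A real number is coded by a set of naturals, and a sequence of such sets by one set of pairs.\<close>

lemma nat_fun_real_lepoll: "(UNIV :: (nat \<Rightarrow> real) set) \<lesssim> (UNIV :: real set)"
proof -
  obtain h :: "real \<Rightarrow> nat set" where h: "inj h"
    using eqpoll_imp_lepoll[OF eqpoll_sym[OF nat_sets_eqpoll_reals]] by (auto simp: lepoll_def)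
  have "inj (\<lambda>f :: nat \<Rightarrow> real. {prod_encode (n, m) |n m. m \<in> h (f n)})"
  proof (rule injI, rule ext)
    fix f g :: "nat \<Rightarrow> real" and n
    assume eq: "{prod_encode (n, m) |n m. m \<in> h (f n)} = {prod_encode (n, m) |n m. m \<in> h (g n)}"
    have "m \<in> h (k n) \<longleftrightarrow> prod_encode (n, m) \<in> {prod_encode (n, m) |n m. m \<in> h (k n)}" for k :: "nat \<Rightarrow> real" and m
      by auto
    then have "h (f n) = h (g n)" using eq by blast
    then show "f n = g n" using h by (simp add: inj_eq)
  qed
  then have "(UNIV :: (nat \<Rightarrow> real) set) \<lesssim> (UNIV :: nat set set)"
    by (auto simp: lepoll_def)
  then show ?thesis
    using eqpoll_imp_lepoll[OF nat_sets_eqpoll_reals] lepoll_trans by blast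
qed

text \<open>The finite intersections of a countable base of the topology.\<close>

lemma standard_prob_space_generator:
  assumes "standard_prob_space M"
  obtains E where "countable E" "Int_stable E" "E \<subseteq> Pow (space M)" "space M \<in> E"
    "sets M = sigma_sets (space M) E"
proof -
  obtain \<tau> where sc: "second_countable \<tau>" and top: "topspace \<tau> = space M"
    and sets: "sets M = sigma_sets (space M) {U. openin \<tau> U}"
    using assms by (auto simp: standard_prob_space_def)
  obtain B where B: "countable B" "\<And>V. V \<in> B \<Longrightarrow> openin \<tau> V"
    "\<And>U x. openin \<tau> U \<Longrightarrow> x \<in> U \<Longrightarrow> \<exists>V\<in>B. x \<in> V \<and> V \<subseteq> U"
    using sc by (auto simp: second_countable_def)
  define E where "E = (\<lambda>F. \<Inter>F \<inter> space M) ` {F. finite F \<and> F \<subseteq> B}"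
  have op: "openin \<tau> U" if U: "U \<in> E" for U
  proof -
    obtain F where F: "finite F" "F \<subseteq> B" "U = \<Inter>F \<inter> space M" using U by (auto simp: E_def)
    have "openin \<tau> (\<Inter>F \<inter> space M)" if "finite F" "F \<subseteq> B" for F
      using that
    proof (induction F)
      case empty then show ?case by (simp flip: top)
    next
      case (insert V F)
      have "\<Inter>(insert V F) \<inter> space M = V \<inter> (\<Inter>F \<inter> space M)" by auto
      then show ?case using insert B(2) by (metis insert_subset openin_Int)
    qed
    then show ?thesis using F by simp
  qed
  show thesis
  proof
    show "countable E" unfolding E_def using B(1) by (intro countable_image countable_Collect_finite_subset)
    show "Int_stable E"
      unfolding Int_stable_def
    proof (intro ballI)
      fix U V assume "U \<in> E" "V \<in> E"
      then obtain F1 F2 where F: "finite F1" "F1 \<subseteq> B" "U = \<Inter>F1 \<inter> space M"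
        "finite F2" "F2 \<subseteq> B" "V = \<Inter>F2 \<inter> space M" by (auto simp: E_def)
      show "U \<inter> V \<in> E"
        unfolding E_def by (rule image_eqI[of _ _ "F1 \<union> F2"]) (use F in auto)
    qed
    show "E \<subseteq> Pow (space M)" by (auto simp: E_def)
    show "space M \<in> E" unfolding E_def by (rule image_eqI[of _ _ "{}"]) auto
    show "sets M = sigma_sets (space M) E"
    proof
      have BE: "V \<in> E" if "V \<in> B" for V
        unfolding E_def using that openin_subset[OF B(2)[OF that]]
        by (intro image_eqI[of _ _ "{V}"]) (auto simp: top)
      have "U \<in> sigma_sets (space M) E" if "openin \<tau> U" for U
      proof -
        have "U = \<Union>{V \<in> B. V \<subseteq> U}" using B(3)[OF that] by blast
        moreover have "\<Union>{V \<in> B. V \<subseteq> U} \<in> sigma_sets (space M) E"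
          using B(1) BE by (intro sigma_sets_UNION) (auto intro: countable_subset[OF _ B(1)])
        ultimately show ?thesis by simp
      qed
      then show "sets M \<subseteq> sigma_sets (space M) E"
        unfolding sets by (intro sigma_sets_mono) auto
      show "sigma_sets (space M) E \<subseteq> sets M"
        unfolding sets using op by (intro sigma_sets_mono) auto
    qed
  qed
qed

text \<open>The sets over which both functions have the same integral form a Dynkin system.\<close>

lemma (in prob_space) AE_eq_of_integrals_on_generator:
  fixes f g :: "'a \<Rightarrow> complex"
  assumes E: "Int_stable E" "E \<subseteq> Pow (space M)" "space M \<in> E" "sets M = sigma_sets (space M) E"
    and int: "integrable M f" "integrable M g"
    and eq: "\<And>Y. Y \<in> E \<Longrightarrow> (\<integral>x\<in>Y. f x \<partial>M) = (\<integral>x\<in>Y. g x \<partial>M)"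
  shows "AE x in M. f x = g x"
proof -
  define h where "h x = f x - g x" for x
  have hi: "integrable M h" using int unfolding h_def by simp
  have si: "set_integrable M Y k" if "Y \<in> sets M" "integrable M k" for Y and k :: "'a \<Rightarrow> complex"
    using that by (simp add: set_integrable_def integrable_mult_indicator)
  have E0: "(\<integral>x\<in>Y. h x \<partial>M) = 0" if "Y \<in> E" for Y
  proof -
    have "Y \<in> sets M" using that E(4) by auto
    then show ?thesis using eq[OF that] int by (simp add: h_def set_integral_diff si)
  qed
  have "(\<integral>x\<in>Y. h x \<partial>M) = 0" if "Y \<in> sets M" for Y
    using that[unfolded E(4)]
  proof (induction rule: sigma_sets_induct_disjoint[OF E(1,2), consumes 1, case_names basic empty compl union])
    case (basic A) then show ?case by (rule E0)
  next
    case empty then show ?case by (simp add: set_lebesgue_integral_def)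
  next
    case (compl A)
    then have A: "A \<in> sets M" by (simp add: E(4))
    have "(\<integral>x\<in>A \<union> (space M - A). h x \<partial>M) = (\<integral>x\<in>A. h x \<partial>M) + (\<integral>x\<in>space M - A. h x \<partial>M)"
      using A by (intro set_integral_Un si hi) auto
    moreover have "A \<union> (space M - A) = space M" using sets.sets_into_space[OF A] by auto
    ultimately show ?case using compl E0[OF E(3)] by simp
  next
    case (union A)
    then have A: "A i \<in> sets M" for i by (auto simp: E(4))
    have "(\<integral>x\<in>(\<Union>i. A i). h x \<partial>M) = suminf (\<lambda>i. \<integral>x\<in>A i. h x \<partial>M)"
      using A union(1) by (intro lebesgue_integral_countable_add si hi) (auto simp: disjoint_family_on_def)
    then show ?case using union by simp
  qed
  then have "AE x in M. h x = 0" using density_zero[OF hi] by blast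
  then show ?thesis by (simp add: h_def)
qed

text \<open>The code of a class is the sequence of real and imaginary parts of its integrals over a
  countable generator, a point of a set of the size of the continuum.\<close>

lemma L2_space_exists:
  fixes M :: "'x measure"
  assumes M: "standard_prob_space M" and card: "(UNIV :: real set) \<lesssim> (UNIV :: 'h set)"
  shows "\<exists>enc :: ('x \<Rightarrow> complex) \<Rightarrow> 'h. L2_space M enc"
proof -
  interpret prob_space M using M by (simp add: standard_prob_space_def)
  obtain E where E: "countable E" "Int_stable E" "E \<subseteq> Pow (space M)" "space M \<in> E"
    "sets M = sigma_sets (space M) E"
    using standard_prob_space_generator[OF M] .
  obtain k :: "(nat \<Rightarrow> real) \<Rightarrow> 'h" where k: "inj k"
    using lepoll_trans[OF nat_fun_real_lepoll card] by (auto simp: lepoll_def)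
  define I where "I f n = (\<integral>x\<in>from_nat_into E n. f x \<partial>M)" for f :: "'x \<Rightarrow> complex" and n
  define c where "c f = (\<lambda>n. if even n then Re (I f (n div 2)) else Im (I f (n div 2)))" for f
  have cI: "I f = I g" if "c f = c g" for f g
  proof
    fix n
    have "c f (2*n) = c g (2*n)" "c f (2*n+1) = c g (2*n+1)" using that by simp_all
    then show "I f n = I g n" by (simp add: c_def complex_eq_iff)
  qed
  have "L2_space M (\<lambda>f. k (c f))"
  proof
    fix f g assume fg: "f \<in> L2 M" "g \<in> L2 M"
    note [measurable] = fg[THEN L2_measurable]
    show "k (c f) = k (c g) \<longleftrightarrow> (AE x in M. f x = g x)"
    proof
      assume "k (c f) = k (c g)"
      then have "I f = I g" using k by (intro cI) (simp add: inj_eq)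
      then have "I f (to_nat_on E Y) = I g (to_nat_on E Y)" for Y by simp
      then have "(\<integral>x\<in>Y. f x \<partial>M) = (\<integral>x\<in>Y. g x \<partial>M)" if "Y \<in> E" for Y
        unfolding I_def using from_nat_into_to_nat_on[OF E(1) that] by metis
      then show "AE x in M. f x = g x"
        using fg by (intro AE_eq_of_integrals_on_generator[OF E(2-5)] L2_integrable)
    next
      assume ae: "AE x in M. f x = g x"
      have "I f = I g"
      proof
        fix n
        have [measurable]: "from_nat_into E n \<in> sets M"
          using from_nat_into[of E n] E(4,5) by auto
        show "I f n = I g n"
          unfolding I_def using ae by (intro set_lebesgue_integral_cong_AE) auto
      qed
      then have "c f = c g" by (simp add: c_def cong: if_cong)
      then show "k (c f) = k (c g)" by simp
    qed
  qed
  then show ?thesis by blast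
qed

section \<open>Permutation groups\<close>

lemma topspace_permutation_group:
  assumes "subgroup G (BijGroup \<Omega>)"
  shows "topspace (subtopology (sym_topology \<Omega>) G) = G"
  using subgroup.subset[OF assms]
  by (auto simp: sym_topology_def BijGroup_def Bij_def PiE_def dest: bij_betwE)

lemma openin_agreeing_on_finite:
  assumes G: "subgroup G (BijGroup \<Omega>)" and F: "finite F" "F \<subseteq> \<Omega>" and g0: "g0 \<in> G"
  shows "openin (subtopology (sym_topology \<Omega>) G) {g \<in> G. \<forall>a\<in>F. g a = g0 a}"
proof -
  let ?X = "subtopology (sym_topology \<Omega>) G"
  have GB: "G \<subseteq> Bij \<Omega>" using subgroup.subset[OF G] by (simp add: BijGroup_def)
  have ts: "topspace ?X = G"
    by (rule topspace_permutation_group[OF G])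
  have "openin ?X {g \<in> topspace ?X. g a \<in> {g0 a}}" if "a \<in> F" for a
  proof (rule openin_continuous_map_preimage)
    show "continuous_map ?X (discrete_topology \<Omega>) (\<lambda>g. g a)"
      unfolding sym_topology_def using F that
      by (intro continuous_map_from_subtopology continuous_map_product_projection) auto
    show "openin (discrete_topology \<Omega>) {g0 a}"
    proof -
      have "g0 \<in> Bij \<Omega>" "a \<in> \<Omega>" using g0 GB F that by auto
      then show ?thesis by (auto simp: Bij_def dest: bij_betwE)
    qed
  qed
  then have "openin ?X (topspace ?X \<inter> (\<Inter>a\<in>F. {g \<in> topspace ?X. g a \<in> {g0 a}}))"
    using F(1) by (intro openin_Int_Inter openin_topspace) auto
  moreover have "topspace ?X \<inter> (\<Inter>a\<in>F. {g \<in> topspace ?X. g a \<in> {g0 a}}) = {g \<in> G. \<forall>a\<in>F. g a = g0 a}"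
    unfolding ts by auto
  ultimately show ?thesis by (simp only:)
qed

lemma BijGroup_mult_apply:
  "g \<in> carrier (BijGroup \<Omega>) \<Longrightarrow> h \<in> carrier (BijGroup \<Omega>) \<Longrightarrow> a \<in> \<Omega> \<Longrightarrow> (g \<otimes>\<^bsub>BijGroup \<Omega>\<^esub> h) a = g (h a)"
  by (simp add: BijGroup_def compose_def)

lemma BijGroup_inv_apply:
  assumes g: "g \<in> carrier (BijGroup \<Omega>)" and a: "a \<in> \<Omega>"
  shows "(inv\<^bsub>BijGroup \<Omega>\<^esub> g) (g a) = a"
proof -
  interpret Group.group "BijGroup \<Omega>" by (rule group_BijGroup)
  have "(inv\<^bsub>BijGroup \<Omega>\<^esub> g) (g a) = (inv\<^bsub>BijGroup \<Omega>\<^esub> g \<otimes>\<^bsub>BijGroup \<Omega>\<^esub> g) a"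
    using BijGroup_mult_apply[OF inv_closed[OF g] g a] by simp
  also have "\<dots> = \<one>\<^bsub>BijGroup \<Omega>\<^esub> a" using g by simp
  also have "\<dots> = a" using a by (simp add: BijGroup_def)
  finally show ?thesis .
qed

section \<open>Measure-preserving bijections modulo null sets\<close>

lemma mp_group_iff:
  "T \<in> carrier (mp_group M) \<longleftrightarrow> T \<in> Bij (space M) \<and> T \<in> measurable M M \<and>
     inv_into (space M) T \<in> measurable M M \<and> distr M M T = M"
  by (auto simp: mp_group_def)

text \<open>Exhibiting a two-sided measurable inverse is easier than controlling \<^const>\<open>inv_into\<close>.\<close>

lemma mp_groupI:
  assumes "T \<in> extensional (space M)" and T: "T \<in> measurable M M" and S: "S \<in> measurable M M"
    and ST: "\<And>x. x \<in> space M \<Longrightarrow> S (T x) = x" and TS: "\<And>x. x \<in> space M \<Longrightarrow> T (S x) = x"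
    and "distr M M T = M"
  shows "T \<in> carrier (mp_group M)"
proof -
  have b: "bij_betw T (space M) (space M)"
    by (rule bij_betw_byWitness[where f'=S])
      (use ST TS measurable_space[OF T] measurable_space[OF S] in auto)
  then have inj: "inj_on T (space M)" by (simp add: bij_betw_def)
  have "inv_into (space M) T x = S x" if "x \<in> space M" for x
    using inv_into_f_eq[OF inj measurable_space[OF S that] TS[OF that]] .
  then have "inv_into (space M) T \<in> measurable M M"
    using S by (subst measurable_cong) auto
  then show ?thesis using assms b by (simp add: mp_group_iff Bij_def)
qed

lemma mp_group_inverse:
  assumes T: "T \<in> carrier (mp_group M)"
  defines "S \<equiv> inv_into (space M) T"
  shows "T \<in> measurable M M" "S \<in> measurable M M" "\<And>x. x \<in> space M \<Longrightarrow> S (T x) = x"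
    "\<And>x. x \<in> space M \<Longrightarrow> T (S x) = x" "distr M M T = M" "distr M M S = M"
proof -
  have b: "bij_betw T (space M) (space M)" using T by (auto simp: mp_group_iff Bij_def)
  show m: "T \<in> measurable M M" "S \<in> measurable M M" and d: "distr M M T = M"
    using T by (auto simp: mp_group_iff S_def)
  show ST: "S (T x) = x" if "x \<in> space M" for x
    using b that by (simp add: S_def bij_betw_def inv_into_f_f)
  show "T (S x) = x" if "x \<in> space M" for x
    using b that by (simp add: S_def bij_betw_def f_inv_into_f)
  have "distr M M S = distr (distr M M T) M S" by (simp add: d)
  also have "\<dots> = distr M M (S \<circ> T)" by (rule distr_distr[OF m(2,1)])
  also have "\<dots> = distr M M (\<lambda>x. x)" using ST by (intro distr_cong) auto
  finally show "distr M M S = M" by simp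
qed

lemma mp_group_mult:
  "T \<in> carrier (mp_group M) \<Longrightarrow> S \<in> carrier (mp_group M) \<Longrightarrow> T \<otimes>\<^bsub>mp_group M\<^esub> S = compose (space M) T S"
  by (auto simp: mp_group_def BijGroup_def)

lemma group_mp_group: "group (mp_group M)"
proof -
  have "subgroup (carrier (mp_group M)) (BijGroup (space M))"
  proof (rule group.subgroupI[OF group_BijGroup])
    show "carrier (mp_group M) \<subseteq> carrier (BijGroup (space M))"
      by (auto simp: mp_group_iff BijGroup_def)
    have "(\<lambda>x\<in>space M. x) \<in> carrier (mp_group M)"
    proof (rule mp_groupI[where S = "\<lambda>x. x"])
      have "distr M M (\<lambda>x\<in>space M. x) = distr M M (\<lambda>x. x)" by (intro distr_cong) auto
      then show "distr M M (\<lambda>x\<in>space M. x) = M" by simp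
    qed (auto cong: measurable_cong)
    then show "carrier (mp_group M) \<noteq> {}" by blast
  next
    fix T assume T: "T \<in> carrier (mp_group M)"
    note t = mp_group_inverse[OF T]
    have "(\<lambda>x\<in>space M. inv_into (space M) T x) \<in> carrier (mp_group M)"
    proof (rule mp_groupI[where S = T])
      have "distr M M (\<lambda>x\<in>space M. inv_into (space M) T x) = distr M M (inv_into (space M) T)"
        by (intro distr_cong) auto
      then show "distr M M (\<lambda>x\<in>space M. inv_into (space M) T x) = M" using t(6) by simp
      show "(\<lambda>x\<in>space M. inv_into (space M) T x) \<in> measurable M M"
        using t(2) by (simp cong: measurable_cong)
    qed (use t measurable_space[OF t(1)] in auto)
    then show "inv\<^bsub>BijGroup (space M)\<^esub> T \<in> carrier (mp_group M)"
      using T by (simp add: inv_BijGroup mp_group_iff)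
  next
    fix T S assume T: "T \<in> carrier (mp_group M)" and S: "S \<in> carrier (mp_group M)"
    note t = mp_group_inverse[OF T] and s = mp_group_inverse[OF S]
    have "compose (space M) T S \<in> carrier (mp_group M)"
    proof (rule mp_groupI[where S = "inv_into (space M) S \<circ> inv_into (space M) T"])
      show "compose (space M) T S \<in> measurable M M"
        using measurable_comp[OF s(1) t(1)] by (simp add: compose_def comp_def cong: measurable_cong)
      have "distr M M (compose (space M) T S) = distr M M (T \<circ> S)"
        by (intro distr_cong) (auto simp: compose_def)
      also have "\<dots> = distr (distr M M S) M T" by (rule distr_distr[OF t(1) s(1), symmetric])
      finally show "distr M M (compose (space M) T S) = M" using s t by simp
    qed (use s t measurable_space[OF t(2)] measurable_space[OF s(1)] measurable_space[OF s(2)] in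
        \<open>auto simp: compose_def intro!: measurable_comp[OF t(2) s(2)]\<close>)
    then show "T \<otimes>\<^bsub>BijGroup (space M)\<^esub> S \<in> carrier (mp_group M)"
      using S T by (simp add: BijGroup_def mp_group_iff)
  qed
  then have "group ((BijGroup (space M))\<lparr>carrier := carrier (mp_group M)\<rparr>)"
    using group_BijGroup by (rule subgroup.subgroup_is_group)
  moreover have "(BijGroup (space M))\<lparr>carrier := carrier (mp_group M)\<rparr> = mp_group M"
    by (simp add: mp_group_def)
  ultimately show ?thesis by simp
qed

lemma AE_mp:
  assumes "distr M M T = M" "T \<in> measurable M M" "AE x in M. P x" shows "AE x in M. P (T x)"
proof (rule AE_distrD[OF assms(2)])
  show "AE x in distr M M T. P x" by (subst assms(1)) (rule assms(3))
qed

lemma mp_group_inv: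
  assumes T: "T \<in> carrier (mp_group M)" and x: "x \<in> space M"
  shows "(inv\<^bsub>mp_group M\<^esub> T) x = inv_into (space M) T x"
proof -
  interpret group "mp_group M" by (rule group_mp_group)
  have i: "inv\<^bsub>mp_group M\<^esub> T \<in> carrier (mp_group M)" using T by simp
  have "T \<otimes>\<^bsub>mp_group M\<^esub> inv\<^bsub>mp_group M\<^esub> T = (\<lambda>x\<in>space M. x)"
    using r_inv[OF T] by (simp add: mp_group_def BijGroup_def)
  then have "T ((inv\<^bsub>mp_group M\<^esub> T) x) = x"
    using x by (simp add: mp_group_mult[OF T i] compose_def fun_eq_iff split: if_splits)
  moreover have "(inv\<^bsub>mp_group M\<^esub> T) x \<in> space M"
    using measurable_space[OF mp_group_inverse(1)[OF i] x] .
  ultimately show ?thesis using mp_group_inverse(3)[OF T, of "(inv\<^bsub>mp_group M\<^esub> T) x"] by simp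
qed

lemma normal_ae_identity: "ae_identity M \<lhd> mp_group M"
proof -
  interpret group "mp_group M" by (rule group_mp_group)
  have one: "\<one>\<^bsub>mp_group M\<^esub> = (\<lambda>x\<in>space M. x)" by (simp add: mp_group_def BijGroup_def)
  have mem: "T \<in> ae_identity M \<longleftrightarrow> T \<in> carrier (mp_group M) \<and> (AE x in M. T x = x)" for T
    by (simp add: ae_identity_def)
  have mult: "(T \<otimes>\<^bsub>mp_group M\<^esub> S) x = T (S x)"
    if "T \<in> carrier (mp_group M)" "S \<in> carrier (mp_group M)" "x \<in> space M" for T S x
    using that by (simp add: mp_group_mult compose_def)
  have sub: "subgroup (ae_identity M) (mp_group M)"
  proof (rule subgroupI)
    show "ae_identity M \<subseteq> carrier (mp_group M)" by (auto simp: mem)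
    have "\<one>\<^bsub>mp_group M\<^esub> \<in> ae_identity M" unfolding mem using one_closed by (auto simp: one intro!: AE_I2)
    then show "ae_identity M \<noteq> {}" by blast
  next
    fix T assume T: "T \<in> ae_identity M"
    then have t: "T \<in> carrier (mp_group M)" and ae: "AE x in M. T x = x" by (auto simp: mem)
    have "AE x in M. inv_into (space M) T x = x"
      using ae AE_space by eventually_elim (metis mp_group_inverse(3)[OF t])
    then have "AE x in M. (inv\<^bsub>mp_group M\<^esub> T) x = x"
      using AE_space by eventually_elim (simp add: mp_group_inv[OF t])
    then show "inv\<^bsub>mp_group M\<^esub> T \<in> ae_identity M" using t by (simp add: mem)
  next
    fix T S assume "T \<in> ae_identity M" "S \<in> ae_identity M"
    then have t: "T \<in> carrier (mp_group M)" and s: "S \<in> carrier (mp_group M)"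
      and ae: "AE x in M. T x = x" "AE x in M. S x = x" by (auto simp: mem)
    have "AE x in M. (T \<otimes>\<^bsub>mp_group M\<^esub> S) x = x"
      using ae AE_space by eventually_elim (simp add: mult[OF t s])
    then show "T \<otimes>\<^bsub>mp_group M\<^esub> S \<in> ae_identity M" using t s by (simp add: mem)
  qed
  show ?thesis
    unfolding normal_inv_iff
  proof (intro conjI ballI sub)
    fix T N assume t: "T \<in> carrier (mp_group M)" and "N \<in> ae_identity M"
    then have n: "N \<in> carrier (mp_group M)" and ae: "AE x in M. N x = x" by (auto simp: mem)
    have i: "inv\<^bsub>mp_group M\<^esub> T \<in> carrier (mp_group M)" using t by simp
    have "AE x in M. N ((inv\<^bsub>mp_group M\<^esub> T) x) = (inv\<^bsub>mp_group M\<^esub> T) x"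
      using AE_mp[OF mp_group_inverse(5)[OF i] mp_group_inverse(1)[OF i] ae] .
    then have "AE x in M. (T \<otimes>\<^bsub>mp_group M\<^esub> N \<otimes>\<^bsub>mp_group M\<^esub> inv\<^bsub>mp_group M\<^esub> T) x = x"
      using AE_space
    proof eventually_elim
      fix x assume "N ((inv\<^bsub>mp_group M\<^esub> T) x) = (inv\<^bsub>mp_group M\<^esub> T) x" and x: "x \<in> space M"
      moreover have "(inv\<^bsub>mp_group M\<^esub> T) x \<in> space M"
        using measurable_space[OF mp_group_inverse(1)[OF i] x] .
      ultimately show "(T \<otimes>\<^bsub>mp_group M\<^esub> N \<otimes>\<^bsub>mp_group M\<^esub> inv\<^bsub>mp_group M\<^esub> T) x = x"
        using mp_group_inverse(4)[OF t x] mp_group_inv[OF t x] mult t n i m_closed[OF t n] by simp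
    qed
    then show "T \<otimes>\<^bsub>mp_group M\<^esub> N \<otimes>\<^bsub>mp_group M\<^esub> inv\<^bsub>mp_group M\<^esub> T \<in> ae_identity M"
      using t n i by (simp add: mem)
  qed
qed

text \<open>Membership in \<^const>\<open>Aut\<close> cosets becomes equality almost everywhere; this is the only form in
  which quotient elements are used below.\<close>

lemma Aut_coset:
  assumes T: "T \<in> carrier (mp_group M)"
  shows "S \<in> ae_identity M #>\<^bsub>mp_group M\<^esub> T \<longleftrightarrow> S \<in> carrier (mp_group M) \<and> (AE x in M. S x = T x)"
proof -
  interpret normal "ae_identity M" "mp_group M" by (rule normal_ae_identity)
  have eq: "(S \<otimes>\<^bsub>mp_group M\<^esub> inv\<^bsub>mp_group M\<^esub> T \<in> ae_identity M) \<longleftrightarrow> (AE x in M. S x = T x)"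
    if S: "S \<in> carrier (mp_group M)"
  proof -
    have i: "inv\<^bsub>mp_group M\<^esub> T \<in> carrier (mp_group M)" using T by simp
    have m: "(S \<otimes>\<^bsub>mp_group M\<^esub> inv\<^bsub>mp_group M\<^esub> T) x = S (inv_into (space M) T x)" if "x \<in> space M" for x
      using S i that by (simp add: mp_group_mult compose_def mp_group_inv[OF T])
    have "(AE x in M. (S \<otimes>\<^bsub>mp_group M\<^esub> inv\<^bsub>mp_group M\<^esub> T) x = x) \<longleftrightarrow> (AE x in M. S (inv_into (space M) T x) = x)"
      using m by (intro AE_cong) auto
    also have "\<dots> \<longleftrightarrow> (AE x in M. S x = T x)"
    proof
      assume "AE x in M. S (inv_into (space M) T x) = x"
      from AE_mp[OF mp_group_inverse(5)[OF T] mp_group_inverse(1)[OF T] this] AE_space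
      show "AE x in M. S x = T x" by eventually_elim (simp add: mp_group_inverse(3)[OF T])
    next
      assume "AE x in M. S x = T x"
      from AE_mp[OF mp_group_inverse(6)[OF T] mp_group_inverse(2)[OF T] this] AE_space
      show "AE x in M. S (inv_into (space M) T x) = x"
      proof eventually_elim
        fix x assume "S (inv_into (space M) T x) = T (inv_into (space M) T x)" and x: "x \<in> space M"
        then show "S (inv_into (space M) T x) = x" using mp_group_inverse(4)[OF T x] by (simp only:)
      qed
    qed
    finally show ?thesis unfolding ae_identity_def using m_closed[OF S i] by blast
  qed
  show ?thesis
  proof (cases "S \<in> carrier (mp_group M)")
    case True
    then show ?thesis using rcos_module[OF is_group T True] eq by simp
  next
    case False
    then show ?thesis using elemrcos_carrier[OF is_group T] by blast
  qed
qed

lemma Aut_carrierE: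
  assumes "C \<in> carrier (Aut M)"
  obtains T where "T \<in> carrier (mp_group M)" "C = ae_identity M #>\<^bsub>mp_group M\<^esub> T"
  using assms by (auto simp: Aut_def carrier_FactGroup)

lemma mp_group_image:
  assumes T: "T \<in> carrier (mp_group M)" and Y: "Y \<in> sets M"
  shows "T ` Y = inv_into (space M) T -` Y \<inter> space M" "T ` Y \<in> sets M"
proof -
  note t = mp_group_inverse[OF T]
  have Ys: "Y \<subseteq> space M" using sets.sets_into_space[OF Y] .
  show eq: "T ` Y = inv_into (space M) T -` Y \<inter> space M"
  proof
    show "T ` Y \<subseteq> inv_into (space M) T -` Y \<inter> space M"
      using t(3) Ys measurable_space[OF t(1)] by auto
    show "inv_into (space M) T -` Y \<inter> space M \<subseteq> T ` Y"
    proof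
      fix x assume x: "x \<in> inv_into (space M) T -` Y \<inter> space M"
      then show "x \<in> T ` Y" using t(4)[of x] by (intro image_eqI[of _ _ "inv_into (space M) T x"]) auto
    qed
  qed
  show "T ` Y \<in> sets M" unfolding eq using t(2) Y by (rule measurable_sets)
qed

lemma (in prob_space) measure_sym_diff_eq_0_iff:
  assumes "Y \<in> sets M" "Z \<in> sets M"
  shows "measure M (sym_diff Y Z) = 0 \<longleftrightarrow> (AE x in M. x \<in> Y \<longleftrightarrow> x \<in> Z)"
proof -
  have "measure M (sym_diff Y Z) = 0 \<longleftrightarrow> (AE x in M. x \<notin> sym_diff Y Z)"
    using assms by (intro prob_eq_0) auto
  also have "\<dots> \<longleftrightarrow> (AE x in M. x \<in> Y \<longleftrightarrow> x \<in> Z)"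
    by (intro AE_cong) auto
  finally show ?thesis .
qed

lemma image_AE_cong:
  assumes S: "S \<in> carrier (mp_group M)" and T: "T \<in> carrier (mp_group M)"
    and ST: "AE x in M. S x = T x" and Y: "Y \<in> sets M"
  shows "AE x in M. x \<in> S ` Y \<longleftrightarrow> x \<in> T ` Y"
proof -
  have "AE x in M. inv_into (space M) T x = inv_into (space M) S x"
    using AE_mp[OF mp_group_inverse(6)[OF T] mp_group_inverse(2)[OF T] ST] AE_space
  proof eventually_elim
    fix x assume eq: "S (inv_into (space M) T x) = T (inv_into (space M) T x)" and x: "x \<in> space M"
    then have "S (inv_into (space M) T x) = x" using mp_group_inverse(4)[OF T x] by simp
    then show "inv_into (space M) T x = inv_into (space M) S x"
      using mp_group_inverse(3)[OF S measurable_space[OF mp_group_inverse(2)[OF T] x]] by simp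
  qed
  then show ?thesis
    unfolding mp_group_image(1)[OF S Y] mp_group_image(1)[OF T Y] by eventually_elim auto
qed

lemma (in prob_space) sym_diff_triangle:
  assumes "A \<in> sets M" "B \<in> sets M" "C \<in> sets M"
  shows "measure M (sym_diff A C) \<le> measure M (sym_diff A B) + measure M (sym_diff B C)"
proof -
  have "measure M (sym_diff A C) \<le> measure M (sym_diff A B \<union> sym_diff B C)"
    using assms by (intro finite_measure_mono) auto
  also have "\<dots> \<le> measure M (sym_diff A B) + measure M (sym_diff B C)"
    using assms by (intro measure_Un_le) auto
  finally show ?thesis .
qed

section \<open>Invariant sets of a Boolean action\<close>

locale boolean_action =
  fixes \<Omega> :: "'w set" and G M \<alpha>
  assumes subgroup_G: "subgroup G (BijGroup \<Omega>)" and prob_M: "prob_space M"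
    and action: "boolean_pmp_action \<Omega> G M \<alpha>"
begin

sublocale prob_space M by (rule prob_M)

abbreviation "GG \<equiv> (BijGroup \<Omega>)\<lparr>carrier := G\<rparr>"

lemma G_mult: "g \<in> G \<Longrightarrow> h \<in> G \<Longrightarrow> g \<otimes>\<^bsub>BijGroup \<Omega>\<^esub> h \<in> G"
  by (rule subgroup.m_closed[OF subgroup_G])

lemma topspace_G: "topspace (subtopology (sym_topology \<Omega>) G) = G"
  by (rule topspace_permutation_group[OF subgroup_G])

lemma alpha_Aut: "g \<in> G \<Longrightarrow> \<alpha> g \<in> carrier (Aut M)"
  using action by (auto simp: boolean_pmp_action_def hom_def)

text \<open>A quotient element is handled through one chosen representative and the pointwise inverse
  of that representative. Both are multiplicative only up to null sets.\<close>

definition rep :: "('w \<Rightarrow> 'w) \<Rightarrow> 'a \<Rightarrow> 'a" where "rep g = (SOME T. T \<in> \<alpha> g)"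

definition rep_inv :: "('w \<Rightarrow> 'w) \<Rightarrow> 'a \<Rightarrow> 'a" where "rep_inv g = inv_into (space M) (rep g)"

lemma rep_in: assumes "g \<in> G" shows "rep g \<in> \<alpha> g"
proof -
  interpret normal "ae_identity M" "mp_group M" by (rule normal_ae_identity)
  obtain T where "T \<in> carrier (mp_group M)" "\<alpha> g = ae_identity M #>\<^bsub>mp_group M\<^esub> T"
    using alpha_Aut[OF assms] by (rule Aut_carrierE)
  then have "T \<in> \<alpha> g" using Aut_coset[of T M T] by simp
  then show ?thesis unfolding rep_def by (rule someI[of "\<lambda>T. T \<in> \<alpha> g"])
qed

lemma rep_mp: assumes "g \<in> G" shows "rep g \<in> carrier (mp_group M)"
  using rep_in[OF assms] Aut_coset by (metis Aut_carrierE alpha_Aut[OF assms])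

lemma alpha_iff:
  assumes "g \<in> G" shows "S \<in> \<alpha> g \<longleftrightarrow> S \<in> carrier (mp_group M) \<and> (AE x in M. S x = rep g x)"
proof -
  obtain T where T: "T \<in> carrier (mp_group M)" "\<alpha> g = ae_identity M #>\<^bsub>mp_group M\<^esub> T"
    using alpha_Aut[OF assms] by (rule Aut_carrierE)
  have ae: "AE x in M. rep g x = T x" using rep_in[OF assms] Aut_coset[OF T(1)] T(2) by simp
  have "(AE x in M. S x = T x) \<longleftrightarrow> (AE x in M. S x = rep g x)"
  proof
    assume "AE x in M. S x = T x"
    then show "AE x in M. S x = rep g x" using ae by eventually_elim simp
  next
    assume "AE x in M. S x = rep g x"
    then show "AE x in M. S x = T x" using ae by eventually_elim simp
  qed
  then show ?thesis using Aut_coset[OF T(1)] T(2) by simp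
qed

lemmas rep_props = mp_group_inverse[OF rep_mp, folded rep_inv_def]

lemma rep_mult:
  assumes g: "g \<in> G" and h: "h \<in> G"
  shows "AE x in M. rep (g \<otimes>\<^bsub>BijGroup \<Omega>\<^esub> h) x = rep g (rep h x)"
proof -
  have "\<alpha> (g \<otimes>\<^bsub>BijGroup \<Omega>\<^esub> h) = \<alpha> g <#>\<^bsub>mp_group M\<^esub> \<alpha> h"
    using action g h by (auto simp: boolean_pmp_action_def hom_def Aut_def FactGroup_def)
  then have "rep g \<otimes>\<^bsub>mp_group M\<^esub> rep h \<in> \<alpha> (g \<otimes>\<^bsub>BijGroup \<Omega>\<^esub> h)"
    using rep_in[OF g] rep_in[OF h] by (auto simp: set_mult_def)
  then have "AE x in M. (rep g \<otimes>\<^bsub>mp_group M\<^esub> rep h) x = rep (g \<otimes>\<^bsub>BijGroup \<Omega>\<^esub> h) x"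
    using alpha_iff[OF G_mult[OF g h]] by blast
  then show ?thesis using AE_space
    by eventually_elim (simp add: mp_group_mult rep_mp g h compose_def)
qed

lemma rep_inv_mult:
  assumes g: "g \<in> G" and h: "h \<in> G"
  shows "AE x in M. rep_inv (g \<otimes>\<^bsub>BijGroup \<Omega>\<^esub> h) x = rep_inv h (rep_inv g x)"
proof -
  note gh = G_mult[OF g h]
  note p = rep_props[OF gh] rep_props[OF g] rep_props[OF h]
  have "AE x in M. rep (g \<otimes>\<^bsub>BijGroup \<Omega>\<^esub> h) (rep_inv (g \<otimes>\<^bsub>BijGroup \<Omega>\<^esub> h) x)
      = rep g (rep h (rep_inv (g \<otimes>\<^bsub>BijGroup \<Omega>\<^esub> h) x))"
    by (rule AE_mp[OF p(6) p(2) rep_mult[OF g h]])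
  then show ?thesis using AE_space
  proof eventually_elim
    fix x let ?y = "rep_inv (g \<otimes>\<^bsub>BijGroup \<Omega>\<^esub> h) x"
    assume e: "rep (g \<otimes>\<^bsub>BijGroup \<Omega>\<^esub> h) ?y = rep g (rep h ?y)" and x: "x \<in> space M"
    have y: "?y \<in> space M" using x by (rule measurable_space[OF p(2)])
    have "x = rep g (rep h ?y)" using e rep_props(4)[OF gh x] by simp
    then have "rep_inv h (rep_inv g x) = rep_inv h (rep_inv g (rep g (rep h ?y)))" by simp
    also have "\<dots> = ?y"
      using rep_props(3)[OF g measurable_space[OF rep_props(1)[OF h] y]] rep_props(3)[OF h y] by simp
    finally show "?y = rep_inv h (rep_inv g x)" by simp
  qed
qed

definition inv_sets :: "'w set \<Rightarrow> 'a set set" where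
  "inv_sets A = {Y \<in> sets M. \<forall>g\<in>pointwise_stabilizer G A. AE x in M. rep_inv g x \<in> Y \<longleftrightarrow> x \<in> Y}"

lemma stab_G: "g \<in> pointwise_stabilizer G A \<Longrightarrow> g \<in> G"
  by (simp add: pointwise_stabilizer_def)

text \<open>Invariance under all representatives is invariance under the chosen one, and the image of a
  set under a bijection is its preimage under the inverse.\<close>

lemma inv_sets_eq:
  "{Y \<in> sets M. \<forall>g\<in>pointwise_stabilizer G A. \<forall>T\<in>\<alpha> g. measure M (sym_diff (T ` Y) Y) = 0} = inv_sets A"
proof -
  have "(\<forall>T\<in>\<alpha> g. measure M (sym_diff (T ` Y) Y) = 0) \<longleftrightarrow> (AE x in M. rep_inv g x \<in> Y \<longleftrightarrow> x \<in> Y)"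
    if g: "g \<in> G" and Y: "Y \<in> sets M" for g Y
  proof -
    have "measure M (sym_diff (T ` Y) Y) = 0 \<longleftrightarrow> (AE x in M. rep_inv g x \<in> Y \<longleftrightarrow> x \<in> Y)" if "T \<in> \<alpha> g" for T
    proof -
      have T: "T \<in> carrier (mp_group M)" and ae: "AE x in M. T x = rep g x"
        using that alpha_iff[OF g] by auto
      have ae2: "AE x in M. inv_into (space M) T x = rep_inv g x"
        using AE_mp[OF rep_props(6)[OF g] rep_props(2)[OF g] ae] AE_space
      proof eventually_elim
        fix x assume "T (rep_inv g x) = rep g (rep_inv g x)" and x: "x \<in> space M"
        then have "T (rep_inv g x) = x" using rep_props(4)[OF g x] by simp
        then show "inv_into (space M) T x = rep_inv g x"
          using mp_group_inverse(3)[OF T measurable_space[OF rep_props(2)[OF g] x]] by simp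
      qed
      have "measure M (sym_diff (T ` Y) Y) = 0 \<longleftrightarrow> (AE x in M. x \<in> T ` Y \<longleftrightarrow> x \<in> Y)"
        using mp_group_image(2)[OF T Y] Y by (rule measure_sym_diff_eq_0_iff)
      also have "\<dots> \<longleftrightarrow> (AE x in M. rep_inv g x \<in> Y \<longleftrightarrow> x \<in> Y)"
        unfolding mp_group_image(1)[OF T Y]
      proof
        assume "AE x in M. x \<in> inv_into (space M) T -` Y \<inter> space M \<longleftrightarrow> x \<in> Y"
        then show "AE x in M. rep_inv g x \<in> Y \<longleftrightarrow> x \<in> Y" using ae2 AE_space by eventually_elim auto
      next
        assume "AE x in M. rep_inv g x \<in> Y \<longleftrightarrow> x \<in> Y"
        then show "AE x in M. x \<in> inv_into (space M) T -` Y \<inter> space M \<longleftrightarrow> x \<in> Y"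
          using ae2 AE_space by eventually_elim auto
      qed
      finally show ?thesis .
    qed
    then show ?thesis using rep_in[OF g] by blast
  qed
  then show ?thesis unfolding inv_sets_def using stab_G by (intro Collect_cong conj_cong refl ball_cong) blast+
qed

lemma sigma_algebra_inv_sets: "sigma_algebra (space M) (inv_sets A)"
  unfolding sigma_algebra_iff2
proof (intro conjI ballI allI impI)
  show "inv_sets A \<subseteq> Pow (space M)" using sets.sets_into_space by (auto simp: inv_sets_def)
  show "{} \<in> inv_sets A" by (simp add: inv_sets_def)
next
  fix Y assume Y: "Y \<in> inv_sets A"
  have "AE x in M. rep_inv g x \<in> space M - Y \<longleftrightarrow> x \<in> space M - Y" if "g \<in> pointwise_stabilizer G A" for g
  proof -
    have "AE x in M. rep_inv g x \<in> Y \<longleftrightarrow> x \<in> Y" using Y that by (auto simp: inv_sets_def)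
    then show ?thesis using AE_space
      by eventually_elim (use measurable_space[OF rep_props(2)[OF stab_G[OF that]]] in auto)
  qed
  then show "space M - Y \<in> inv_sets A" using Y by (auto simp: inv_sets_def)
next
  fix Y :: "nat \<Rightarrow> 'a set" assume Y: "range Y \<subseteq> inv_sets A"
  have "AE x in M. rep_inv g x \<in> (\<Union>i. Y i) \<longleftrightarrow> x \<in> (\<Union>i. Y i)" if "g \<in> pointwise_stabilizer G A" for g
  proof -
    have "AE x in M. \<forall>i. rep_inv g x \<in> Y i \<longleftrightarrow> x \<in> Y i"
      unfolding AE_all_countable using Y that by (auto simp: inv_sets_def)
    then show ?thesis by eventually_elim auto
  qed
  then show "(\<Union>i. Y i) \<in> inv_sets A" using Y by (auto simp: inv_sets_def)
qed

lemma space_fixed [simp]: "space (fixed_algebra G M \<alpha> A) = space M"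
  unfolding fixed_algebra_def inv_sets_eq
  by (rule space_measure_of) (use sets.sets_into_space in \<open>auto simp: inv_sets_def\<close>)

lemma sets_fixed: "sets (fixed_algebra G M \<alpha> A) = inv_sets A"
  unfolding fixed_algebra_def inv_sets_eq
  using sigma_algebra.sets_measure_of_eq[OF sigma_algebra_inv_sets] .

lemma subalgebra_fixed: "Conditional_Expectation.subalgebra M (fixed_algebra G M \<alpha> A)"
  unfolding Conditional_Expectation.subalgebra_def sets_fixed by (auto simp: inv_sets_def)

lemma fixed_mono: "A \<subseteq> B \<Longrightarrow> Conditional_Expectation.subalgebra (fixed_algebra G M \<alpha> B) (fixed_algebra G M \<alpha> A)"
  unfolding Conditional_Expectation.subalgebra_def sets_fixed by (auto simp: inv_sets_def pointwise_stabilizer_def)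

lemma sigma_finite_fixed: "sigma_finite_subalgebra M (fixed_algebra G M \<alpha> A)"
proof -
  interpret finite_measure_subalgebra M "fixed_algebra G M \<alpha> A"
    by unfold_locales (rule subalgebra_fixed)
  show ?thesis by (rule sigma_finite_subalgebra_axioms)
qed

text \<open>Level sets of a function that is invariant up to null sets are invariant up to null sets.\<close>

lemma measurable_fixed:
  fixes f :: "'a \<Rightarrow> 'b :: topological_space"
  assumes f: "f \<in> borel_measurable M"
    and inv: "\<And>g. g \<in> pointwise_stabilizer G A \<Longrightarrow> AE x in M. f (rep_inv g x) = f x"
  shows "f \<in> borel_measurable (fixed_algebra G M \<alpha> A)"
proof (rule measurableI)
  fix S :: "'b set" assume S: "S \<in> sets borel"
  have "AE x in M. rep_inv g x \<in> f -` S \<inter> space M \<longleftrightarrow> x \<in> f -` S \<inter> space M"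
    if g: "g \<in> pointwise_stabilizer G A" for g
    using inv[OF g] AE_space
    by eventually_elim (use measurable_space[OF rep_props(2)[OF stab_G[OF g]]] in auto)
  then show "f -` S \<inter> space (fixed_algebra G M \<alpha> A) \<in> sets (fixed_algebra G M \<alpha> A)"
    using measurable_sets[OF f S] by (simp add: sets_fixed inv_sets_def)
qed simp

text \<open>The ball of radius \<open>e\<close> around \<open>\<alpha> g0\<close> is an open set of the weak topology that contains \<open>\<alpha> g0\<close>,
  because two representatives of one coset move \<open>Y\<close> to the same set up to a null set.\<close>

lemma weak_continuity:
  assumes g0: "g0 \<in> G" and Y: "Y \<in> sets M" and e: "0 < e"
  shows "\<exists>U. openin (subtopology (sym_topology \<Omega>) G) U \<and> g0 \<in> U \<and>
    (\<forall>g\<in>U. measure M (sym_diff (rep g ` Y) (rep g0 ` Y)) < e)"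
proof -
  let ?B = "weak_ball M (\<alpha> g0) Y e"
  have "openin (weak_topology M) ?B"
    unfolding weak_topology_def using alpha_Aut[OF g0] Y e
    by (intro topology_generated_by_Basis) blast
  then have op: "openin (subtopology (sym_topology \<Omega>) G) {g \<in> topspace (subtopology (sym_topology \<Omega>) G). \<alpha> g \<in> ?B}"
    using action unfolding boolean_pmp_action_def by (intro openin_continuous_map_preimage) auto
  have "measure M (sym_diff (S ` Y) (T ` Y)) = 0" if "S \<in> \<alpha> g0" "T \<in> \<alpha> g0" for S T
  proof -
    have m: "S \<in> carrier (mp_group M)" "T \<in> carrier (mp_group M)"
      and ae: "AE x in M. S x = rep g0 x" "AE x in M. T x = rep g0 x"
      using that alpha_iff[OF g0] by auto
    from ae have "AE x in M. S x = T x" by eventually_elim simp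
    then have "AE x in M. x \<in> S ` Y \<longleftrightarrow> x \<in> T ` Y" by (rule image_AE_cong[OF m _ Y])
    then show ?thesis
      using measure_sym_diff_eq_0_iff[OF mp_group_image(2)[OF m(1) Y] mp_group_image(2)[OF m(2) Y]] by simp
  qed
  then have "\<alpha> g0 \<in> ?B" using alpha_Aut[OF g0] e by (auto simp: weak_ball_def)
  moreover have "measure M (sym_diff (rep g ` Y) (rep g0 ` Y)) < e" if "g \<in> G" "\<alpha> g \<in> ?B" for g
    using that rep_in[OF that(1)] rep_in[OF g0] by (auto simp: weak_ball_def)
  ultimately show ?thesis using op g0 unfolding topspace_G by blast
qed

end

section \<open>Unitary representations\<close>

locale unitary_rep = complex_hilbert_space H for H :: "'h hilbert" +
  fixes \<Omega> :: "'w set" and G \<pi>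
  assumes subgroup_G: "subgroup G (BijGroup \<Omega>)" and unitary: "unitary_representation \<Omega> G H \<pi>"
begin

lemma pi_unitary: "g \<in> G \<Longrightarrow> \<pi> g \<in> carrier (unitary_group H)"
  using unitary by (auto simp: unitary_representation_def hom_def)

lemma pi_closed [simp]: "g \<in> G \<Longrightarrow> x \<in> carrier H \<Longrightarrow> \<pi> g x \<in> carrier H"
  using pi_unitary[of g] by (auto simp: unitary_group_def Bij_def dest: bij_betwE)

lemma pi_add: "g \<in> G \<Longrightarrow> x \<in> carrier H \<Longrightarrow> y \<in> carrier H \<Longrightarrow> \<pi> g (x \<oplus>\<^bsub>H\<^esub> y) = \<pi> g x \<oplus>\<^bsub>H\<^esub> \<pi> g y"
  using pi_unitary[of g] by (auto simp: unitary_group_def)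

lemma pi_smult: "g \<in> G \<Longrightarrow> x \<in> carrier H \<Longrightarrow> \<pi> g (c \<odot>\<^bsub>H\<^esub> x) = c \<odot>\<^bsub>H\<^esub> \<pi> g x"
  using pi_unitary[of g] by (auto simp: unitary_group_def)

lemma pi_ip [simp]: "g \<in> G \<Longrightarrow> x \<in> carrier H \<Longrightarrow> y \<in> carrier H \<Longrightarrow> ip H (\<pi> g x) (\<pi> g y) = ip H x y"
  using pi_unitary[of g] by (auto simp: unitary_group_def)

lemma pi_mult:
  assumes "g \<in> G" "h \<in> G" "x \<in> carrier H"
  shows "\<pi> (g \<otimes>\<^bsub>BijGroup \<Omega>\<^esub> h) x = \<pi> g (\<pi> h x)"
proof -
  have "\<pi> (g \<otimes>\<^bsub>BijGroup \<Omega>\<^esub> h) = \<pi> g \<otimes>\<^bsub>unitary_group H\<^esub> \<pi> h"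
    using unitary assms by (auto simp: unitary_representation_def hom_def)
  also have "\<dots> = compose (carrier H) (\<pi> g) (\<pi> h)"
    using pi_unitary assms by (auto simp: unitary_group_def BijGroup_def)
  finally show ?thesis using assms by (simp add: compose_def)
qed

lemma pi_one:
  assumes "x \<in> carrier H" shows "\<pi> \<one>\<^bsub>BijGroup \<Omega>\<^esub> x = x"
proof -
  interpret Group.group "BijGroup \<Omega>" by (rule group_BijGroup)
  have 1: "\<one>\<^bsub>BijGroup \<Omega>\<^esub> \<in> G" by (rule subgroup.one_closed[OF subgroup_G])
  let ?y = "\<pi> \<one>\<^bsub>BijGroup \<Omega>\<^esub> x"
  \<comment> \<open>An injective idempotent map is the identity.\<close>
  have "\<pi> \<one>\<^bsub>BijGroup \<Omega>\<^esub> ?y = ?y" using pi_mult[OF 1 1 assms] by simp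
  moreover have "inj_on (\<pi> \<one>\<^bsub>BijGroup \<Omega>\<^esub>) (carrier H)"
    using pi_unitary[OF 1] by (auto simp: unitary_group_def Bij_def bij_betw_def)
  ultimately show ?thesis using assms 1 by (meson inj_onD pi_closed)
qed

lemma pi_diff:
  assumes "g \<in> G" "x \<in> carrier H" "y \<in> carrier H"
  shows "\<pi> g (x \<ominus>\<^bsub>H\<^esub> y) = \<pi> g x \<ominus>\<^bsub>H\<^esub> \<pi> g y"
proof (rule vector_eqI)
  fix z assume z: "z \<in> carrier H"
  have "x = (x \<ominus>\<^bsub>H\<^esub> y) \<oplus>\<^bsub>H\<^esub> y"
    by (rule vector_eqI) (use assms in \<open>auto simp: ip_linear\<close>)
  then have "\<pi> g x = \<pi> g (x \<ominus>\<^bsub>H\<^esub> y) \<oplus>\<^bsub>H\<^esub> \<pi> g y"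
    using pi_add[of g "x \<ominus>\<^bsub>H\<^esub> y" y] assms by simp
  then have "ip H (\<pi> g x) z = ip H (\<pi> g (x \<ominus>\<^bsub>H\<^esub> y)) z + ip H (\<pi> g y) z"
    using assms z by (simp add: ip_linear)
  then show "ip H (\<pi> g (x \<ominus>\<^bsub>H\<^esub> y)) z = ip H (\<pi> g x \<ominus>\<^bsub>H\<^esub> \<pi> g y) z"
    using assms z by simp
qed (use assms in auto)

lemma hnorm_pi: "g \<in> G \<Longrightarrow> x \<in> carrier H \<Longrightarrow> hnorm H (\<pi> g x) = hnorm H x"
  by (simp add: hnorm_def)

lemma pi_zero: "g \<in> G \<Longrightarrow> \<pi> g \<zero>\<^bsub>H\<^esub> = \<zero>\<^bsub>H\<^esub>"
  using hnorm_pi[of g "\<zero>\<^bsub>H\<^esub>"] hnorm_eq_0[of "\<pi> g \<zero>\<^bsub>H\<^esub>"] hnorm_eq_0[of "\<zero>\<^bsub>H\<^esub>"] by simp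

lemma fixed_vectors_iff:
  "\<xi> \<in> fixed_vectors G H \<pi> A \<longleftrightarrow> \<xi> \<in> carrier H \<and> (\<forall>g\<in>pointwise_stabilizer G A. \<pi> g \<xi> = \<xi>)"
  by (simp add: fixed_vectors_def)

lemma fixed_vectors_mono: "A \<subseteq> B \<Longrightarrow> fixed_vectors G H \<pi> A \<subseteq> fixed_vectors G H \<pi> B"
  by (auto simp: fixed_vectors_def pointwise_stabilizer_def)

lemma closed_subspace_fixed: "closed_subspace (fixed_vectors G H \<pi> A)"
proof -
  have stab: "g \<in> G" if "g \<in> pointwise_stabilizer G A" for g
    using that by (simp add: pointwise_stabilizer_def)
  have "x \<in> fixed_vectors G H \<pi> A" if s: "range s \<subseteq> fixed_vectors G H \<pi> A" and t: "tends s x" for s x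
    unfolding fixed_vectors_iff
  proof (intro conjI ballI)
    have c: "s n \<in> carrier H" for n using range_subsetD[OF s, of n] by (simp add: fixed_vectors_iff)
    show x: "x \<in> carrier H" using t by (simp add: tends_def)
    fix g assume g: "g \<in> pointwise_stabilizer G A"
    note gG = stab[OF g]
    have lim: "(\<lambda>n. 2 * hnorm H (s n \<ominus>\<^bsub>H\<^esub> x)) \<longlonglongrightarrow> 2 * 0"
      using t by (intro tendsto_intros) (simp add: tends_def)
    have "hnorm H (\<pi> g x \<ominus>\<^bsub>H\<^esub> x) \<le> 2 * 0"
    proof (rule LIMSEQ_le_const[OF lim], intro exI allI impI)
      fix n
      have e: "\<pi> g (s n) = s n" using range_subsetD[OF s, of n] g by (simp add: fixed_vectors_iff)
      have "hnorm H (\<pi> g x \<ominus>\<^bsub>H\<^esub> x) \<le> hnorm H (\<pi> g x \<ominus>\<^bsub>H\<^esub> s n) + hnorm H (s n \<ominus>\<^bsub>H\<^esub> x)"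
        using gG x c by (intro hnorm_diff_triangle) auto
      also have "hnorm H (\<pi> g x \<ominus>\<^bsub>H\<^esub> s n) = hnorm H (\<pi> g (x \<ominus>\<^bsub>H\<^esub> s n))"
        using gG x c by (simp add: pi_diff e)
      also have "\<dots> = hnorm H (s n \<ominus>\<^bsub>H\<^esub> x)"
        using gG x c by (simp add: hnorm_pi hnorm_diff_commute[of x])
      finally show "hnorm H (\<pi> g x \<ominus>\<^bsub>H\<^esub> x) \<le> 2 * hnorm H (s n \<ominus>\<^bsub>H\<^esub> x)" by simp
    qed
    then have "hnorm H (\<pi> g x \<ominus>\<^bsub>H\<^esub> x) = 0" using gG x by (simp add: order_antisym)
    then show "\<pi> g x = x" using gG x by (simp add: hnorm_eq_0 diff_eq_zero_iff)
  qed
  then show ?thesis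
    unfolding closed_subspace_def closed_real_subspace_def
    by (auto simp: fixed_vectors_iff stab pi_add pi_smult pi_zero)
qed

lemmas fixed_proj_in = orth_proj_in[OF closed_subspace_fixed]
  and fixed_proj_orth = orth_proj_orth[OF closed_subspace_fixed]
  and fixed_proj_eqI = orth_proj_eqI[OF closed_subspace_fixed]

lemma fixed_proj_closed: "\<xi> \<in> carrier H \<Longrightarrow> orth_proj H (fixed_vectors G H \<pi> A) \<xi> \<in> carrier H"
  using fixed_proj_in[of \<xi> A] by (simp add: fixed_vectors_iff)

lemma dissociated_rep_ip:
  assumes "dissociated_rep \<Omega> G H \<pi>" "finite A" "A \<subseteq> \<Omega>" "finite B" "B \<subseteq> \<Omega>"
    and x: "\<xi> \<in> fixed_vectors G H \<pi> A" and z: "\<zeta> \<in> fixed_vectors G H \<pi> B"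
  shows "ip H \<zeta> \<xi> = ip H (orth_proj H (fixed_vectors G H \<pi> (A \<inter> B)) \<zeta>) \<xi>"
proof -
  have c: "\<xi> \<in> carrier H" "\<zeta> \<in> carrier H" using x z by (auto simp: fixed_vectors_iff)
  have "orth_proj H (fixed_vectors G H \<pi> B) \<zeta> = \<zeta>"
    using c by (intro fixed_proj_eqI z) (auto simp: fixed_vectors_iff)
  then have "orth_proj H (fixed_vectors G H \<pi> A) \<zeta> = orth_proj H (fixed_vectors G H \<pi> (A \<inter> B)) \<zeta>"
    using assms c unfolding dissociated_rep_def by metis
  then have "ip H (\<zeta> \<ominus>\<^bsub>H\<^esub> orth_proj H (fixed_vectors G H \<pi> (A \<inter> B)) \<zeta>) \<xi> = 0"
    using fixed_proj_orth[OF c(2) x] by simp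
  then show ?thesis using c fixed_proj_closed by simp
qed

lemma G_carr: "g \<in> G \<Longrightarrow> g \<in> carrier (BijGroup \<Omega>)"
  using subgroup.subset[OF subgroup_G] by blast

lemma G_mult: "g \<in> G \<Longrightarrow> h \<in> G \<Longrightarrow> g \<otimes>\<^bsub>BijGroup \<Omega>\<^esub> h \<in> G"
  by (rule subgroup.m_closed[OF subgroup_G])

lemma G_inv: "g \<in> G \<Longrightarrow> inv\<^bsub>BijGroup \<Omega>\<^esub> g \<in> G"
  by (rule subgroup.m_inv_closed[OF subgroup_G])

lemma pi_inv:
  assumes g: "g \<in> G" and x: "x \<in> carrier H"
  shows "\<pi> (inv\<^bsub>BijGroup \<Omega>\<^esub> g) (\<pi> g x) = x" "\<pi> g (\<pi> (inv\<^bsub>BijGroup \<Omega>\<^esub> g) x) = x"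
proof -
  interpret B: Group.group "BijGroup \<Omega>" by (rule group_BijGroup)
  show "\<pi> (inv\<^bsub>BijGroup \<Omega>\<^esub> g) (\<pi> g x) = x" "\<pi> g (\<pi> (inv\<^bsub>BijGroup \<Omega>\<^esub> g) x) = x"
    using pi_mult[OF G_inv[OF g] g x] pi_mult[OF g G_inv[OF g] x] pi_one[OF x] G_carr[OF g] by simp_all
qed

text \<open>If \<open>g\<close> and \<open>h\<close> agree on \<open>A\<close>, then \<open>h\<^sup>-\<^sup>1 g\<close> lies in \<open>G\<^sub>A\<close>.\<close>

lemma pi_eq_of_agree:
  assumes xi: "\<xi> \<in> fixed_vectors G H \<pi> A" and A: "A \<subseteq> \<Omega>" and g: "g \<in> G" and h: "h \<in> G"
    and ag: "\<forall>a\<in>A. g a = h a"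
  shows "\<pi> g \<xi> = \<pi> h \<xi>"
proof -
  have c: "\<xi> \<in> carrier H" using xi by (simp add: fixed_vectors_iff)
  let ?k = "inv\<^bsub>BijGroup \<Omega>\<^esub> h \<otimes>\<^bsub>BijGroup \<Omega>\<^esub> g"
  have k: "?k \<in> G" using G_mult G_inv g h by blast
  have "?k a = a" if "a \<in> A" for a
  proof -
    have a: "a \<in> \<Omega>" using that A by auto
    have "?k a = (inv\<^bsub>BijGroup \<Omega>\<^esub> h) (h a)"
      using BijGroup_mult_apply[OF G_carr[OF G_inv[OF h]] G_carr[OF g] a] ag that by simp
    then show ?thesis using BijGroup_inv_apply[OF G_carr[OF h] a] by simp
  qed
  then have "?k \<in> pointwise_stabilizer G A" using k by (simp add: pointwise_stabilizer_def)
  then have "\<pi> ?k \<xi> = \<xi>" using xi by (simp add: fixed_vectors_iff)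
  then have "\<pi> (inv\<^bsub>BijGroup \<Omega>\<^esub> h) (\<pi> g \<xi>) = \<xi>" using pi_mult[OF G_inv[OF h] g c] by simp
  then show ?thesis using pi_inv(2)[OF h, of "\<pi> g \<xi>"] g c by simp
qed

text \<open>A vector of the orbit depends only on the restriction of \<open>g\<close> to \<open>A\<close>, and there are countably
  many functions from a finite set to \<open>\<Omega>\<close>.\<close>

lemma countable_orbit:
  assumes xi: "\<xi> \<in> fixed_vectors G H \<pi> A" and A: "finite A" "A \<subseteq> \<Omega>" and cnt: "countable \<Omega>"
  shows "countable ((\<lambda>g. \<pi> g \<xi>) ` G)"
proof -
  have "(\<lambda>g. restrict g A) ` G \<subseteq> (\<Pi>\<^sub>E a\<in>A. \<Omega>)"
  proof (intro image_subsetI)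
    fix g assume "g \<in> G"
    then have "bij_betw g \<Omega> \<Omega>" using G_carr by (auto simp: BijGroup_def Bij_def)
    then show "restrict g A \<in> (\<Pi>\<^sub>E a\<in>A. \<Omega>)" using A(2) by (auto dest: bij_betwE)
  qed
  moreover have "countable (\<Pi>\<^sub>E a\<in>A. \<Omega>)" using A(1) cnt by (intro countable_PiE) auto
  ultimately have c: "countable ((\<lambda>g. restrict g A) ` G)" by (rule countable_subset)
  have "\<pi> g \<xi> = \<pi> (SOME h. h \<in> G \<and> restrict h A = restrict g A) \<xi>" if g: "g \<in> G" for g
  proof -
    define h where "h = (SOME h. h \<in> G \<and> restrict h A = restrict g A)"
    have h: "h \<in> G \<and> restrict h A = restrict g A"
      unfolding h_def by (rule someI[of _ g]) (simp add: g)
    then have "\<forall>a\<in>A. g a = h a" by (metis restrict_apply)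
    then show ?thesis using pi_eq_of_agree[OF xi A(2) g] h unfolding h_def[symmetric] by blast
  qed
  then have "(\<lambda>g. \<pi> g \<xi>) ` G = (\<lambda>r. \<pi> (SOME h. h \<in> G \<and> restrict h A = r) \<xi>) ` ((\<lambda>g. restrict g A) ` G)"
    unfolding image_image by (intro image_cong) auto
  then show ?thesis using c by simp
qed

lemma fixed_translate:
  assumes xi: "\<xi> \<in> fixed_vectors G H \<pi> A" and A: "A \<subseteq> \<Omega>" and h: "h \<in> G"
  shows "\<pi> h \<xi> \<in> fixed_vectors G H \<pi> (h ` A)"
proof -
  have c: "\<xi> \<in> carrier H" using xi by (simp add: fixed_vectors_iff)
  have "\<pi> g (\<pi> h \<xi>) = \<pi> h \<xi>" if g: "g \<in> pointwise_stabilizer G (h ` A)" for g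
  proof -
    have gG: "g \<in> G" using g by (simp add: pointwise_stabilizer_def)
    have "\<forall>a\<in>A. (g \<otimes>\<^bsub>BijGroup \<Omega>\<^esub> h) a = h a"
      using g A BijGroup_mult_apply[OF G_carr[OF gG] G_carr[OF h]] by (auto simp: pointwise_stabilizer_def)
    from pi_eq_of_agree[OF xi A G_mult[OF gG h] h this] show ?thesis
      using pi_mult[OF gG h c] by simp
  qed
  then show ?thesis using c h by (simp add: fixed_vectors_iff)
qed

text \<open>The identity \<open>p\<^sub>A p\<^sub>B = p\<^sub>A\<^sub>\<inter>\<^sub>B\<close> is tested at \<open>\<xi>\<close> on the vector \<open>p\<^sub>B \<xi> - p\<^sub>A\<^sub>\<inter>\<^sub>B \<xi>\<close>: it is fixed by \<open>G\<^sub>B\<close> and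
  orthogonal to the vectors fixed by \<open>G\<^sub>A\<^sub>\<inter>\<^sub>B\<close>, and it has to be orthogonal to those fixed by \<open>G\<^sub>A\<close>.
  The latter form a complex subspace, so real parts suffice.\<close>

lemma dissociated_repI:
  assumes "\<And>A B \<xi> \<zeta>. finite A \<Longrightarrow> A \<subseteq> \<Omega> \<Longrightarrow> finite B \<Longrightarrow> B \<subseteq> \<Omega> \<Longrightarrow>
     \<xi> \<in> fixed_vectors G H \<pi> A \<Longrightarrow> \<zeta> \<in> fixed_vectors G H \<pi> B \<Longrightarrow>
     (\<And>\<theta>. \<theta> \<in> fixed_vectors G H \<pi> (A \<inter> B) \<Longrightarrow> ip H \<zeta> \<theta> = 0) \<Longrightarrow> Re (ip H \<zeta> \<xi>) = 0"
  shows "dissociated_rep \<Omega> G H \<pi>"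
  unfolding dissociated_rep_def
proof (intro allI impI ballI)
  fix A B \<xi> assume A: "finite A" "A \<subseteq> \<Omega>" and B: "finite B" "B \<subseteq> \<Omega>" and xi: "\<xi> \<in> carrier H"
  let ?F = "fixed_vectors G H \<pi>"
  let ?P = "\<lambda>A. orth_proj H (?F A)"
  have CA: "?F (A \<inter> B) \<subseteq> ?F A" and CB: "?F (A \<inter> B) \<subseteq> ?F B" by (auto intro!: fixed_vectors_mono)
  have Fc: "x \<in> carrier H" if "x \<in> ?F A" for x A using that by (simp add: fixed_vectors_iff)
  define \<beta> where "\<beta> = ?P B \<xi>"
  define \<gamma> where "\<gamma> = ?P (A \<inter> B) \<xi>"
  have b: "\<beta> \<in> ?F B" and g: "\<gamma> \<in> ?F (A \<inter> B)" using fixed_proj_in xi by (auto simp: \<beta>_def \<gamma>_def)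
  note bc = Fc[OF b] and gc = Fc[OF g]
  have d: "\<beta> \<ominus>\<^bsub>H\<^esub> \<gamma> \<in> ?F B"
    using b g CB by (auto simp: fixed_vectors_iff pi_diff pointwise_stabilizer_def)
  have orth: "ip H (\<beta> \<ominus>\<^bsub>H\<^esub> \<gamma>) \<theta> = 0" if t: "\<theta> \<in> ?F (A \<inter> B)" for \<theta>
  proof -
    have "ip H (\<xi> \<ominus>\<^bsub>H\<^esub> \<beta>) \<theta> = 0" using fixed_proj_orth[OF xi, of \<theta> B] CB t by (auto simp: \<beta>_def)
    moreover have "ip H (\<xi> \<ominus>\<^bsub>H\<^esub> \<gamma>) \<theta> = 0" using fixed_proj_orth[OF xi t] by (simp add: \<gamma>_def)
    ultimately show ?thesis using xi bc gc Fc[OF t] by simp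
  qed
  have "?P A \<beta> = \<gamma>"
  proof (rule fixed_proj_eqI)
    show "\<beta> \<in> carrier H" "\<gamma> \<in> ?F A" using bc g CA by auto
    fix \<theta> assume t: "\<theta> \<in> ?F A"
    show "ip H (\<beta> \<ominus>\<^bsub>H\<^esub> \<gamma>) \<theta> = 0"
    proof (rule Re_orth_imp_orth[of _ "?F A"])
      show "Re (ip H (\<beta> \<ominus>\<^bsub>H\<^esub> \<gamma>) z) = 0" if "z \<in> ?F A" for z
        using assms[OF A B that d orth] .
    qed (use bc gc t Fc closed_subspace_fixed[of A] in \<open>auto simp: closed_subspace_def\<close>)
  qed
  then show "?P A (?P B \<xi>) = ?P (A \<inter> B) \<xi>" by (simp add: \<beta>_def \<gamma>_def)
qed

end

section \<open>The Koopman representation\<close>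

locale koopman = boolean_action \<Omega> G M \<alpha> + L2_space M enc
  for \<Omega> :: "'w set" and G and M :: "'x measure" and \<alpha> and enc :: "('x \<Rightarrow> complex) \<Rightarrow> 'h"
begin

definition koop :: "('w \<Rightarrow> 'w) \<Rightarrow> 'h \<Rightarrow> 'h" where
  "koop g = (\<lambda>a\<in>carrier LH. enc (\<lambda>x. dec a (rep_inv g x)))"

lemma integral_mp:
  fixes f :: "'x \<Rightarrow> 'b :: {banach, second_countable_topology}"
  assumes T: "T \<in> measurable M M" "distr M M T = M"
  shows "f \<in> borel_measurable M \<Longrightarrow> (\<integral>x. f (T x) \<partial>M) = (\<integral>x. f x \<partial>M)"
    and "integrable M f \<Longrightarrow> integrable M (\<lambda>x. f (T x))"
  using integral_distr[OF T(1), of f] integrable_distr[OF T(1), of f] T(2) by auto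

lemma comp_L2:
  assumes T: "T \<in> measurable M M" "distr M M T = M" and f: "f \<in> L2 M"
  shows "(\<lambda>x. f (T x)) \<in> L2 M"
  using f integral_mp(2)[OF T, of "\<lambda>x. (cmod (f x))\<^sup>2"] measurable_compose[OF T(1), of f]
  by (simp add: L2_def)

lemma rep_inv_L2: "g \<in> G \<Longrightarrow> f \<in> L2 M \<Longrightarrow> (\<lambda>x. f (rep_inv g x)) \<in> L2 M"
  using comp_L2[OF rep_props(2,6)] .

lemma koop_enc:
  assumes g: "g \<in> G" and f: "f \<in> L2 M" shows "koop g (enc f) = enc (\<lambda>x. f (rep_inv g x))"
proof -
  have "AE x in M. dec (enc f) (rep_inv g x) = f (rep_inv g x)"
    by (rule AE_mp[OF rep_props(6)[OF g] rep_props(2)[OF g] dec_enc[OF f]])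
  then show ?thesis
    using g f by (auto simp: koop_def intro!: enc_cong rep_inv_L2 dec_in)
qed

lemma koop_closed: "g \<in> G \<Longrightarrow> a \<in> carrier LH \<Longrightarrow> koop g a \<in> carrier LH"
  by (auto simp: koop_def intro!: enc_in rep_inv_L2 dec_in)

lemma koop_mult:
  assumes g: "g \<in> G" and h: "h \<in> G" and a: "a \<in> carrier LH"
  shows "koop (g \<otimes>\<^bsub>BijGroup \<Omega>\<^esub> h) a = koop g (koop h a)"
proof -
  obtain f where f: "f \<in> L2 M" and a: "a = enc f" using a by (auto simp: LH_simps(1))
  have "AE x in M. f (rep_inv (g \<otimes>\<^bsub>BijGroup \<Omega>\<^esub> h) x) = f (rep_inv h (rep_inv g x))"
    using rep_inv_mult[OF g h] by eventually_elim simp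
  then show ?thesis
    using f g h G_mult[OF g h] by (auto simp: a koop_enc rep_inv_L2 intro!: enc_cong rep_inv_L2[OF g, of "\<lambda>x. f (rep_inv h x)"])
qed

lemma koop_unitary:
  assumes g: "g \<in> G" shows "koop g \<in> carrier (unitary_group LH)"
proof -
  note p = rep_props[OF g]
  have "koop g \<in> Bij (carrier LH)"
    unfolding Bij_def
  proof (intro IntI CollectI bij_betw_byWitness[where f' = "\<lambda>a. enc (\<lambda>x. dec a (rep g x))"] ballI)
    show "koop g \<in> extensional (carrier LH)" by (simp add: koop_def)
    show "koop g ` carrier LH \<subseteq> carrier LH" using koop_closed[OF g] by auto
    show "(\<lambda>a. enc (\<lambda>x. dec a (rep g x))) ` carrier LH \<subseteq> carrier LH"
      by (auto intro!: enc_in comp_L2 p dec_in)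
  next
    fix a assume "a \<in> carrier LH"
    then obtain f where f: "f \<in> L2 M" and a: "a = enc f" by (auto simp: LH_simps(1))
    have 1: "AE x in M. dec (enc (\<lambda>x. f (rep_inv g x))) (rep g x) = f (rep_inv g (rep g x))"
      by (rule AE_mp[OF p(5,1) dec_enc[OF rep_inv_L2[OF g f]]])
    have "AE x in M. dec (enc (\<lambda>x. f (rep_inv g x))) (rep g x) = f x"
      using 1 AE_space by eventually_elim (simp add: p(3))
    then show "enc (\<lambda>x. dec (koop g a) (rep g x)) = a"
      unfolding a koop_enc[OF g f]
      by (intro enc_cong f comp_L2[OF p(1,5)] dec_in enc_in rep_inv_L2[OF g f])
    have 2: "AE x in M. dec (enc f) (rep g (rep_inv g x)) = f (rep g (rep_inv g x))"
      using AE_mp[OF p(6,2) AE_mp[OF p(5,1) dec_enc[OF f]]] .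
    have "AE x in M. dec (enc f) (rep g (rep_inv g x)) = f x"
      using 2 AE_space by eventually_elim (simp add: p(4))
    then show "koop g (enc (\<lambda>x. dec a (rep g x))) = a"
      unfolding a
      by (subst koop_enc[OF g]) (auto intro!: enc_cong f rep_inv_L2[OF g, of "\<lambda>x. dec (enc f) (rep g x)"] comp_L2[OF p(1,5)] dec_in enc_in)
  qed
  moreover have "koop g (x \<oplus>\<^bsub>LH\<^esub> y) = koop g x \<oplus>\<^bsub>LH\<^esub> koop g y \<and> ip LH (koop g x) (koop g y) = ip LH x y"
    if c: "x \<in> carrier LH" "y \<in> carrier LH" for x y
  proof -
    obtain f h where f: "f \<in> L2 M" "h \<in> L2 M" and x: "x = enc f" "y = enc h"
      using c by (auto simp: LH_simps(1))
    have "(\<integral>x. f (rep_inv g x) * cnj (h (rep_inv g x)) \<partial>M) = (\<integral>x. f x * cnj (h x) \<partial>M)"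
      using L2_prod_integrable[OF f] by (intro integral_mp(1)[OF p(2,6)]) auto
    then show ?thesis using f g by (simp add: x enc_add koop_enc ip_enc rep_inv_L2 L2_add)
  qed
  moreover have "koop g (c \<odot>\<^bsub>LH\<^esub> x) = c \<odot>\<^bsub>LH\<^esub> koop g x" if c: "x \<in> carrier LH" for c x
  proof -
    obtain f where f: "f \<in> L2 M" and x: "x = enc f" using c by (auto simp: LH_simps(1))
    show ?thesis using f g by (simp add: x enc_smult koop_enc rep_inv_L2 L2_smult)
  qed
  ultimately show ?thesis by (auto simp: unitary_group_def)
qed

lemma koop_add:
  assumes g: "g \<in> G" and "a \<in> carrier LH" "b \<in> carrier LH"
  shows "koop g (a \<oplus>\<^bsub>LH\<^esub> b) = koop g a \<oplus>\<^bsub>LH\<^esub> koop g b"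
  using koop_unitary[OF g] assms by (auto simp: unitary_group_def)

lemma koop_smult:
  assumes g: "g \<in> G" and "a \<in> carrier LH"
  shows "koop g (c \<odot>\<^bsub>LH\<^esub> a) = c \<odot>\<^bsub>LH\<^esub> koop g a"
  using koop_unitary[OF g] assms by (auto simp: unitary_group_def)

lemma koop_diff:
  assumes g: "g \<in> G" and "a \<in> carrier LH" "b \<in> carrier LH"
  shows "koop g (a \<ominus>\<^bsub>LH\<^esub> b) = koop g a \<ominus>\<^bsub>LH\<^esub> koop g b"
proof -
  obtain f h where f: "f \<in> L2 M" "h \<in> L2 M" and x: "a = enc f" "b = enc h"
    using assms by (auto simp: LH_simps(1))
  show ?thesis using f g by (simp add: x enc_diff koop_enc rep_inv_L2 L2_diff)
qed

lemma hnorm_koop: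
  assumes g: "g \<in> G" and "a \<in> carrier LH" shows "hnorm LH (koop g a) = hnorm LH a"
  using koop_unitary[OF g] assms by (auto simp: unitary_group_def hnorm_def)

abbreviation "topG \<equiv> subtopology (sym_topology \<Omega>) G"

definition orbit_continuous :: "'h \<Rightarrow> bool" where
  "orbit_continuous a \<longleftrightarrow> a \<in> carrier LH \<and>
     (\<forall>g0\<in>G. \<forall>e>0. \<exists>U. openin topG U \<and> g0 \<in> U \<and>
        (\<forall>g\<in>U. hnorm LH (koop g a \<ominus>\<^bsub>LH\<^esub> koop g0 a) < e))"

lemma open_subset_G: "openin topG U \<Longrightarrow> U \<subseteq> G"
  using openin_subset topspace_G by fastforce

text \<open>For indicators the distance in \<open>L\<^sup>2\<close> is the square root of the measure of a symmetric
  difference, which is what the weak topology controls.\<close>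

lemma orbit_continuous_indicator:
  assumes Y: "Y \<in> sets M" shows "orbit_continuous (enc (indicator Y))"
  unfolding orbit_continuous_def
proof (intro conjI ballI allI impI)
  have iL: "indicator Z \<in> L2 M" if "Z \<in> sets M" for Z
    using that by (intro L2_bounded[of _ 1]) (auto simp: indicator_def)
  show "enc (indicator Y) \<in> carrier LH" using iL[OF Y] by simp
  fix g0 and e :: real assume g0: "g0 \<in> G" and e: "0 < e"
  have k: "koop g (enc (indicator Y)) = enc (indicator (rep g ` Y))" if g: "g \<in> G" for g
  proof -
    note im = mp_group_image[OF rep_mp[OF g] Y]
    show ?thesis
      unfolding koop_enc[OF g iL[OF Y]] im(1)
      using im(2) iL[OF Y] rep_inv_L2[OF g iL[OF Y]] iL[OF im(2)]
      by (intro enc_cong AE_I2) (auto simp: indicator_def rep_inv_def im(1))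
  qed
  have d: "hnorm LH (koop g (enc (indicator Y)) \<ominus>\<^bsub>LH\<^esub> koop g0 (enc (indicator Y)))
      = sqrt (measure M (sym_diff (rep g ` Y) (rep g0 ` Y)))" if g: "g \<in> G" for g
  proof -
    let ?A = "rep g ` Y" and ?B = "rep g0 ` Y"
    have s: "?A \<in> sets M" "?B \<in> sets M" using mp_group_image(2) rep_mp g g0 Y by blast+
    have "(\<integral>x. (cmod (indicator ?A x - indicator ?B x))\<^sup>2 \<partial>M) = (\<integral>x. indicator (sym_diff ?A ?B) x \<partial>M)"
      by (intro Bochner_Integration.integral_cong) (auto simp: indicator_def)
    also have "\<dots> = measure M (sym_diff ?A ?B)"
      using s by (subst Bochner_Integration.integral_indicator) (auto simp: Int_absorb2 sets.sets_into_space)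
    finally show ?thesis
      using iL[OF s(1)] iL[OF s(2)] by (simp add: k g g0 enc_diff hnorm_enc L2_diff)
  qed
  obtain U where U: "openin topG U" "g0 \<in> U"
    "\<And>g. g \<in> U \<Longrightarrow> measure M (sym_diff (rep g ` Y) (rep g0 ` Y)) < e\<^sup>2"
    using weak_continuity[OF g0 Y, of "e\<^sup>2"] e by auto
  have "hnorm LH (koop g (enc (indicator Y)) \<ominus>\<^bsub>LH\<^esub> koop g0 (enc (indicator Y))) < e" if "g \<in> U" for g
  proof -
    have "g \<in> G" using that open_subset_G[OF U(1)] by blast
    then show ?thesis using U(3)[OF that] e d by (simp add: real_less_lsqrt)
  qed
  then show "\<exists>U. openin topG U \<and> g0 \<in> U \<and>
        (\<forall>g\<in>U. hnorm LH (koop g (enc (indicator Y)) \<ominus>\<^bsub>LH\<^esub> koop g0 (enc (indicator Y))) < e)"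
    using U(1,2) by blast
qed

lemma orbit_continuous_combination:
  assumes ab: "orbit_continuous a" "orbit_continuous b"
  shows "orbit_continuous (a \<oplus>\<^bsub>LH\<^esub> c \<odot>\<^bsub>LH\<^esub> b)"
  unfolding orbit_continuous_def
proof (intro conjI ballI allI impI)
  have ac: "a \<in> carrier LH" and bc: "b \<in> carrier LH" using ab by (auto simp: orbit_continuous_def)
  show "a \<oplus>\<^bsub>LH\<^esub> c \<odot>\<^bsub>LH\<^esub> b \<in> carrier LH" using ac bc by simp
  fix g0 and e :: real assume g0: "g0 \<in> G" and e: "0 < e"
  define d where "d = e / (cmod c + 1)"
  have d: "0 < d" and ed: "d + cmod c * d = e"
  proof -
    have "0 < cmod c + 1" by (simp add: add_nonneg_pos)
    moreover have "d + cmod c * d = (cmod c + 1) * d" by (simp add: algebra_simps)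
    ultimately show "0 < d" "d + cmod c * d = e" using e by (simp_all add: d_def)
  qed
  obtain U where U: "openin topG U" "g0 \<in> U" "\<And>g. g \<in> U \<Longrightarrow> hnorm LH (koop g a \<ominus>\<^bsub>LH\<^esub> koop g0 a) < d"
    using ab(1) g0 d unfolding orbit_continuous_def by meson
  obtain V where V: "openin topG V" "g0 \<in> V" "\<And>g. g \<in> V \<Longrightarrow> hnorm LH (koop g b \<ominus>\<^bsub>LH\<^esub> koop g0 b) < d"
    using ab(2) g0 d unfolding orbit_continuous_def by meson
  have "hnorm LH (koop g (a \<oplus>\<^bsub>LH\<^esub> c \<odot>\<^bsub>LH\<^esub> b) \<ominus>\<^bsub>LH\<^esub> koop g0 (a \<oplus>\<^bsub>LH\<^esub> c \<odot>\<^bsub>LH\<^esub> b)) < e" if g: "g \<in> U \<inter> V" for g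
  proof -
    have gG: "g \<in> G" using g open_subset_G[OF U(1)] by blast
    let ?da = "koop g a \<ominus>\<^bsub>LH\<^esub> koop g0 a" and ?db = "koop g b \<ominus>\<^bsub>LH\<^esub> koop g0 b"
    note kc = koop_closed[OF gG ac] koop_closed[OF gG bc] koop_closed[OF g0 ac] koop_closed[OF g0 bc]
    have "koop g (a \<oplus>\<^bsub>LH\<^esub> c \<odot>\<^bsub>LH\<^esub> b) \<ominus>\<^bsub>LH\<^esub> koop g0 (a \<oplus>\<^bsub>LH\<^esub> c \<odot>\<^bsub>LH\<^esub> b) = ?da \<oplus>\<^bsub>LH\<^esub> c \<odot>\<^bsub>LH\<^esub> ?db"
      by (rule LH.vector_eqI)
        (use kc ac bc gG g0 in \<open>auto simp: LH.ip_linear koop_add koop_smult algebra_simps\<close>)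
    then have "hnorm LH (koop g (a \<oplus>\<^bsub>LH\<^esub> c \<odot>\<^bsub>LH\<^esub> b) \<ominus>\<^bsub>LH\<^esub> koop g0 (a \<oplus>\<^bsub>LH\<^esub> c \<odot>\<^bsub>LH\<^esub> b))
        \<le> hnorm LH ?da + cmod c * hnorm LH ?db"
      using LH.hnorm_triangle[of ?da "c \<odot>\<^bsub>LH\<^esub> ?db"] kc by (simp add: LH.hnorm_smult)
    also have "\<dots> < d + cmod c * d"
      using U(3)[of g] V(3)[of g] g by (intro add_less_le_mono mult_left_mono) auto
    finally show ?thesis by (simp only: ed)
  qed
  then show "\<exists>U. openin topG U \<and> g0 \<in> U \<and> (\<forall>g\<in>U.
      hnorm LH (koop g (a \<oplus>\<^bsub>LH\<^esub> c \<odot>\<^bsub>LH\<^esub> b) \<ominus>\<^bsub>LH\<^esub> koop g0 (a \<oplus>\<^bsub>LH\<^esub> c \<odot>\<^bsub>LH\<^esub> b)) < e)"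
    using openin_Int[OF U(1) V(1)] U(2) V(2) by blast
qed

lemma orbit_continuous_smult:
  assumes "orbit_continuous a" shows "orbit_continuous (c \<odot>\<^bsub>LH\<^esub> a)"
proof -
  have "(indicator {} :: 'x \<Rightarrow> complex) = (\<lambda>_. 0)" by (simp add: fun_eq_iff)
  then have "orbit_continuous \<zero>\<^bsub>LH\<^esub>" using orbit_continuous_indicator[of "{}"] by (simp add: LH_simps(2))
  from orbit_continuous_combination[OF this assms, of c] show ?thesis
    using assms by (simp add: orbit_continuous_def LH.M.l_zero)
qed

lemma orbit_continuous_subspace: "LH.closed_real_subspace {a. orbit_continuous a}"
  unfolding LH.closed_real_subspace_def
proof (intro conjI ballI allI impI; (simp only: mem_Collect_eq)?)
  show "{a. orbit_continuous a} \<subseteq> carrier LH" by (auto simp: orbit_continuous_def)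
  have "(indicator {} :: 'x \<Rightarrow> complex) = (\<lambda>_. 0)" by (simp add: fun_eq_iff)
  then show "orbit_continuous \<zero>\<^bsub>LH\<^esub>" using orbit_continuous_indicator[of "{}"] by (simp add: LH_simps(2))
  show "orbit_continuous (a \<oplus>\<^bsub>LH\<^esub> b)" if "orbit_continuous a" "orbit_continuous b" for a b
    using orbit_continuous_combination[OF that, of 1] that
    by (simp add: orbit_continuous_def LH.smult_one[unfolded complex_ring_simps])
  show "orbit_continuous (complex_of_real t \<odot>\<^bsub>LH\<^esub> a)" if "orbit_continuous a" for t a
    using that by (rule orbit_continuous_smult)
next
  fix s x assume s: "range s \<subseteq> {a. orbit_continuous a}" and t: "LH.tends s x"
  have x: "x \<in> carrier LH" and sc: "s n \<in> carrier LH" for n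
    using t by (auto simp: LH.tends_def)
  show "orbit_continuous x"
    unfolding orbit_continuous_def
  proof (intro conjI ballI allI impI x)
    fix g0 and e :: real assume g0: "g0 \<in> G" and e: "0 < e"
    have e': "0 < e / 3" using e by simp
    have "\<forall>\<^sub>F n in sequentially. hnorm LH (s n \<ominus>\<^bsub>LH\<^esub> x) < e / 3"
      using t e' by (intro order_tendstoD(2)[of _ 0]) (auto simp: LH.tends_def)
    then obtain n where n: "hnorm LH (s n \<ominus>\<^bsub>LH\<^esub> x) < e / 3" by (auto simp: eventually_sequentially)
    have "orbit_continuous (s n)" using s by auto
    then obtain U where U: "openin topG U" "g0 \<in> U"
      "\<And>g. g \<in> U \<Longrightarrow> hnorm LH (koop g (s n) \<ominus>\<^bsub>LH\<^esub> koop g0 (s n)) < e / 3"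
      using g0 e' unfolding orbit_continuous_def by meson
    have "hnorm LH (koop g x \<ominus>\<^bsub>LH\<^esub> koop g0 x) < e" if g: "g \<in> U" for g
    proof -
      have gG: "g \<in> G" using g open_subset_G[OF U(1)] by blast
      note kc = koop_closed[OF gG x] koop_closed[OF g0 x] koop_closed[OF gG sc] koop_closed[OF g0 sc]
      have "hnorm LH (koop h (s n) \<ominus>\<^bsub>LH\<^esub> koop h x) < e / 3" if "h \<in> G" for h
        using n hnorm_koop[OF that, of "s n \<ominus>\<^bsub>LH\<^esub> x"] koop_diff[OF that sc x] sc x by simp
      then have "hnorm LH (koop g x \<ominus>\<^bsub>LH\<^esub> koop g (s n)) < e / 3" "hnorm LH (koop g0 (s n) \<ominus>\<^bsub>LH\<^esub> koop g0 x) < e / 3"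
        using gG g0 kc LH.hnorm_diff_commute[of "koop g x" "koop g (s n)"] by auto
      then show ?thesis
        using LH.hnorm_diff_triangle[OF kc(1) kc(3)[of n] kc(2)]
          LH.hnorm_diff_triangle[OF kc(3)[of n] kc(4)[of n] kc(2)] U(3)[OF g] by linarith
    qed
    then show "\<exists>U. openin topG U \<and> g0 \<in> U \<and> (\<forall>g\<in>U. hnorm LH (koop g x \<ominus>\<^bsub>LH\<^esub> koop g0 x) < e)"
      using U(1,2) by blast
  qed
qed

text \<open>Indicators are total in \<open>L\<^sup>2\<close>: a function orthogonal to all of them has integral zero over
  every measurable set. So continuity of the orbit maps of indicators is enough.\<close>

lemma orbit_continuous: assumes a: "a \<in> carrier LH" shows "orbit_continuous a"
proof -
  obtain \<eta> where e: "orbit_continuous \<eta>" and orth: "\<And>\<zeta>. orbit_continuous \<zeta> \<Longrightarrow> Re (ip LH (a \<ominus>\<^bsub>LH\<^esub> \<eta>) \<zeta>) = 0"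
    using LH.projection_exists[OF orbit_continuous_subspace a] by auto
  have ec: "\<eta> \<in> carrier LH" using e by (simp add: orbit_continuous_def)
  define f where "f = dec (a \<ominus>\<^bsub>LH\<^esub> \<eta>)"
  have f: "f \<in> L2 M" and ef: "enc f = a \<ominus>\<^bsub>LH\<^esub> \<eta>"
    using a ec by (auto simp: f_def dec_in enc_dec)
  have fi: "integrable M f" using L2_integrable[OF f] .
  have "AE x in M. f x = 0"
  proof (rule density_zero[OF fi])
    fix Y assume Y: "Y \<in> sets M"
    have iL: "indicator Y \<in> L2 M"
      using Y by (intro L2_bounded[of _ 1]) (auto simp: indicator_def)
    have ip: "ip LH (enc f) (enc (indicator Y)) = (\<integral>x\<in>Y. f x \<partial>M)"
      unfolding ip_enc[OF f iL] set_lebesgue_integral_def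
      by (intro Bochner_Integration.integral_cong) (auto simp: indicator_def)
    have oi: "orbit_continuous (enc (indicator Y))" by (rule orbit_continuous_indicator[OF Y])
    have "orbit_continuous (\<i> \<odot>\<^bsub>LH\<^esub> enc (indicator Y))" using oi by (rule orbit_continuous_smult)
    from orth[OF this] orth[OF oi] show "(\<integral>x\<in>Y. f x \<partial>M) = 0"
      using f iL by (simp add: complex_eq_iff LH.ip_smult_right flip: ip ef)
  qed
  then have "enc f = \<zero>\<^bsub>LH\<^esub>" unfolding LH_simps(2) using f by (intro enc_cong) auto
  then have "a = \<eta>" using ef a ec LH.diff_eq_zero_iff by simp
  then show ?thesis using e by simp
qed

lemma unitary_koop: "unitary_representation \<Omega> G LH koop"
  unfolding unitary_representation_def
proof (intro conjI ballI)
  show "koop \<in> hom GG (unitary_group LH)"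
  proof (rule homI)
    fix g h assume "g \<in> carrier GG" "h \<in> carrier GG"
    then have g: "g \<in> G" and h: "h \<in> G" by auto
    have "koop (g \<otimes>\<^bsub>BijGroup \<Omega>\<^esub> h) = compose (carrier LH) (koop g) (koop h)"
      using koop_mult[OF g h] G_mult[OF g h]
      by (intro extensionalityI[of _ "carrier LH"]) (auto simp: koop_def[of "g \<otimes>\<^bsub>BijGroup \<Omega>\<^esub> h"] compose_def)
    also have "\<dots> = koop g \<otimes>\<^bsub>unitary_group LH\<^esub> koop h"
      using koop_unitary g h by (auto simp: unitary_group_def BijGroup_def)
    finally show "koop (g \<otimes>\<^bsub>GG\<^esub> h) = koop g \<otimes>\<^bsub>unitary_group LH\<^esub> koop h" by simp
  qed (use koop_unitary in auto)
next
  fix a assume a: "a \<in> carrier LH"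
  show "continuous_map (topG) LH.hm.mtopology (\<lambda>g. koop g a)"
    unfolding LH.hm.continuous_map_to_metric topspace_G
  proof (intro ballI allI impI)
    fix g0 and e :: real assume g0: "g0 \<in> G" and e: "0 < e"
    obtain U where U: "openin topG U" "g0 \<in> U"
          "\<And>g. g \<in> U \<Longrightarrow> hnorm LH (koop g a \<ominus>\<^bsub>LH\<^esub> koop g0 a) < e"
      using orbit_continuous[OF a] g0 e unfolding orbit_continuous_def by meson
    have "koop g a \<in> LH.hm.mball (koop g0 a) e" if "g \<in> U" for g
    proof -
      have gG: "g \<in> G" using that open_subset_G[OF U(1)] by blast
      then show ?thesis
        using U(3)[OF that] koop_closed[OF gG a] koop_closed[OF g0 a] LH.hnorm_diff_commute
        by (simp add: LH.hm.mball_def hdist_def)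
    qed
    then show "\<exists>U. openin topG U \<and> g0 \<in> U \<and>
        (\<forall>y\<in>U. koop y a \<in> LH.hm.mball (koop g0 a) e)" using U by blast
  qed
qed

sublocale K: unitary_rep LH \<Omega> G koop
  by (intro unitary_rep.intro hilbert_LH unitary_rep_axioms.intro subgroup_G unitary_koop)

lemma indicator_L2: "Y \<in> sets M \<Longrightarrow> indicator Y \<in> L2 M"
  by (intro L2_bounded[of _ 1]) (auto simp: indicator_def)

lemma fixed_enc_iff:
  assumes f: "f \<in> L2 M"
  shows "enc f \<in> fixed_vectors G LH koop A \<longleftrightarrow>
    (\<forall>g\<in>pointwise_stabilizer G A. AE x in M. f (rep_inv g x) = f x)"
  using f stab_G[of _ A] enc_eq_iff[OF rep_inv_L2[OF stab_G f] f] by (simp add: K.fixed_vectors_iff koop_enc)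

lemma fixed_indicator:
  assumes "Y \<in> inv_sets A" shows "enc (indicator Y) \<in> fixed_vectors G LH koop A"
proof -
  have Y: "Y \<in> sets M" using assms by (simp add: inv_sets_def)
  have "AE x in M. (indicator Y (rep_inv g x) :: complex) = indicator Y x" if "g \<in> pointwise_stabilizer G A" for g
  proof -
    have "AE x in M. rep_inv g x \<in> Y \<longleftrightarrow> x \<in> Y" using assms that by (simp add: inv_sets_def)
    then show ?thesis by eventually_elim (auto simp: indicator_def)
  qed
  then show ?thesis using fixed_enc_iff[OF indicator_L2[OF Y]] by blast
qed

abbreviation "FA \<equiv> fixed_algebra G M \<alpha>"

text \<open>A representative \<open>h\<close> of \<open>p\<^sub>C 1\<^sub>Y\<close>, where \<open>C = A \<inter> B\<close>, is \<open>F\<^sub>C\<close>-measurable because its class is fixed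
  by \<open>G\<^sub>C\<close>, and it has the same integrals as \<open>1\<^sub>Y\<close> over \<open>F\<^sub>C\<close>; so its real part is the conditional
  expectation of \<open>1\<^sub>Y\<close>. Dissociation says that \<open>1\<^sub>Y\<close> and \<open>p\<^sub>C 1\<^sub>Y\<close> have the same inner product with
  \<open>1\<^sub>Z\<close>.\<close>

lemma indicator_cond_exp:
  assumes dis: "dissociated_rep \<Omega> G LH koop" and A: "finite A" "A \<subseteq> \<Omega>" and B: "finite B" "B \<subseteq> \<Omega>"
    and Y: "Y \<in> inv_sets B" and Z: "Z \<in> inv_sets A"
  shows "measure M (Y \<inter> Z) = (\<integral>x. indicator Z x * real_cond_exp M (FA (A \<inter> B)) (indicator Y) x \<partial>M)"
proof -
  let ?C = "A \<inter> B"
  interpret C: sigma_finite_subalgebra M "FA ?C" by (rule sigma_finite_fixed)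
  have Ys: "Y \<in> sets M" and Zs: "Z \<in> sets M" using Y Z by (auto simp: inv_sets_def)
  note iL = indicator_L2
  let ?\<eta> = "orth_proj LH (fixed_vectors G LH koop ?C) (enc (indicator Y))"
  have yc: "enc (indicator Y) \<in> carrier LH" using iL[OF Ys] by simp
  have e: "?\<eta> \<in> fixed_vectors G LH koop ?C" by (rule K.fixed_proj_in[OF yc])
  then have ec: "?\<eta> \<in> carrier LH" by (simp add: K.fixed_vectors_iff)
  define h where "h = dec ?\<eta>"
  have h: "h \<in> L2 M" and eh: "?\<eta> = enc h" using ec by (simp_all add: h_def dec_in enc_dec)
  have hm: "(\<lambda>x. Re (h x)) \<in> borel_measurable (FA ?C)"
  proof (rule measurable_fixed)
    show "(\<lambda>x. Re (h x)) \<in> borel_measurable M" using L2_measurable[OF h] by measurable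
    fix g assume "g \<in> pointwise_stabilizer G ?C"
    then have "AE x in M. h (rep_inv g x) = h x" using e fixed_enc_iff[OF h] by (simp add: eh)
    then show "AE x in M. Re (h (rep_inv g x)) = Re (h x)" by eventually_elim simp
  qed
  have hi: "integrable M (\<lambda>x. Re (h x))" using L2_integrable[OF h] by simp
  have ip: "Re (ip LH (enc f) (enc (indicator W))) = (\<integral>x. indicator W x * Re (f x) \<partial>M)"
    if "f \<in> L2 M" "W \<in> sets M" for f W
  proof -
    have "integrable M (\<lambda>x. f x * cnj (indicator W x))" using L2_prod_integrable[OF that(1) iL[OF that(2)]] .
    then have "Re (ip LH (enc f) (enc (indicator W))) = (\<integral>x. Re (f x * cnj (indicator W x)) \<partial>M)"
      unfolding ip_enc[OF that(1) iL[OF that(2)]] by (rule integral_Re[symmetric])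
    also have "\<dots> = (\<integral>x. indicator W x * Re (f x) \<partial>M)"
      by (intro Bochner_Integration.integral_cong) (auto simp: indicator_def)
    finally show ?thesis .
  qed
  have "AE x in M. real_cond_exp M (FA ?C) (indicator Y) x = Re (h x)"
  proof (rule C.real_cond_exp_charact)
    fix W assume W: "W \<in> sets (FA ?C)"
    then have Wi: "W \<in> inv_sets ?C" and Ws: "W \<in> sets M" by (auto simp: sets_fixed inv_sets_def)
    have wc: "enc (indicator W) \<in> carrier LH" using iL[OF Ws] by simp
    have "ip LH (enc (indicator Y) \<ominus>\<^bsub>LH\<^esub> ?\<eta>) (enc (indicator W)) = 0"
      by (rule K.fixed_proj_orth[OF yc fixed_indicator[OF Wi]])
    then have "ip LH (enc (indicator Y)) (enc (indicator W)) = ip LH (enc h) (enc (indicator W))"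
      using LH.ip_diff_left[OF yc ec wc] by (simp add: eh)
    then have "(\<integral>x. indicator W x * Re (indicator Y x) \<partial>M) = (\<integral>x. indicator W x * Re (h x) \<partial>M)"
      using ip[OF iL[OF Ys] Ws] ip[OF h Ws] by simp
    moreover have "(\<lambda>x. indicator W x * Re (indicator Y x)) = (\<lambda>x. indicator W x * indicator Y x)"
      by (auto simp: indicator_def fun_eq_iff)
    ultimately show "(\<integral>x\<in>W. indicator Y x \<partial>M) = (\<integral>x\<in>W. Re (h x) \<partial>M)"
      by (simp add: set_lebesgue_integral_def)
  qed (use hi hm Ys in \<open>auto intro!: integrable_real_indicator simp: less_top[symmetric]\<close>)
  then have "(\<integral>x. indicator Z x * real_cond_exp M (FA ?C) (indicator Y) x \<partial>M) = (\<integral>x. indicator Z x * Re (h x) \<partial>M)"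
    using Zs L2_measurable[OF h] by (intro integral_cong_AE) auto
  also have "\<dots> = Re (ip LH ?\<eta> (enc (indicator Z)))" using ip[OF h Zs] by (simp add: eh)
  also have "\<dots> = Re (ip LH (enc (indicator Y)) (enc (indicator Z)))"
    using K.dissociated_rep_ip[OF dis A B fixed_indicator[OF Z] fixed_indicator[OF Y]] by simp
  also have "\<dots> = (\<integral>x. indicator Z x * Re (indicator Y x) \<partial>M)" using ip[OF iL[OF Ys] Zs] .
  also have "\<dots> = (\<integral>x. indicator (Y \<inter> Z) x \<partial>M)"
    by (intro Bochner_Integration.integral_cong) (auto simp: indicator_def)
  also have "\<dots> = measure M (Y \<inter> Z)"
    using Ys Zs by (subst Bochner_Integration.integral_indicator) (auto simp: Int_absorb2 sets.sets_into_space)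
  finally show ?thesis by simp
qed

text \<open>For \<open>Z\<close> in \<open>F\<^sub>A\<close> the previous lemma, with the roles of \<open>A\<close> and \<open>B\<close> exchanged, identifies
  \<open>E[1\<^sub>Z | F\<^sub>B]\<close> with \<open>E[1\<^sub>Z | F\<^sub>C]\<close>. Since \<open>f\<close> is \<open>F\<^sub>B\<close>-measurable, its integral over \<open>Z\<close> only sees
  \<open>E[1\<^sub>Z | F\<^sub>B]\<close>, so it may be computed with \<open>E[1\<^sub>Z | F\<^sub>C]\<close> and hence with \<open>E[f | F\<^sub>C]\<close>.\<close>

lemma dissociated_action_of_rep:
  assumes dis: "dissociated_rep \<Omega> G LH koop"
  shows "dissociated_action \<Omega> G M \<alpha>"
  unfolding dissociated_action_def
proof (intro allI impI)
  fix A B and f :: "'x \<Rightarrow> real"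
  assume A: "finite A" "A \<subseteq> \<Omega>" and B: "finite B" "B \<subseteq> \<Omega>"
    and fB: "f \<in> borel_measurable (FA B)" and f2: "integrable M (\<lambda>x. (f x)\<^sup>2)"
  let ?C = "A \<inter> B"
  interpret A: sigma_finite_subalgebra M "FA A" by (rule sigma_finite_fixed)
  interpret B: sigma_finite_subalgebra M "FA B" by (rule sigma_finite_fixed)
  interpret C: sigma_finite_subalgebra M "FA ?C" by (rule sigma_finite_fixed)
  have CA: "Conditional_Expectation.subalgebra (FA A) (FA ?C)" and CB: "Conditional_Expectation.subalgebra (FA B) (FA ?C)"
    by (auto intro!: fixed_mono)
  have fM [measurable]: "f \<in> borel_measurable M" using measurable_from_subalg[OF subalgebra_fixed fB] .
  have fi: "integrable M f" using square_integrable_imp_integrable[OF fM f2] .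
  have "AE x in M. real_cond_exp M (FA A) f x = real_cond_exp M (FA ?C) f x"
  proof (rule A.real_cond_exp_charact)
    fix Z assume "Z \<in> sets (FA A)"
    then have Z: "Z \<in> inv_sets A" and Zs [measurable]: "Z \<in> sets M" by (auto simp: sets_fixed inv_sets_def)
    let ?z = "indicator Z :: 'x \<Rightarrow> real"
    let ?zC = "real_cond_exp M (FA ?C) ?z"
    have zi: "integrable M ?z" using Zs by (intro integrable_real_indicator) (auto simp: less_top[symmetric])
    have zCi: "integrable M ?zC" using C.real_cond_exp_int(1)[OF zi] .
    have zB: "AE x in M. real_cond_exp M (FA B) ?z x = ?zC x"
    proof (rule B.real_cond_exp_charact)
      fix Y assume "Y \<in> sets (FA B)"
      then have Y: "Y \<in> inv_sets B" and Ys: "Y \<in> sets M" by (auto simp: sets_fixed inv_sets_def)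
      have "(\<integral>x\<in>Y. ?z x \<partial>M) = (\<integral>x. indicator (Z \<inter> Y) x \<partial>M)"
        unfolding set_lebesgue_integral_def by (intro Bochner_Integration.integral_cong) (auto simp: indicator_def)
      also have "\<dots> = measure M (Z \<inter> Y)"
        using Ys Zs by (subst Bochner_Integration.integral_indicator) (auto simp: Int_absorb2 sets.sets_into_space)
      also have "\<dots> = (\<integral>x. indicator Y x * real_cond_exp M (FA (B \<inter> A)) ?z x \<partial>M)"
        by (rule indicator_cond_exp[OF dis B A Z Y])
      finally show "(\<integral>x\<in>Y. ?z x \<partial>M) = (\<integral>x\<in>Y. ?zC x \<partial>M)"
        by (simp add: set_lebesgue_integral_def Int_commute)
    qed (use zi zCi measurable_from_subalg[OF CB borel_measurable_cond_exp] in auto)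
    have fz: "integrable M (\<lambda>x. f x * ?z x)" using fi by (simp add: integrable_real_mult_indicator)
    have zf: "integrable M (\<lambda>x. ?zC x * f x)"
    proof -
      have "integrable M (\<lambda>x. f x * real_cond_exp M (FA B) ?z x)"
        using B.real_cond_exp_intg(1)[OF fz fB] by simp
      moreover have "AE x in M. f x * real_cond_exp M (FA B) ?z x = ?zC x * f x"
        using zB by eventually_elim simp
      ultimately show ?thesis by (subst integrable_cong_AE[symmetric]) auto
    qed
    have fCi: "integrable M (real_cond_exp M (FA ?C) f)" using C.real_cond_exp_int(1)[OF fi] .
    have "(\<integral>x\<in>Z. f x \<partial>M) = (\<integral>x. f x * ?z x \<partial>M)"
      unfolding set_lebesgue_integral_def by (simp add: mult.commute)
    also have "\<dots> = (\<integral>x. f x * real_cond_exp M (FA B) ?z x \<partial>M)"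
      using B.real_cond_exp_intg(2)[OF fz fB] by simp
    also have "\<dots> = (\<integral>x. ?zC x * f x \<partial>M)"
      using zB by (intro integral_cong_AE) (auto intro!: borel_measurable_cond_exp2)
    also have "\<dots> = (\<integral>x. ?zC x * real_cond_exp M (FA ?C) f x \<partial>M)"
      using C.real_cond_exp_intg(2)[OF zf] by simp
    also have "\<dots> = (\<integral>x. real_cond_exp M (FA ?C) f x * ?zC x \<partial>M)" by (simp add: mult.commute)
    also have "\<dots> = (\<integral>x. real_cond_exp M (FA ?C) f x * ?z x \<partial>M)"
      using fCi by (intro C.real_cond_exp_intg(2)) (auto simp: integrable_real_mult_indicator)
    also have "\<dots> = (\<integral>x\<in>Z. real_cond_exp M (FA ?C) f x \<partial>M)"
      unfolding set_lebesgue_integral_def by (simp add: mult.commute)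
    finally show "(\<integral>x\<in>Z. f x \<partial>M) = (\<integral>x\<in>Z. real_cond_exp M (FA ?C) f x \<partial>M)" .
  qed (use fi C.real_cond_exp_int(1)[OF fi] measurable_from_subalg[OF CA borel_measurable_cond_exp] in auto)
  then show "AE x in M. real_cond_exp M (FA A) f x = real_cond_exp M (FA ?C) f x" .
qed

end

section \<open>Gaussian laws with prescribed covariance\<close>

lemma borel_measurable_cis [measurable]: "cis \<in> borel_measurable borel"
  by (intro borel_measurable_continuous_onI continuous_intros)

context prob_space
begin

lemma weighted_law:
  fixes u S :: "'a \<Rightarrow> real"
  assumes [measurable]: "u \<in> borel_measurable M" "S \<in> borel_measurable M"
    and u: "\<forall>x\<in>space M. 0 \<le> u x" "integrable M u" and m: "expectation u > 0"
  defines "D \<equiv> distr (density M (\<lambda>x. ennreal (u x / expectation u))) borel S"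
  shows "real_distribution D"
    and "Characteristic_Functions.char D s = (\<integral>x. complex_of_real (u x) * cis (s * S x) \<partial>M) / complex_of_real (expectation u)"
    and "A \<in> sets borel \<Longrightarrow> measure D A = (\<integral>x. u x * indicator A (S x) \<partial>M) / expectation u"
proof -
  let ?m = "expectation u"
  let ?N = "density M (\<lambda>x. ennreal (u x / ?m))"
  have nn: "AE x in M. 0 \<le> u x / ?m" using u(1) m by (auto intro!: AE_I2)
  have "emeasure ?N (space ?N) = (\<integral>\<^sup>+x. ennreal (u x / ?m) \<partial>M)"
    by (simp add: emeasure_density cong: nn_integral_cong)
  also have "\<dots> = ennreal (\<integral>x. u x / ?m \<partial>M)"
    using u(2) nn by (intro nn_integral_eq_integral) auto
  also have "\<dots> = 1" using m by simp
  finally interpret N: prob_space ?N by (rule prob_spaceI)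
  have "prob_space D" unfolding D_def by (intro N.prob_space_distr) simp
  then show "real_distribution D"
    by (auto simp: real_distribution_def real_distribution_axioms_def D_def)
  have "Characteristic_Functions.char D s = (\<integral>x. cis (s * S x) \<partial>?N)"
    unfolding char_def D_def by (subst integral_distr) (auto simp: cis_conv_exp)
  also have "\<dots> = (\<integral>x. (u x / ?m) *\<^sub>R cis (s * S x) \<partial>M)"
    using nn by (intro integral_density) auto
  also have "\<dots> = (\<integral>x. complex_of_real (u x) * cis (s * S x) / complex_of_real ?m \<partial>M)"
    by (simp add: scaleR_conv_of_real)
  finally show "Characteristic_Functions.char D s = (\<integral>x. complex_of_real (u x) * cis (s * S x) \<partial>M) / complex_of_real (expectation u)"
    by simp
  { assume A [measurable]: "A \<in> sets borel"
    interpret D: prob_space D by fact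
    have "measure D A = (\<integral>x. indicator A x \<partial>D)" by (simp add: D_def)
    also have "\<dots> = (\<integral>x. indicator A (S x) \<partial>?N)"
      unfolding D_def by (subst integral_distr) auto
    also have "\<dots> = (\<integral>x. (u x / ?m) *\<^sub>R indicator A (S x) \<partial>M)"
      using nn by (intro integral_density) auto
    also have "\<dots> = (\<integral>x. u x * indicator A (S x) / ?m \<partial>M)" by simp
    finally show "measure D A = (\<integral>x. u x * indicator A (S x) \<partial>M) / expectation u" by simp }
qed

text \<open>After normalization the weights are densities, and the hypothesis says that \<open>S\<close> and \<open>T\<close> have
  the same characteristic function under the two reweighted measures. Taking \<open>s = 0\<close> shows that
  the normalizing constants agree.\<close>

lemma weighted_law_unique:
  fixes u v S T :: "'a \<Rightarrow> real"
  assumes [measurable]: "u \<in> borel_measurable M" "v \<in> borel_measurable M"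
      "S \<in> borel_measurable M" "T \<in> borel_measurable M" and A [measurable]: "A \<in> sets borel"
    and u: "\<And>x. x \<in> space M \<Longrightarrow> 0 \<le> u x" "integrable M u"
    and v: "\<And>x. x \<in> space M \<Longrightarrow> 0 \<le> v x" "integrable M v"
    and eq: "\<And>s. (\<integral>x. complex_of_real (u x) * cis (s * S x) \<partial>M) = (\<integral>x. complex_of_real (v x) * cis (s * T x) \<partial>M)"
  shows "(\<integral>x. u x * indicator A (S x) \<partial>M) = (\<integral>x. v x * indicator A (T x) \<partial>M)"
proof -
  have uv: "expectation u = expectation v" using eq[of 0] by simp
  have zero: "(\<integral>x. w x * indicator A (Z x) \<partial>M) = 0"
    if "w \<in> borel_measurable M" "Z \<in> borel_measurable M" "\<And>x. x \<in> space M \<Longrightarrow> 0 \<le> w x"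
      "integrable M w" "expectation w = 0" for w Z :: "'a \<Rightarrow> real"
  proof -
    have "AE x in M. w x = 0"
      using integral_nonneg_eq_0_iff_AE[of M w] that by auto
    then have "(\<integral>x. w x * indicator A (Z x) \<partial>M) = (\<integral>x. 0 \<partial>M)"
      using that(1,2) by (intro integral_cong_AE) auto
    then show ?thesis by simp
  qed
  show ?thesis
  proof (cases "expectation u = 0")
    case True
    then show ?thesis using zero[of u S] zero[of v T] u v uv by simp
  next
    case False
    moreover have "expectation u \<ge> 0" using u(1) by (intro integral_nonneg_AE) auto
    ultimately have m: "expectation u > 0" "expectation v > 0" using uv by auto
    have u0: "\<forall>x\<in>space M. 0 \<le> u x" and v0: "\<forall>x\<in>space M. 0 \<le> v x" using u(1) v(1) by auto
    note U = weighted_law[OF assms(1,3) u0 u(2) m(1)] and V = weighted_law[OF assms(2,4) v0 v(2) m(2)]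
    have "distr (density M (\<lambda>x. ennreal (u x / expectation u))) borel S
        = distr (density M (\<lambda>x. ennreal (v x / expectation v))) borel T"
    proof (rule Levy_uniqueness[OF U(1) V(1)])
      show "Characteristic_Functions.char (distr (density M (\<lambda>x. ennreal (u x / expectation u))) borel S)
        = Characteristic_Functions.char (distr (density M (\<lambda>x. ennreal (v x / expectation v))) borel T)"
      proof (rule ext)
        fix s
        show "Characteristic_Functions.char (distr (density M (\<lambda>x. ennreal (u x / expectation u))) borel S) s
          = Characteristic_Functions.char (distr (density M (\<lambda>x. ennreal (v x / expectation v))) borel T) s"
          using U(2)[of s] V(2)[of s] eq[of s] uv by (simp only:)
      qed
    qed
    then show ?thesis using U(3)[OF A] V(3)[OF A] uv m by simp
  qed
qed

text \<open>The multivariate uniqueness theorem for characteristic functions, derived from the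
  one-dimensional one. The coordinates in \<open>K\<close> are treated one after the other: the claim carries
  indicators for the coordinates already treated and a character in all coordinates. To treat
  coordinate \<open>k\<close>, split the character into its cosine and sine and use these, shifted to be
  nonnegative, as weights.\<close>

lemma joint_law_unique:
  fixes S T :: "nat \<Rightarrow> 'a \<Rightarrow> real" and A :: "nat \<Rightarrow> real set"
  assumes [measurable]: "\<And>n. S n \<in> borel_measurable M" "\<And>n. T n \<in> borel_measurable M"
    and ch: "\<And>t N. (\<integral>x. cis (\<Sum>j<N. t j * S j x) \<partial>M) = (\<integral>x. cis (\<Sum>j<N. t j * T j x) \<partial>M)"
    and K: "finite K" and A: "\<And>k. k \<in> K \<Longrightarrow> A k \<in> sets borel"
  shows "prob {x \<in> space M. \<forall>k\<in>K. S k x \<in> A k} = prob {x \<in> space M. \<forall>k\<in>K. T k x \<in> A k}"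
proof -
  define W where "W Z K x = (\<Prod>k\<in>K. indicator (A k) (Z k x) :: real)"
    for Z :: "nat \<Rightarrow> 'a \<Rightarrow> real" and K x
  have W01: "0 \<le> W Z K x" "W Z K x \<le> 1" for Z K x
    unfolding W_def by (auto intro!: prod_nonneg prod_le_1 simp: indicator_def)
  have claim: "\<And>t N. (\<integral>x. complex_of_real (W S K x) * cis (\<Sum>j<N. t j * S j x) \<partial>M)
      = (\<integral>x. complex_of_real (W T K x) * cis (\<Sum>j<N. t j * T j x) \<partial>M)"
    using K A
  proof (induction K)
    case empty
    then show ?case using ch by (simp add: W_def)
  next
    case (insert k K)
    have [measurable]: "A j \<in> sets borel" if "j \<in> K" for j using insert.prems that by blast
    have Ak [measurable]: "A k \<in> sets borel" using insert.prems by blast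
    have Wm [measurable]: "W S K \<in> borel_measurable M" "W T K \<in> borel_measurable M"
      unfolding W_def by measurable
    have IH: "(\<integral>x. complex_of_real (W S K x) * cis (\<Sum>j<N. t j * S j x) \<partial>M)
      = (\<integral>x. complex_of_real (W T K x) * cis (\<Sum>j<N. t j * T j x) \<partial>M)" for t N
      using insert by blast
    fix t :: "nat \<Rightarrow> real" and N :: nat
    define C where "C Z x = (\<Sum>j<N. t j * Z j x)" for Z :: "nat \<Rightarrow> 'a \<Rightarrow> real" and x
    have [measurable]: "C S \<in> borel_measurable M" "C T \<in> borel_measurable M"
      unfolding C_def by measurable
    define J where "J Z r s = (\<integral>x. complex_of_real (W Z K x) * cis (r * C Z x + s * Z k x) \<partial>M)"
      for Z :: "nat \<Rightarrow> 'a \<Rightarrow> real" and r s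
    \<comment> \<open>The phase \<open>r C + s Z\<^sub>k\<close> is again a linear combination of coordinates.\<close>
    have J: "J S r s = J T r s" for r s
    proof -
      define t' where "t' j = (if j < N then r * t j else 0) + (if j = k then s else 0)" for j
      have "(\<Sum>j<max N (Suc k). t' j * Z j x) = r * C Z x + s * Z k x" for Z :: "nat \<Rightarrow> 'a \<Rightarrow> real" and x
      proof -
        have "(\<Sum>j<max N (Suc k). t' j * Z j x)
            = (\<Sum>j<max N (Suc k). if j < N then r * (t j * Z j x) else 0)
              + (\<Sum>j<max N (Suc k). if j = k then s * Z k x else 0)"
          unfolding t'_def sum.distrib[symmetric] by (intro sum.cong) (auto simp: distrib_right)
        also have "(\<Sum>j<max N (Suc k). if j < N then r * (t j * Z j x) else 0) = (\<Sum>j<N. r * (t j * Z j x))"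
          by (intro sum.mono_neutral_cong_right) auto
        also have "(\<Sum>j<max N (Suc k). if j = k then s * Z k x else 0) = s * Z k x"
          by (simp add: less_max_iff_disj)
        finally show ?thesis by (simp add: C_def sum_distrib_left)
      qed
      then show ?thesis using IH[of t' "max N (Suc k)"] by (simp add: J_def)
    qed
    have bnd: "integrable M f" if "f \<in> borel_measurable M" "\<And>x. cmod (f x) \<le> 2" for f :: "'a \<Rightarrow> complex"
      using that by (intro integrable_const_bound[of _ 2]) auto
    have bndr: "integrable M f" if "f \<in> borel_measurable M" "\<And>x. \<bar>f x\<bar> \<le> 2" for f :: "'a \<Rightarrow> real"
      using that by (intro integrable_const_bound[of _ 2]) auto
    have Wle: "W Z K x * y \<le> 1" if "0 \<le> y" "y \<le> 1" for Z x y
      using W01[of Z K x] that mult_le_one by blast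
    have Fi: "integrable M (\<lambda>x. complex_of_real (W Z K x * p x) * cis (q x))"
      if "Z = S \<or> Z = T" "p \<in> borel_measurable M" "q \<in> borel_measurable M" "\<And>x. \<bar>p x\<bar> \<le> 1" for Z p q
    proof (rule bnd)
      show "cmod (complex_of_real (W Z K x * p x) * cis (q x)) \<le> 2" for x
        using Wle[of "\<bar>p x\<bar>" Z x] that(4)[of x] W01[of Z K x] by (simp add: norm_mult abs_mult)
    qed (use that in auto)
    have Ri: "integrable M (\<lambda>x. W Z K x * p x)"
      if "Z = S \<or> Z = T" "p \<in> borel_measurable M" "\<And>x. \<bar>p x\<bar> \<le> 1" for Z p
    proof (rule bndr)
      show "\<bar>W Z K x * p x\<bar> \<le> 2" for x
        using Wle[of "\<bar>p x\<bar>" Z x] that(3)[of x] W01[of Z K x] by (simp add: abs_mult)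
    qed (use that in auto)
    have W1: "integrable M (W Z K)" if "Z = S \<or> Z = T" for Z
      using Ri[OF that, of "\<lambda>_. 1"] by simp
    have Ji: "integrable M (\<lambda>x. complex_of_real (W Z K x) * cis (r * C Z x + s * Z k x))"
      if "Z = S \<or> Z = T" for Z r s
      using Fi[OF that, of "\<lambda>_. 1"] that by auto
    have I0: "(\<integral>x. W S K x * indicator (A k) (S k x) \<partial>M) = (\<integral>x. W T K x * indicator (A k) (T k x) \<partial>M)"
    proof (rule weighted_law_unique)
      fix s
      show "(\<integral>x. complex_of_real (W S K x) * cis (s * S k x) \<partial>M) = (\<integral>x. complex_of_real (W T K x) * cis (s * T k x) \<partial>M)"
        using J[of 0 s] by (simp add: J_def)
    qed (use W01 W1 in auto)
    (* The phases 0 and pi/2 give cosine and sine. Adding the constant 1 makes the weight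
       nonnegative, so that it is a density. *)
    have trig: "(\<integral>x. W S K x * cos (C S x - \<theta>) * indicator (A k) (S k x) \<partial>M)
        = (\<integral>x. W T K x * cos (C T x - \<theta>) * indicator (A k) (T k x) \<partial>M)" for \<theta>
    proof -
      have pm: "(\<lambda>x. cos (C Z x - \<theta>)) \<in> borel_measurable M" if "Z = S \<or> Z = T" for Z using that by auto
      have c0: "0 \<le> 1 + cos c" for c :: real using cos_ge_minus_one[of c] by linarith
      have Wc: "integrable M (\<lambda>x. W Z K x * (1 + cos (C Z x - \<theta>)))" if "Z = S \<or> Z = T" for Z
        using Bochner_Integration.integrable_add[OF W1[OF that] Ri[OF that pm[OF that] abs_cos_le_one]]
        by (simp add: distrib_left)
      have "(\<integral>x. (W S K x * (1 + cos (C S x - \<theta>))) * indicator (A k) (S k x) \<partial>M)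
        = (\<integral>x. (W T K x * (1 + cos (C T x - \<theta>))) * indicator (A k) (T k x) \<partial>M)"
      proof (rule weighted_law_unique)
        fix s
        have "(\<integral>x. complex_of_real (W Z K x * (1 + cos (C Z x - \<theta>))) * cis (s * Z k x) \<partial>M)
          = J Z 0 s + (cis (- \<theta>) * J Z 1 s + cis \<theta> * J Z (-1) s) / 2" if Z: "Z = S \<or> Z = T" for Z
        proof -
          have e: "complex_of_real (w * (1 + cos (c - \<theta>))) * cis y = complex_of_real w * cis (0 * c + y)
            + (cis (- \<theta>) * (complex_of_real w * cis (1 * c + y)) + cis \<theta> * (complex_of_real w * cis (-1 * c + y))) / 2"
            for w c y :: real
          proof -
            have "complex_of_real (cos (c - \<theta>)) = (cis (- \<theta>) * cis c + cis \<theta> * cis (- c)) / 2"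
              by (simp add: cis_mult complex_eq_iff cos_diff sin_diff)
            moreover have "cis (y - c) = cis y * cis (- c)" by (simp add: cis_mult)
            ultimately show ?thesis by (simp add: cis_mult[symmetric] ring_distribs add_divide_distrib mult_ac)
          qed
          show ?thesis
            unfolding e J_def using Ji[OF Z, of 0 s] Ji[OF Z, of 1 s] Ji[OF Z, of "-1" s] by simp
        qed
        then show "(\<integral>x. complex_of_real (W S K x * (1 + cos (C S x - \<theta>))) * cis (s * S k x) \<partial>M)
          = (\<integral>x. complex_of_real (W T K x * (1 + cos (C T x - \<theta>))) * cis (s * T k x) \<partial>M)"
          by (simp only: J simp_thms)
      qed (use W01 Wc c0 in auto)
      moreover have "(\<integral>x. (W Z K x * (1 + cos (C Z x - \<theta>))) * indicator (A k) (Z k x) \<partial>M)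
          = (\<integral>x. W Z K x * indicator (A k) (Z k x) \<partial>M) + (\<integral>x. W Z K x * cos (C Z x - \<theta>) * indicator (A k) (Z k x) \<partial>M)"
        if Z: "Z = S \<or> Z = T" for Z
      proof -
        have m: "(\<lambda>x. indicator (A k) (Z k x) :: real) \<in> borel_measurable M" using Z by auto
        have "integrable M (\<lambda>x. W Z K x * indicator (A k) (Z k x))"
          by (rule Ri[OF Z m]) (simp add: indicator_def)
        moreover have "integrable M (\<lambda>x. W Z K x * (cos (C Z x - \<theta>) * indicator (A k) (Z k x)))"
          using pm[OF Z] m by (intro Ri[OF Z]) (auto simp: indicator_def)
        ultimately show ?thesis
          by (subst Bochner_Integration.integral_add[symmetric]) (auto simp: algebra_simps)
      qed
      ultimately show ?thesis using I0 by simp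
    qed
    have Ic: "(\<integral>x. W S K x * cos (C S x) * indicator (A k) (S k x) \<partial>M)
        = (\<integral>x. W T K x * cos (C T x) * indicator (A k) (T k x) \<partial>M)"
      using trig[of 0] by simp
    have Is: "(\<integral>x. W S K x * sin (C S x) * indicator (A k) (S k x) \<partial>M)
        = (\<integral>x. W T K x * sin (C T x) * indicator (A k) (T k x) \<partial>M)"
      using trig[of "pi / 2"] by (simp add: cos_diff)
    have "(\<integral>x. complex_of_real (W Z (insert k K) x) * cis (\<Sum>j<N. t j * Z j x) \<partial>M)
        = complex_of_real (\<integral>x. W Z K x * cos (C Z x) * indicator (A k) (Z k x) \<partial>M)
          + \<i> * complex_of_real (\<integral>x. W Z K x * sin (C Z x) * indicator (A k) (Z k x) \<partial>M)"
      if Z: "Z = S \<or> Z = T" for Z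
    proof -
      have e: "complex_of_real (W Z (insert k K) x) * cis (\<Sum>j<N. t j * Z j x)
        = complex_of_real (W Z K x * (cos (C Z x) * indicator (A k) (Z k x)))
          + \<i> * complex_of_real (W Z K x * (sin (C Z x) * indicator (A k) (Z k x)))" for x
        using insert.hyps by (simp add: W_def C_def complex_eq_iff)
      have m: "(\<lambda>x. p (C Z x) * indicator (A k) (Z k x) :: real) \<in> borel_measurable M"
        if "p \<in> borel_measurable borel" for p using Z that by auto
      have "integrable M (\<lambda>x. W Z K x * (cos (C Z x) * indicator (A k) (Z k x)))"
        "integrable M (\<lambda>x. W Z K x * (sin (C Z x) * indicator (A k) (Z k x)))"
        using m[of cos] m[of sin] by (auto intro!: Ri[OF Z] simp: indicator_def)
      moreover have "(\<integral>x. complex_of_real (p x) + \<i> * complex_of_real (q x) \<partial>M)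
          = complex_of_real (\<integral>x. p x \<partial>M) + \<i> * complex_of_real (\<integral>x. q x \<partial>M)"
        if "integrable M p" "integrable M q" for p q :: "'a \<Rightarrow> real"
        using that by simp
      ultimately show ?thesis
        unfolding e by (simp only: mult.assoc)
    qed
    then show "(\<integral>x. complex_of_real (W S (insert k K) x) * cis (\<Sum>j<N. t j * S j x) \<partial>M)
      = (\<integral>x. complex_of_real (W T (insert k K) x) * cis (\<Sum>j<N. t j * T j x) \<partial>M)"
      by (simp add: Ic Is)
  qed
  have [measurable]: "A j \<in> sets borel" if "j \<in> K" for j using A that by blast
  have "prob {x \<in> space M. \<forall>k\<in>K. Z k x \<in> A k} = Re (\<integral>x. complex_of_real (W Z K x) * cis (\<Sum>j<0. 0 * Z j x) \<partial>M)"
    if "Z = S \<or> Z = T" for Z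
  proof -
    have s: "{x \<in> space M. \<forall>k\<in>K. Z k x \<in> A k} \<in> sets M" using that K by auto
    have "(\<integral>x. complex_of_real (W Z K x) * cis (\<Sum>j<0. 0 * Z j x) \<partial>M) = complex_of_real (\<integral>x. W Z K x \<partial>M)" by simp
    also have "(\<integral>x. W Z K x \<partial>M) = (\<integral>x. indicator {x \<in> space M. \<forall>k\<in>K. Z k x \<in> A k} x \<partial>M)"
      using K by (intro Bochner_Integration.integral_cong) (auto simp: W_def indicator_def prod_zero)
    also have "\<dots> = prob {x \<in> space M. \<forall>k\<in>K. Z k x \<in> A k}" using s by simp
    finally show ?thesis by simp
  qed
  then show ?thesis using claim[of "\<lambda>_. 0" 0] by simp
qed

end

abbreviation "seq_borel \<equiv> PiM (UNIV :: nat set) (\<lambda>_. borel :: real measure)"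

abbreviation "gauss_noise \<equiv> PiM (UNIV :: nat set) (\<lambda>_. std_normal_distribution)"

lemma prob_std_normal: "prob_space std_normal_distribution"
  using real_dist_normal_dist by (simp add: real_distribution_def)

lemma prob_gauss_noise: "prob_space gauss_noise"
  by (intro prob_space_PiM prob_std_normal)

lemma gauss_noise_coord [measurable]: "(\<lambda>z. z k) \<in> borel_measurable gauss_noise"
  using measurable_component_singleton[of k UNIV "\<lambda>_. std_normal_distribution"] by simp

lemma distr_gauss_noise: "distr gauss_noise borel (\<lambda>z. z k) = std_normal_distribution"
proof -
  have "distr gauss_noise borel (\<lambda>z. z k) = distr gauss_noise std_normal_distribution (\<lambda>z. z k)"
    by (intro distr_cong) auto
  then show ?thesis
    using distr_PiM_component[of UNIV "\<lambda>_. std_normal_distribution" k] prob_std_normal by simp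
qed

lemma indep_gauss_noise: "prob_space.indep_vars gauss_noise (\<lambda>_. borel) (\<lambda>k z. z k) J"
proof -
  interpret prob_space gauss_noise by (rule prob_gauss_noise)
  have "indep_vars (\<lambda>_. borel) (\<lambda>k z. z k) UNIV"
  proof (subst indep_vars_iff_distr_eq_PiM)
    have "distr gauss_noise seq_borel (\<lambda>z. \<lambda>i\<in>UNIV. z i) = distr gauss_noise gauss_noise (\<lambda>z. z)"
      by (intro distr_cong) (auto intro!: sets_PiM_cong)
    then show "distr gauss_noise seq_borel (\<lambda>z. \<lambda>i\<in>UNIV. z i) = PiM UNIV (\<lambda>i. distr gauss_noise borel (\<lambda>z. z i))"
      by (simp add: distr_gauss_noise)
  qed auto
  then show ?thesis by (rule indep_vars_subset) simp
qed

lemma gauss_noise_moments: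
  "integrable gauss_noise (\<lambda>z. z k * z l)"
  "(\<integral>z. z k * z l \<partial>gauss_noise) = (if k = l then 1 else 0)"
proof -
  interpret prob_space gauss_noise by (rule prob_gauss_noise)
  have m: "integrable gauss_noise (\<lambda>z. (z k) ^ n)" "(\<integral>z. (z k) ^ n \<partial>gauss_noise) = (\<integral>y. y ^ n \<partial>std_normal_distribution)" for k n
    using integrable_distr[of "\<lambda>z. z k" gauss_noise borel "\<lambda>y. y ^ n"] integral_distr[of "\<lambda>z. z k" gauss_noise borel "\<lambda>y. y ^ n"]
      integrable_std_normal_distribution_moment[of n] by (auto simp: distr_gauss_noise)
  have m1: "(\<integral>z. z k \<partial>gauss_noise) = 0" "integrable gauss_noise (\<lambda>z. z k)" for k
    using m(2)[of k 1] m(1)[of k 1] integral_std_normal_distribution_moment_odd[of 1] by simp_all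
  have "integrable gauss_noise (\<lambda>z. z k * z l) \<and> (\<integral>z. z k * z l \<partial>gauss_noise) = (if k = l then 1 else 0)"
  proof (cases "k = l")
    case True
    then show ?thesis
      using m[of k 2] std_normal_distribution_even_moments(1)[of 1] by (simp add: power2_eq_square numeral_2_eq_2)
  next
    case False
    have "(\<integral>z. (\<Prod>i\<in>{k, l}. z i) \<partial>gauss_noise) = (\<Prod>i\<in>{k, l}. \<integral>z. z i \<partial>gauss_noise)"
      by (rule indep_vars_lebesgue_integral) (auto intro: indep_gauss_noise m1)
    moreover have "integrable gauss_noise (\<lambda>z. \<Prod>i\<in>{k, l}. z i)"
      by (rule indep_vars_integrable) (auto intro: indep_gauss_noise m1)
    ultimately have "(\<integral>z. (\<Prod>i\<in>{k, l}. z i) \<partial>gauss_noise) = (\<Prod>i\<in>{k, l}. \<integral>z. z i \<partial>gauss_noise)"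
      "integrable gauss_noise (\<lambda>z. \<Prod>i\<in>{k, l}. z i)" by auto
    then show ?thesis using False m1 by simp
  qed
  then show "integrable gauss_noise (\<lambda>z. z k * z l)"
    "(\<integral>z. z k * z l \<partial>gauss_noise) = (if k = l then 1 else 0)" by auto
qed

lemma gauss_noise_char:
  "(\<integral>z. cis (\<Sum>k<n. b k * z k) \<partial>gauss_noise) = complex_of_real (exp (- (\<Sum>k<n. (b k)\<^sup>2) / 2))"
proof -
  interpret prob_space gauss_noise by (rule prob_gauss_noise)
  have ind: "indep_vars (\<lambda>_. borel) (\<lambda>k z. b k * z k) {..<n}"
    by (rule indep_vars_compose2[OF indep_gauss_noise]) simp
  have "(\<integral>z. cis (\<Sum>k<n. b k * z k) \<partial>gauss_noise)
      = Characteristic_Functions.char (distr gauss_noise borel (\<lambda>z. \<Sum>k<n. b k * z k)) 1"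
    unfolding char_def by (subst integral_distr) (auto simp: cis_conv_exp)
  also have "\<dots> = (\<Prod>k<n. Characteristic_Functions.char (distr gauss_noise borel (\<lambda>z. b k * z k)) 1)"
    by (rule char_distr_sum[OF ind])
  also have "\<dots> = (\<Prod>k<n. complex_of_real (exp (- ((b k)\<^sup>2) / 2)))"
  proof (rule prod.cong[OF refl])
    fix k
    have "Characteristic_Functions.char (distr gauss_noise borel (\<lambda>z. b k * z k)) 1
        = Characteristic_Functions.char (distr gauss_noise borel (\<lambda>z. z k)) (b k)"
      unfolding char_def by (subst (1 2) integral_distr) auto
    also have "\<dots> = complex_of_real (exp (- ((b k)\<^sup>2) / 2))"
      by (simp add: distr_gauss_noise char_std_normal_distribution)
    finally show "Characteristic_Functions.char (distr gauss_noise borel (\<lambda>z. b k * z k)) 1 = complex_of_real (exp (- ((b k)\<^sup>2) / 2))" .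
  qed
  also have "\<dots> = complex_of_real (exp (- (\<Sum>k<n. (b k)\<^sup>2) / 2))"
    by (simp add: exp_sum[symmetric] sum_negf sum_divide_distrib flip: of_real_prod)
  finally show ?thesis .
qed

text \<open>The \<open>i\<close>-th coordinate is the combination of independent standard normal variables with
  coefficients \<open>a i k\<close>. Its characteristic functions involve \<open>a\<close> only through \<open>R\<close>, so a relabelling
  that preserves \<open>R\<close> preserves the law.\<close>

lemma gaussian_law_exists:
  fixes a :: "nat \<Rightarrow> nat \<Rightarrow> real" and R :: "nat \<Rightarrow> nat \<Rightarrow> real"
  assumes tri: "\<forall>i k. i < k \<longrightarrow> a i k = 0"
    and R: "\<And>i j. R i j = (\<Sum>k\<le>i. a i k * a j k)"
  shows "\<exists>L. prob_space L \<and> sets L = sets seq_borel \<and>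
    (\<forall>i j. integrable L (\<lambda>x. x i * x j) \<and> (\<integral>x. x i * x j \<partial>L) = R i j) \<and>
    (\<forall>\<sigma>. (\<forall>i j. R (\<sigma> i) (\<sigma> j) = R i j) \<longrightarrow> distr L L (\<lambda>x n. x (\<sigma> n)) = L)"
proof -
  interpret prob_space gauss_noise by (rule prob_gauss_noise)
  define F where "F z i = (\<Sum>k\<le>i. a i k * z k)" for z :: "nat \<Rightarrow> real" and i
  have Fn: "F z i = (\<Sum>k<n. a i k * z k)" if "i < n" for z i n
    unfolding F_def using that tri by (intro sum.mono_neutral_left) auto
  have Rn: "R i j = (\<Sum>k<n. a i k * a j k)" if "i < n" for i j n
    unfolding R using that tri by (intro sum.mono_neutral_left) auto
  have Fi [measurable]: "(\<lambda>z. F z i) \<in> borel_measurable gauss_noise" for i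
    unfolding F_def by measurable
  have F [measurable]: "F \<in> measurable gauss_noise seq_borel"
    by (rule measurable_PiM_single') (auto simp: space_PiM)
  define L where "L = distr gauss_noise seq_borel F"
  have sL: "sets L = sets seq_borel" by (simp add: L_def)
  interpret L: prob_space L unfolding L_def by (rule prob_space_distr) simp
  have ch: "(\<integral>z. cis (\<Sum>j<N. t j * F z (\<tau> j)) \<partial>gauss_noise)
      = complex_of_real (exp (- (\<Sum>i<N. \<Sum>j<N. t i * t j * R (\<tau> i) (\<tau> j)) / 2))" for t and N :: nat and \<tau>
  proof -
    define n where "n = Suc (\<Sum>j<N. \<tau> j)"
    have n: "\<tau> j < n" if "j < N" for j
    proof -
      have "\<tau> j \<le> (\<Sum>j<N. \<tau> j)" using that by (intro member_le_sum) auto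
      then show ?thesis by (simp add: n_def)
    qed
    define b where "b k = (\<Sum>j<N. t j * a (\<tau> j) k)" for k
    have "(\<Sum>j<N. t j * F z (\<tau> j)) = (\<Sum>k<n. b k * z k)" for z
    proof -
      have "(\<Sum>j<N. t j * F z (\<tau> j)) = (\<Sum>j<N. \<Sum>k<n. t j * a (\<tau> j) k * z k)"
        by (intro sum.cong refl) (simp add: Fn[OF n] sum_distrib_left mult.assoc)
      also have "\<dots> = (\<Sum>k<n. \<Sum>j<N. t j * a (\<tau> j) k * z k)" by (rule sum.swap)
      finally show ?thesis by (simp add: b_def sum_distrib_right)
    qed
    moreover have "(\<Sum>k<n. (b k)\<^sup>2) = (\<Sum>i<N. \<Sum>j<N. t i * t j * R (\<tau> i) (\<tau> j))"
    proof -
      have "(\<Sum>k<n. (b k)\<^sup>2) = (\<Sum>k<n. \<Sum>i<N. \<Sum>j<N. t i * t j * (a (\<tau> i) k * a (\<tau> j) k))"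
        unfolding b_def power2_eq_square sum_product by (intro sum.cong refl) (simp add: algebra_simps)
      also have "\<dots> = (\<Sum>i<N. \<Sum>k<n. \<Sum>j<N. t i * t j * (a (\<tau> i) k * a (\<tau> j) k))" by (rule sum.swap)
      also have "\<dots> = (\<Sum>i<N. \<Sum>j<N. \<Sum>k<n. t i * t j * (a (\<tau> i) k * a (\<tau> j) k))"
        by (intro sum.cong refl sum.swap)
      also have "\<dots> = (\<Sum>i<N. \<Sum>j<N. t i * t j * R (\<tau> i) (\<tau> j))"
        by (intro sum.cong refl) (simp add: Rn[OF n] sum_distrib_left)
      finally show ?thesis .
    qed
    ultimately show ?thesis by (simp add: gauss_noise_char)
  qed
  have inv: "distr L L (\<lambda>x n. x (\<sigma> n)) = L" if s: "\<forall>i j. R (\<sigma> i) (\<sigma> j) = R i j" for \<sigma>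
  proof -
    let ?F = "\<lambda>z n. F z (\<sigma> n)"
    have sm: "(\<lambda>x n. x (\<sigma> n)) \<in> measurable seq_borel seq_borel"
      by (rule measurable_PiM_single') (auto simp: space_PiM)
    have Fs: "?F \<in> measurable gauss_noise seq_borel"
      using measurable_compose[OF F sm] by simp
    have "distr L L (\<lambda>x n. x (\<sigma> n)) = distr (distr gauss_noise seq_borel F) seq_borel (\<lambda>x n. x (\<sigma> n))"
      unfolding L_def by (intro distr_cong) auto
    also have "\<dots> = distr gauss_noise seq_borel ?F"
      by (subst distr_distr[OF sm F]) (simp add: comp_def)
    also have "\<dots> = L"
    proof (rule measure_eqI_PiM_infinite[where I = UNIV and M = "\<lambda>_. borel"])
      show "finite_measure (distr gauss_noise seq_borel ?F)"
        using prob_space_distr[OF Fs] by (simp add: prob_space_def)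
      fix A :: "nat \<Rightarrow> real set" and J assume J: "finite J" and A: "\<And>i. i \<in> J \<Longrightarrow> A i \<in> sets borel"
      have Fe: "emeasure (distr gauss_noise seq_borel \<Phi>) (prod_emb UNIV (\<lambda>_. borel) J (Pi\<^sub>E J A))
          = prob {z \<in> space gauss_noise. \<forall>k\<in>J. \<Phi> z k \<in> A k}" if \<Phi>: "\<Phi> \<in> measurable gauss_noise seq_borel" for \<Phi>
      proof -
        have "prod_emb UNIV (\<lambda>_. borel) J (Pi\<^sub>E J A) \<in> sets seq_borel"
          using J A by (intro sets_PiM_I) auto
        moreover have "\<Phi> -` prod_emb UNIV (\<lambda>_. borel) J (Pi\<^sub>E J A) \<inter> space gauss_noise = {z \<in> space gauss_noise. \<forall>k\<in>J. \<Phi> z k \<in> A k}"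
          by (auto simp: prod_emb_def PiE_iff)
        ultimately show ?thesis using \<Phi> by (simp add: emeasure_distr emeasure_eq_measure)
      qed
      have "prob {z \<in> space gauss_noise. \<forall>k\<in>J. F z (\<sigma> k) \<in> A k} = prob {z \<in> space gauss_noise. \<forall>k\<in>J. F z k \<in> A k}"
      proof (rule joint_law_unique[of "\<lambda>n z. F z (\<sigma> n)" "\<lambda>n z. F z n"])
        show "(\<integral>z. cis (\<Sum>j<N. t j * F z (\<sigma> j)) \<partial>gauss_noise) = (\<integral>z. cis (\<Sum>j<N. t j * F z j) \<partial>gauss_noise)" for t N
          using ch[of t \<sigma> N] ch[of t "\<lambda>j. j" N] s by simp
      qed (use J A in auto)
      then show "emeasure (distr gauss_noise seq_borel ?F) (prod_emb UNIV (\<lambda>_. borel) J (Pi\<^sub>E J A))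
          = emeasure L (prod_emb UNIV (\<lambda>_. borel) J (Pi\<^sub>E J A))"
        unfolding L_def Fe[OF Fs] Fe[OF F] by simp
    qed (simp_all add: L_def)
    finally show ?thesis .
  qed
  have mom: "integrable L (\<lambda>x. x i * x j) \<and> (\<integral>x. x i * x j \<partial>L) = R i j" for i j
  proof -
    define n where "n = Suc (max i j)"
    have FF: "F z i * F z j = (\<Sum>k<n. \<Sum>l<n. a i k * a j l * (z k * z l))" for z
    proof -
      have "i < n" "j < n" by (auto simp: n_def)
      then have "F z i * F z j = (\<Sum>k<n. a i k * z k) * (\<Sum>l<n. a j l * z l)" by (simp only: Fn)
      then show ?thesis unfolding sum_product by (simp add: mult_ac)
    qed
    have i: "integrable gauss_noise (\<lambda>z. F z i * F z j)"
      unfolding FF by (intro Bochner_Integration.integrable_sum integrable_mult_right gauss_noise_moments(1))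
    have "(\<integral>z. F z i * F z j \<partial>gauss_noise) = (\<Sum>k<n. \<Sum>l<n. a i k * a j l * (if k = l then 1 else 0))"
      unfolding FF by (subst Bochner_Integration.integral_sum, intro Bochner_Integration.integrable_sum integrable_mult_right gauss_noise_moments(1),
        subst Bochner_Integration.integral_sum, intro integrable_mult_right gauss_noise_moments(1)) (simp add: gauss_noise_moments(2))
    also have "\<dots> = (\<Sum>k<n. a i k * a j k)" by (intro sum.cong refl) (simp add: if_distrib cong: if_cong)
    also have "\<dots> = R i j" by (rule Rn[symmetric]) (simp add: n_def)
    finally have e: "(\<integral>z. F z i * F z j \<partial>gauss_noise) = R i j" .
    have mm: "(\<lambda>x. x i * x j) \<in> borel_measurable seq_borel" by measurable
    show ?thesis
      unfolding L_def using i e integral_distr[OF F mm] integrable_distr_eq[OF F mm] by simp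
  qed
  show ?thesis using L.prob_space_axioms sL mom inv by blast
qed

section \<open>Permuting the coordinates of a random sequence\<close>

lemma second_countable_euclidean: "second_countable (euclidean :: 'a :: second_countable_topology topology)"
proof -
  obtain B :: "'a set set" where B: "countable B" "topological_basis B"
    using ex_countable_basis by blast
  show ?thesis
    unfolding second_countable_def
  proof (intro exI[of _ B] conjI ballI allI impI)
    show "openin euclidean V" if "V \<in> B" for V
      using B(2) that by (simp add: topological_basis_open)
    show "\<exists>V\<in>B. x \<in> V \<and> V \<subseteq> U" if "openin euclidean U \<and> x \<in> U" for U x
    proof -
      have "open U" "x \<in> U" using that by auto
      then show ?thesis using topological_basisE[OF B(2)] by metis
    qed
  qed (rule B(1))
qed

text \<open>The topology of the image is transported along the injection, which becomes a
  homeomorphism.\<close>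

lemma standard_prob_space_embed:
  fixes L :: "'a :: polish_space measure" and \<kappa> :: "'a \<Rightarrow> 'x"
  assumes L: "prob_space L" "sets L = sets borel" and k: "inj \<kappa>"
  shows "standard_prob_space (embed_measure L \<kappa>)"
  unfolding standard_prob_space_def
proof (intro conjI exI)
  interpret prob_space L by fact
  let ?q = "inv_into UNIV \<kappa>"
  let ?\<tau> = "pullback_topology (range \<kappa>) ?q (euclidean :: 'a topology)"
  have sp: "space L = UNIV" using sets_eq_imp_space_eq[OF L(2)] by simp
  have "prob_space (distr L (embed_measure L \<kappa>) \<kappa>)"
    using k by (intro prob_space_distr measurable_embed_measure2)
  then show "prob_space (embed_measure L \<kappa>)" using embed_measure_eq_distr[OF k] by simp
  have tt: "topspace ?\<tau> = range \<kappa>" by (simp add: topspace_pullback_topology)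
  have hom: "homeomorphic_maps (euclidean :: 'a topology) ?\<tau> \<kappa> ?q"
    unfolding homeomorphic_maps_def
  proof (intro conjI ballI)
    show "continuous_map euclidean ?\<tau> \<kappa>"
    proof (rule continuous_map_pullback')
      show "continuous_map euclidean euclidean (?q \<circ> \<kappa>)" using k by (simp add: comp_def)
    qed auto
    show "continuous_map ?\<tau> euclidean ?q"
      using continuous_map_pullback[of euclidean euclidean id "range \<kappa>" ?q] by simp
  qed (use k in \<open>auto simp: tt inv_f_f f_inv_into_f\<close>)
  then have hs: "(euclidean :: 'a topology) homeomorphic_space ?\<tau>" by (auto simp: homeomorphic_space_def)
  show "completely_metrizable_space ?\<tau>"
    using homeomorphic_completely_metrizable_space[OF hs] completely_metrizable_space_euclidean by blast
  show "second_countable ?\<tau>"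
    using homeomorphic_space_second_countability[OF hs] second_countable_euclidean by blast
  show "topspace ?\<tau> = space (embed_measure L \<kappa>)" by (simp add: tt space_embed_measure sp)
  have im: "\<kappa> ` A = ?q -` A \<inter> range \<kappa>" for A using k by (auto simp: inv_f_f)
  have "sets (embed_measure L \<kappa>) = (\<lambda>A. \<kappa> ` A) ` sets L"
    by (auto simp: sets_embed_measure[OF k])
  also have "\<dots> = (\<lambda>A. ?q -` A \<inter> range \<kappa>) ` sets L"
    by (intro image_cong refl im)
  also have "\<dots> = {?q -` A \<inter> range \<kappa> |A. A \<in> sigma_sets UNIV {U. open U}}"
    by (simp add: L(2) borel_def Setcompr_eq_image)
  also have "\<dots> = sigma_sets (range \<kappa>) {?q -` A \<inter> range \<kappa> |A. A \<in> {U. open U}}"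
    by (rule sigma_sets_vimage_commute) auto
  also have "{?q -` A \<inter> range \<kappa> |A. A \<in> {U. open U}} = {U. openin ?\<tau> U}"
    by (auto simp: openin_pullback_topology)
  finally show "sets (embed_measure L \<kappa>) = sigma_sets (space (embed_measure L \<kappa>)) {U. openin ?\<tau> U}"
    by (simp add: space_embed_measure sp)
qed

text \<open>A homomorphism into the group of measure-preserving bijections induces a Boolean action as
  soon as it moves every measurable set continuously.\<close>

lemma boolean_pmp_action_of_pointwise:
  assumes G: "subgroup G (BijGroup \<Omega>)" and M: "prob_space M"
    and T: "\<And>g. g \<in> G \<Longrightarrow> T g \<in> carrier (mp_group M)"
    and mult: "\<And>g h. g \<in> G \<Longrightarrow> h \<in> G \<Longrightarrow> T (g \<otimes>\<^bsub>BijGroup \<Omega>\<^esub> h) = T g \<otimes>\<^bsub>mp_group M\<^esub> T h"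
    and cont: "\<And>g0 Y e. g0 \<in> G \<Longrightarrow> Y \<in> sets M \<Longrightarrow> 0 < e \<Longrightarrow>
      \<exists>F. finite F \<and> F \<subseteq> \<Omega> \<and> (\<forall>g\<in>G. (\<forall>a\<in>F. g a = g0 a) \<longrightarrow> measure M (sym_diff (T g ` Y) (T g0 ` Y)) < e)"
  shows "boolean_pmp_action \<Omega> G M (\<lambda>g. ae_identity M #>\<^bsub>mp_group M\<^esub> T g)"
proof -
  interpret prob_space M by fact
  interpret N: normal "ae_identity M" "mp_group M" by (rule normal_ae_identity)
  let ?\<alpha> = "\<lambda>g. ae_identity M #>\<^bsub>mp_group M\<^esub> T g"
  let ?X = "subtopology (sym_topology \<Omega>) G"
  have ts: "topspace ?X = G"
    by (rule topspace_permutation_group[OF G])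
  have ac: "?\<alpha> g \<in> carrier (Aut M)" if "g \<in> G" for g
    using T[OF that] by (auto simp: Aut_def carrier_FactGroup)
  have sets_im: "S ` Y \<in> sets M" if "S \<in> carrier (mp_group M)" "Y \<in> sets M" for S Y
    using mp_group_image(2) that .
  have ball: "?\<alpha> g \<in> weak_ball M (ae_identity M #>\<^bsub>mp_group M\<^esub> T') Y e
      \<longleftrightarrow> measure M (sym_diff (T g ` Y) (T' ` Y)) < e"
    if g: "g \<in> G" and T': "T' \<in> carrier (mp_group M)" and Y: "Y \<in> sets M" for g T' Y e
  proof -
    have "measure M (sym_diff (S ` Y) (S' ` Y)) = measure M (sym_diff (T g ` Y) (T' ` Y))"
      if "S \<in> ?\<alpha> g" "S' \<in> ae_identity M #>\<^bsub>mp_group M\<^esub> T'" for S S'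
    proof -
      have S: "S \<in> carrier (mp_group M)" "AE x in M. S x = T g x"
        and S': "S' \<in> carrier (mp_group M)" "AE x in M. S' x = T' x"
        using that Aut_coset[OF T[OF g]] Aut_coset[OF T'] by auto
      have "AE x in M. x \<in> sym_diff (S ` Y) (S' ` Y) \<longleftrightarrow> x \<in> sym_diff (T g ` Y) (T' ` Y)"
        using image_AE_cong[OF S(1) T[OF g] S(2) Y] image_AE_cong[OF S'(1) T' S'(2) Y]
        by eventually_elim blast
      then show ?thesis
        using sets_im[OF S(1) Y] sets_im[OF S'(1) Y] sets_im[OF T[OF g] Y] sets_im[OF T' Y]
        by (intro finite_measure_eq_AE) auto
    qed
    note eq = this
    have mem: "T g \<in> ?\<alpha> g" "T' \<in> ae_identity M #>\<^bsub>mp_group M\<^esub> T'"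
      using Aut_coset[OF T[OF g]] Aut_coset[OF T'] T[OF g] T' by auto
    show ?thesis
    proof
      assume "?\<alpha> g \<in> weak_ball M (ae_identity M #>\<^bsub>mp_group M\<^esub> T') Y e"
      then show "measure M (sym_diff (T g ` Y) (T' ` Y)) < e"
        using mem unfolding weak_ball_def by blast
    next
      assume lt: "measure M (sym_diff (T g ` Y) (T' ` Y)) < e"
      show "?\<alpha> g \<in> weak_ball M (ae_identity M #>\<^bsub>mp_group M\<^esub> T') Y e"
        unfolding weak_ball_def
      proof (intro CollectI conjI ballI)
        fix S S' assume "S \<in> ?\<alpha> g" "S' \<in> ae_identity M #>\<^bsub>mp_group M\<^esub> T'"
        from eq[OF this] lt show "measure M (sym_diff (S ` Y) (S' ` Y)) < e" by (simp only:)
      qed (rule ac[OF g])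
    qed
  qed
  have "continuous_map ?X (weak_topology M) ?\<alpha>"
    unfolding weak_topology_def continuous_on_generated_topo_iff ts
  proof (intro conjI allI impI)
    fix U assume "U \<in> {weak_ball M C Y e |C Y e. C \<in> carrier (Aut M) \<and> Y \<in> sets M \<and> 0 < e}"
    then obtain C Y e where U: "U = weak_ball M C Y e" and C: "C \<in> carrier (Aut M)" and Y: "Y \<in> sets M" and e: "0 < e"
      by auto
    obtain T' where T': "T' \<in> carrier (mp_group M)" and CT: "C = ae_identity M #>\<^bsub>mp_group M\<^esub> T'"
      using C by (rule Aut_carrierE)
    show "openin ?X (?\<alpha> -` U \<inter> G)"
      unfolding openin_subopen[of _ "?\<alpha> -` U \<inter> G"]
    proof (intro ballI)
      fix g0 assume "g0 \<in> ?\<alpha> -` U \<inter> G"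
      then have g0: "g0 \<in> G" and lt: "measure M (sym_diff (T g0 ` Y) (T' ` Y)) < e"
        using ball[OF _ T' Y] by (auto simp: U CT)
      obtain F where F: "finite F" "F \<subseteq> \<Omega>" and near: "\<And>g. g \<in> G \<Longrightarrow> (\<forall>a\<in>F. g a = g0 a) \<Longrightarrow>
          measure M (sym_diff (T g ` Y) (T g0 ` Y)) < e - measure M (sym_diff (T g0 ` Y) (T' ` Y))"
        using cont[OF g0 Y, of "e - measure M (sym_diff (T g0 ` Y) (T' ` Y))"] lt by auto
      have "{g \<in> G. \<forall>a\<in>F. g a = g0 a} \<subseteq> ?\<alpha> -` U \<inter> G"
      proof
        fix g assume "g \<in> {g \<in> G. \<forall>a\<in>F. g a = g0 a}"
        then have g: "g \<in> G" and ag: "\<forall>a\<in>F. g a = g0 a" by auto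
        have "measure M (sym_diff (T g ` Y) (T' ` Y)) \<le>
            measure M (sym_diff (T g ` Y) (T g0 ` Y)) + measure M (sym_diff (T g0 ` Y) (T' ` Y))"
          using sets_im T g g0 T' Y by (intro sym_diff_triangle) auto
        also have "\<dots> < e" using near[OF g ag] by simp
        finally show "g \<in> ?\<alpha> -` U \<inter> G" using ball[OF g T' Y] g by (simp add: U CT)
      qed
      then show "\<exists>V. openin ?X V \<and> g0 \<in> V \<and> V \<subseteq> ?\<alpha> -` U \<inter> G"
        using openin_agreeing_on_finite[OF G F g0] g0 by (intro exI[of _ "{g \<in> G. \<forall>a\<in>F. g a = g0 a}"]) auto
    qed
  next
    have "?\<alpha> g \<in> weak_ball M (?\<alpha> g) {} 1" if "g \<in> G" for g
      using ball[OF that T[OF that], of "{}" 1] by simp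
    moreover have "weak_ball M (?\<alpha> g) {} 1 \<in> {weak_ball M C Y e |C Y e. C \<in> carrier (Aut M) \<and> Y \<in> sets M \<and> 0 < e}"
      if "g \<in> G" for g
      by (intro CollectI exI conjI, rule refl) (use ac[OF that] in auto)
    ultimately show "?\<alpha> ` G \<subseteq> \<Union> {weak_ball M C Y e |C Y e. C \<in> carrier (Aut M) \<and> Y \<in> sets M \<and> 0 < e}"
      by (intro image_subsetI UnionI)
  qed
  moreover have "?\<alpha> \<in> hom ((BijGroup \<Omega>)\<lparr>carrier := G\<rparr>) (Aut M)"
  proof (rule homI)
    show "?\<alpha> g \<in> carrier (Aut M)" if "g \<in> carrier ((BijGroup \<Omega>)\<lparr>carrier := G\<rparr>)" for g
      using ac that by simp
    fix g h assume "g \<in> carrier ((BijGroup \<Omega>)\<lparr>carrier := G\<rparr>)" "h \<in> carrier ((BijGroup \<Omega>)\<lparr>carrier := G\<rparr>)"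
    then show "?\<alpha> (g \<otimes>\<^bsub>(BijGroup \<Omega>)\<lparr>carrier := G\<rparr>\<^esub> h) = ?\<alpha> g \<otimes>\<^bsub>Aut M\<^esub> ?\<alpha> h"
      using N.rcos_sum[OF T T] by (simp add: mult Aut_def FactGroup_def)
  qed
  ultimately show ?thesis by (simp add: boolean_pmp_action_def)
qed

text \<open>The permutation action on sequences of reals, carried over to the target type by \<open>\<kappa>\<close>.\<close>

locale sequence_action =
  fixes \<Omega> :: "'w set" and G and \<sigma> :: "('w \<Rightarrow> 'w) \<Rightarrow> nat \<Rightarrow> nat"
    and L :: "(nat \<Rightarrow> real) measure" and \<kappa> :: "(nat \<Rightarrow> real) \<Rightarrow> 'x"
  assumes subgroup_G: "subgroup G (BijGroup \<Omega>)"
    and prob_L: "prob_space L" and sets_L: "sets L = sets seq_borel"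
    and sigma_mult: "\<And>g h n. g \<in> G \<Longrightarrow> h \<in> G \<Longrightarrow> \<sigma> (g \<otimes>\<^bsub>BijGroup \<Omega>\<^esub> h) n = \<sigma> g (\<sigma> h n)"
    and sigma_one: "\<And>n. \<sigma> \<one>\<^bsub>BijGroup \<Omega>\<^esub> n = n"
    and sigma_open: "\<And>n. \<exists>F. finite F \<and> F \<subseteq> \<Omega> \<and> (\<forall>g\<in>pointwise_stabilizer G F. \<sigma> g n = n)"
    and sigma_inv: "\<And>g. g \<in> G \<Longrightarrow> distr L L (\<lambda>x m. x (\<sigma> g m)) = L"
    and inj_k: "inj \<kappa>"
begin

sublocale B: Group.group "BijGroup \<Omega>" by (rule group_BijGroup)

sublocale L: prob_space L by (rule prob_L)

lemma ginv: "g \<in> G \<Longrightarrow> inv\<^bsub>BijGroup \<Omega>\<^esub> g \<in> G"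
  by (rule subgroup.m_inv_closed[OF subgroup_G])

lemma gcarr: "g \<in> G \<Longrightarrow> g \<in> carrier (BijGroup \<Omega>)"
  using subgroup.subset[OF subgroup_G] by blast

lemma sigma_inverse:
  assumes g: "g \<in> G"
  shows "\<sigma> g (\<sigma> (inv\<^bsub>BijGroup \<Omega>\<^esub> g) n) = n" "\<sigma> (inv\<^bsub>BijGroup \<Omega>\<^esub> g) (\<sigma> g n) = n"
  using sigma_mult[OF g ginv[OF g], of n] sigma_mult[OF ginv[OF g] g, of n] gcarr[OF g] by (simp_all add: sigma_one)

definition shift :: "('w \<Rightarrow> 'w) \<Rightarrow> (nat \<Rightarrow> real) \<Rightarrow> nat \<Rightarrow> real" where
  "shift g x = (\<lambda>m. x (\<sigma> (inv\<^bsub>BijGroup \<Omega>\<^esub> g) m))"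

definition M :: "'x measure" where "M = embed_measure L \<kappa>"

definition coord :: "'x \<Rightarrow> nat \<Rightarrow> real" where "coord = inv_into UNIV \<kappa>"

definition move :: "('w \<Rightarrow> 'w) \<Rightarrow> 'x \<Rightarrow> 'x" where
  "move g = (\<lambda>y\<in>range \<kappa>. \<kappa> (shift g (coord y)))"

definition \<alpha> :: "('w \<Rightarrow> 'w) \<Rightarrow> ('x \<Rightarrow> 'x) set" where
  "\<alpha> g = ae_identity M #>\<^bsub>mp_group M\<^esub> move g"

lemma coord_k [simp]: "coord (\<kappa> x) = x"
  using inj_k by (simp add: coord_def)

lemma space_L [simp]: "space L = UNIV"
  using sets_eq_imp_space_eq[OF sets_L] by (simp add: space_PiM PiE_def extensional_def)

lemma space_M [simp]: "space M = range \<kappa>"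
  by (simp add: M_def space_embed_measure)

lemma measurable_k [measurable]: "\<kappa> \<in> measurable L M"
  unfolding M_def using inj_k by (rule measurable_embed_measure2)

lemma measurable_coord [measurable]: "coord \<in> measurable M L"
  unfolding M_def by (rule measurable_embed_measure1) simp

lemma M_distr: "M = distr L M \<kappa>"
  unfolding M_def using embed_measure_eq_distr[OF inj_k] .

lemma measurable_coord_n [measurable]: "(\<lambda>y. coord y n) \<in> borel_measurable M"
proof -
  have "(\<lambda>x. x n) \<in> borel_measurable L"
    using measurable_component_singleton[of n UNIV "\<lambda>_. borel :: real measure"] measurable_cong_sets[OF sets_L refl] by blast
  from measurable_compose[OF measurable_coord this] show ?thesis .
qed

lemma standard_M: "standard_prob_space M"
  unfolding M_def using prob_L sets_L inj_k
  by (intro standard_prob_space_embed) (simp_all add: sets_PiM_equal_borel)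

sublocale P: prob_space M
  using standard_M by (simp add: standard_prob_space_def)

lemma shift_mult:
  assumes g: "g \<in> G" and h: "h \<in> G"
  shows "shift (g \<otimes>\<^bsub>BijGroup \<Omega>\<^esub> h) x = shift g (shift h x)"
  unfolding shift_def B.inv_mult_group[OF gcarr[OF g] gcarr[OF h]]
  by (simp add: sigma_mult ginv g h)

lemma shift_inverse:
  assumes g: "g \<in> G"
  shows "shift g (shift (inv\<^bsub>BijGroup \<Omega>\<^esub> g) x) = x" "shift (inv\<^bsub>BijGroup \<Omega>\<^esub> g) (shift g x) = x"
  unfolding shift_def by (simp_all add: sigma_inverse g B.inv_inv gcarr)

lemma measurable_shift [measurable]: "shift g \<in> measurable L L"
proof -
  have "shift g \<in> measurable seq_borel seq_borel"
    unfolding shift_def by (rule measurable_PiM_single') (auto simp: space_PiM)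
  then show ?thesis using measurable_cong_sets[OF sets_L sets_L] by blast
qed

lemma distr_shift: "g \<in> G \<Longrightarrow> distr L L (shift g) = L"
  unfolding shift_def using sigma_inv[OF ginv] by simp

lemma move_k [simp]: "move g (\<kappa> x) = \<kappa> (shift g x)"
  by (simp add: move_def)

lemma measurable_move: "move g \<in> measurable M M"
proof -
  have "(\<lambda>y. \<kappa> (shift g (coord y))) \<in> measurable M M" by measurable
  then show ?thesis by (rule measurable_cong[THEN iffD1, rotated]) (auto simp: move_def)
qed

lemma move_mp: assumes g: "g \<in> G" shows "move g \<in> carrier (mp_group M)"
proof (rule mp_groupI)
  show "move g \<in> extensional (space M)" by (simp add: move_def)
  show "move g \<in> measurable M M" "move (inv\<^bsub>BijGroup \<Omega>\<^esub> g) \<in> measurable M M" by (rule measurable_move)+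
  show "move (inv\<^bsub>BijGroup \<Omega>\<^esub> g) (move g y) = y" "move g (move (inv\<^bsub>BijGroup \<Omega>\<^esub> g) y) = y" if "y \<in> space M" for y
    using that shift_inverse[OF g] by auto
  have "distr M M (move g) = distr (distr L M \<kappa>) M (move g)" using M_distr by simp
  also have "\<dots> = distr L M (move g \<circ> \<kappa>)" by (rule distr_distr[OF measurable_move measurable_k])
  also have "\<dots> = distr L M (\<kappa> \<circ> shift g)" by (intro distr_cong) auto
  also have "\<dots> = distr (distr L L (shift g)) M \<kappa>" by (rule distr_distr[OF measurable_k measurable_shift, symmetric])
  also have "\<dots> = M" using M_distr distr_shift[OF g] by simp
  finally show "distr M M (move g) = M" .
qed

lemma move_mult:
  assumes g: "g \<in> G" and h: "h \<in> G"
  shows "move (g \<otimes>\<^bsub>BijGroup \<Omega>\<^esub> h) = move g \<otimes>\<^bsub>mp_group M\<^esub> move h"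
  unfolding mp_group_mult[OF move_mp[OF g] move_mp[OF h]]
  by (rule extensionalityI[of _ "space M"])
    (auto simp: move_def[of "g \<otimes>\<^bsub>BijGroup \<Omega>\<^esub> h"] compose_def shift_mult[OF g h])

lemma shift_image:
  assumes g: "g \<in> G" shows "shift g ` A = shift (inv\<^bsub>BijGroup \<Omega>\<^esub> g) -` A"
proof -
  have "x \<in> shift g ` A" if "shift (inv\<^bsub>BijGroup \<Omega>\<^esub> g) x \<in> A" for x
    using that shift_inverse(1)[OF g, of x] by (metis image_eqI)
  then show ?thesis using shift_inverse(2)[OF g] by auto
qed

lemma sets_shift_image: "g \<in> G \<Longrightarrow> A \<in> sets L \<Longrightarrow> shift g ` A \<in> sets L"
  using measurable_sets[OF measurable_shift] by (simp add: shift_image)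

lemma sym_diff_UN_Un_subset:
  "sym_diff ((\<Union>i\<in>I. a i) \<union> q) ((\<Union>i\<in>I. b i) \<union> r) \<subseteq> (\<Union>i\<in>I. sym_diff (a i) (b i)) \<union> (q \<union> r)"
  by auto

text \<open>The sets moved continuously form a \<open>\<sigma>\<close>-algebra. A cylinder over one coordinate is not
  moved at all by elements close to each other, because stabilizers of indices are open.\<close>

lemma shift_continuous:
  fixes e :: real
  assumes g0: "g0 \<in> G" and A: "A \<in> sets L" and e: "0 < e"
  shows "\<exists>F. finite F \<and> F \<subseteq> \<Omega> \<and>
    (\<forall>g\<in>G. (\<forall>a\<in>F. g a = g0 a) \<longrightarrow> measure L (sym_diff (shift g ` A) (shift g0 ` A)) < e)"
proof -
  have bij: "bij (shift g)" if "g \<in> G" for g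
    by (rule o_bij[of "shift (inv\<^bsub>BijGroup \<Omega>\<^esub> g)"]) (auto simp: shift_inverse that fun_eq_iff)
  note im = shift_image and sets_im = sets_shift_image
  have "A \<in> sigma_sets UNIV {{f. f i \<in> B} |i B. B \<in> sets borel}"
    using A unfolding sets_L sets_PiM_single by (simp add: PiE_def extensional_def)
  then show ?thesis using e
  proof (induction arbitrary: e rule: sigma_sets.induct)
    case (Basic A)
    then obtain n B where A: "A = {f. f n \<in> B}" by auto
    obtain F where F: "finite F" "F \<subseteq> \<Omega>" "\<And>g. g \<in> pointwise_stabilizer G F \<Longrightarrow> \<sigma> g n = n"
      using sigma_open[of n] by auto
    have "shift g ` A = shift g0 ` A" if g: "g \<in> G" and ag: "\<forall>a\<in>F. g a = g0 a" for g
    proof -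
      let ?h = "inv\<^bsub>BijGroup \<Omega>\<^esub> g0 \<otimes>\<^bsub>BijGroup \<Omega>\<^esub> g"
      have hG: "?h \<in> G" using g g0 ginv subgroup.m_closed[OF subgroup_G] by blast
      have "?h a = a" if "a \<in> F" for a
      proof -
        have a: "a \<in> \<Omega>" using that F by auto
        have "?h a = (inv\<^bsub>BijGroup \<Omega>\<^esub> g0) (g a)"
          using BijGroup_mult_apply[OF gcarr[OF ginv[OF g0]] gcarr[OF g] a] .
        also have "\<dots> = (inv\<^bsub>BijGroup \<Omega>\<^esub> g0) (g0 a)" using ag that by simp
        also have "\<dots> = a" using BijGroup_inv_apply[OF gcarr[OF g0] a] .
        finally show ?thesis .
      qed
      then have "\<sigma> ?h n = n" using F(3)[of ?h] hG by (simp add: pointwise_stabilizer_def)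
      then have "\<sigma> (inv\<^bsub>BijGroup \<Omega>\<^esub> g0) (\<sigma> g n) = n" using sigma_mult[OF ginv[OF g0] g] by simp
      then have "\<sigma> g n = \<sigma> g0 n" using sigma_inverse(1)[OF g0, of "\<sigma> g n"] by simp
      then show ?thesis
        unfolding im[OF g] im[OF g0] A shift_def by (simp add: B.inv_inv gcarr g g0)
    qed
    then have "measure L (sym_diff (shift g ` A) (shift g0 ` A)) < e"
      if "g \<in> G" "\<forall>a\<in>F. g a = g0 a" for g
      using that Basic(2) by (simp only: Un_absorb Diff_cancel measure_empty)
    then show ?case using F(1,2) by blast
  next
    case Empty
    then show ?case by auto
  next
    case (Compl A)
    have "shift g ` (UNIV - A) = UNIV - shift g ` A" if "g \<in> G" for g
      using bij[OF that] by (simp add: bij_image_Compl_eq flip: Compl_eq_Diff_UNIV)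
    moreover have "sym_diff (UNIV - A') (UNIV - B') = sym_diff A' B'" for A' B' :: "(nat \<Rightarrow> real) set" by auto
    ultimately show ?case using Compl(2)[OF Compl(3)] g0 by simp
  next
    case (Union A)
    have As: "A i \<in> sets L" for i
      using Union(1) unfolding sets_L sets_PiM_single by (simp add: PiE_def extensional_def)
    let ?U = "\<lambda>n. \<Union>i<n. A i"
    have "(\<lambda>n. measure L (?U n)) \<longlonglongrightarrow> measure L (\<Union>n. ?U n)"
      using As by (intro L.finite_Lim_measure_incseq incseq_SucI) (auto simp: lessThan_Suc)
    moreover have "(\<Union>n. ?U n) = (\<Union>i. A i)" by auto
    ultimately have "(\<lambda>n. measure L (?U n)) \<longlonglongrightarrow> measure L (\<Union>i. A i)" by simp
    \<comment> \<open>Finitely many of the sets exhaust the union up to \<open>e / 4\<close>; the remainder \<open>D\<close> costs at most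
      \<open>e / 4\<close> before and after moving, and the finitely many sets together cost \<open>e / 4\<close>.\<close>
    then have "\<forall>\<^sub>F n in sequentially. measure L (\<Union>i. A i) - e / 4 < measure L (?U n)"
      using Union(3) by (intro order_tendstoD(1)) auto
    then obtain N where N: "measure L (\<Union>i. A i) - e / 4 < measure L (?U N)"
      by (auto simp: eventually_sequentially)
    define D where "D = (\<Union>i. A i) - ?U N"
    have Ds: "D \<in> sets L" using As by (auto simp: D_def)
    have "measure L D = measure L (\<Union>i. A i) - measure L (?U N)"
      unfolding D_def using As by (intro L.finite_measure_Diff) auto
    then have D: "measure L D < e / 4" using N by simp
    have Dg: "measure L (shift g ` D) < e / 4" if g: "g \<in> G" for g
    proof -
      have "measure L D = measure (distr L L (shift (inv\<^bsub>BijGroup \<Omega>\<^esub> g))) D" using distr_shift[OF ginv[OF g]] by simp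
      also have "\<dots> = measure L (shift g ` D)"
        unfolding im[OF g] using Ds by (subst measure_distr) auto
      finally show ?thesis using D by simp
    qed
    have "0 < e / (4 * (real N + 1))" using Union(3) by simp
    then have "\<forall>i. \<exists>F. finite F \<and> F \<subseteq> \<Omega> \<and> (\<forall>g\<in>G. (\<forall>a\<in>F. g a = g0 a) \<longrightarrow>
       measure L (sym_diff (shift g ` A i) (shift g0 ` A i)) < e / (4 * (real N + 1)))"
      using Union(2) by blast
    then obtain F where F: "\<And>i. finite (F i)" "\<And>i. F i \<subseteq> \<Omega>"
      "\<And>i g. g \<in> G \<Longrightarrow> \<forall>a\<in>F i. g a = g0 a \<Longrightarrow> measure L (sym_diff (shift g ` A i) (shift g0 ` A i)) < e / (4 * (real N + 1))"
      by metis
    have "measure L (sym_diff (shift g ` (\<Union>i. A i)) (shift g0 ` (\<Union>i. A i))) < e"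
      if g: "g \<in> G" and ag: "\<forall>a\<in>(\<Union>i<N. F i). g a = g0 a" for g
    proof -
      let ?S = "\<lambda>i. sym_diff (shift g ` A i) (shift g0 ` A i)"
      have Ss: "?S i \<in> sets L" for i using sets_im[OF g As] sets_im[OF g0 As] by auto
      have Dss: "shift g ` D \<in> sets L" "shift g0 ` D \<in> sets L" using sets_im g g0 Ds by auto
      have "shift h ` (\<Union>i. A i) = (\<Union>i<N. shift h ` A i) \<union> shift h ` D" for h
        by (auto simp: D_def)
      then have "sym_diff (shift g ` (\<Union>i. A i)) (shift g0 ` (\<Union>i. A i))
          = sym_diff ((\<Union>i<N. shift g ` A i) \<union> shift g ` D) ((\<Union>i<N. shift g0 ` A i) \<union> shift g0 ` D)"
        by (simp only:)
      also have "\<dots> \<subseteq> (\<Union>i<N. ?S i) \<union> (shift g ` D \<union> shift g0 ` D)"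
        by (rule sym_diff_UN_Un_subset)
      finally have "sym_diff (shift g ` (\<Union>i. A i)) (shift g0 ` (\<Union>i. A i)) \<subseteq> (\<Union>i<N. ?S i) \<union> (shift g ` D \<union> shift g0 ` D)" .
      then have "measure L (sym_diff (shift g ` (\<Union>i. A i)) (shift g0 ` (\<Union>i. A i)))
          \<le> measure L ((\<Union>i<N. ?S i) \<union> (shift g ` D \<union> shift g0 ` D))"
        using Ss Dss by (intro L.finite_measure_mono) auto
      also have "\<dots> \<le> measure L (\<Union>i<N. ?S i) + measure L (shift g ` D \<union> shift g0 ` D)"
        using Ss Dss by (intro measure_Un_le) auto
      also have "\<dots> \<le> (\<Sum>i<N. measure L (?S i)) + (measure L (shift g ` D) + measure L (shift g0 ` D))"
        using Ss Dss by (intro add_mono measure_Un_le measure_UNION_le) auto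
      also have "(\<Sum>i<N. measure L (?S i)) \<le> (\<Sum>i<N. e / (4 * (real N + 1)))"
        using F(3)[OF g] ag by (intro sum_mono less_imp_le) auto
      also have "\<dots> \<le> e / 4" using Union(3) by (simp add: field_simps)
      finally show ?thesis using Dg[OF g] Dg[OF g0] Union(3) by linarith
    qed
    then show ?case using F(1,2) by (intro exI[of _ "\<Union>i<N. F i"] conjI finite_UN_I UN_least ballI impI) auto
  qed
qed

lemma measure_M: "A \<in> sets L \<Longrightarrow> measure M (\<kappa> ` A) = measure L A"
  unfolding M_def measure_def using inj_k by (simp add: emeasure_embed_measure_image)

lemma action: "boolean_pmp_action \<Omega> G M \<alpha>"
  unfolding \<alpha>_def
proof (rule boolean_pmp_action_of_pointwise[OF subgroup_G P.prob_space_axioms move_mp move_mult])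
  fix g0 Y and e :: real assume g0: "g0 \<in> G" and Y: "Y \<in> sets M" and e: "0 < e"
  obtain A where A: "A \<in> sets L" and YA: "Y = \<kappa> ` A"
    using Y inj_k by (auto simp: M_def sets_embed_measure)
  have m: "move g ` Y = \<kappa> ` (shift g ` A)" for g by (simp add: YA image_image)
  note s = sets_shift_image[OF _ A]
  have "measure M (sym_diff (move g ` Y) (move g0 ` Y)) = measure L (sym_diff (shift g ` A) (shift g0 ` A))"
    if "g \<in> G" for g
    unfolding m using s[OF that] s[OF g0] inj_k by (simp add: measure_M flip: image_set_diff image_Un)
  then show "\<exists>F. finite F \<and> F \<subseteq> \<Omega> \<and> (\<forall>g\<in>G. (\<forall>a\<in>F. g a = g0 a) \<longrightarrow>
      measure M (sym_diff (move g ` Y) (move g0 ` Y)) < e)"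
    using shift_continuous[OF g0 A e] by auto
qed auto

sublocale A: boolean_action \<Omega> G M \<alpha>
  by (intro boolean_action.intro subgroup_G P.prob_space_axioms action)

lemma coord_rep_inv:
  assumes g: "g \<in> G" shows "AE y in M. coord (A.rep_inv g y) n = coord y (\<sigma> g n)"
proof -
  have "AE y in M. A.rep g y = move g y"
    using A.rep_in[OF g] Aut_coset[OF move_mp[OF g]] by (simp add: \<alpha>_def)
  from AE_mp[OF A.rep_props(6)[OF g] A.rep_props(2)[OF g] this] AE_space
  show ?thesis
  proof eventually_elim
    fix y assume e: "A.rep g (A.rep_inv g y) = move g (A.rep_inv g y)" and y: "y \<in> space M"
    obtain x where x: "A.rep_inv g y = \<kappa> x"
      using measurable_space[OF A.rep_props(2)[OF g] y] by auto
    have "y = \<kappa> (shift g x)" using e A.rep_props(4)[OF g y] by (simp add: x)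
    then have "coord y (\<sigma> g n) = shift g x (\<sigma> g n)" by simp
    also have "\<dots> = x n" by (simp add: shift_def sigma_inverse[OF g])
    finally show "coord (A.rep_inv g y) n = coord y (\<sigma> g n)" by (simp add: x)
  qed
qed

lemma coord_moments:
  assumes "integrable L (\<lambda>x. x i * x j)"
  shows "integrable M (\<lambda>y. coord y i * coord y j)" "(\<integral>y. coord y i * coord y j \<partial>M) = (\<integral>x. x i * x j \<partial>L)"
proof -
  have m: "(\<lambda>y. coord y i * coord y j) \<in> borel_measurable M" by measurable
  have "integrable (distr L M \<kappa>) (\<lambda>y. coord y i * coord y j)"
    using assms integrable_distr_eq[OF measurable_k m] by simp
  then show "integrable M (\<lambda>y. coord y i * coord y j)" using M_distr by simp
  have "(\<integral>y. coord y i * coord y j \<partial>distr L M \<kappa>) = (\<integral>x. x i * x j \<partial>L)"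
    using integral_distr[OF measurable_k m] by simp
  then show "(\<integral>y. coord y i * coord y j \<partial>M) = (\<integral>x. x i * x j \<partial>L)" using M_distr by simp
qed

end

section \<open>Gaussian actions\<close>

text \<open>The \<open>n\<close>-th coordinate is the Gaussian variable of the vector \<open>v n\<close>.\<close>

locale gaussian_action = unitary_rep H \<Omega> G \<pi> + sequence_action \<Omega> G \<sigma> L \<kappa>
  for H :: "'h hilbert" and \<Omega> :: "'w set" and G \<pi> \<sigma> L and \<kappa> :: "(nat \<Rightarrow> real) \<Rightarrow> 'x" +
  fixes v :: "nat \<Rightarrow> 'h"
  assumes v_carrier [simp]: "\<And>n. v n \<in> carrier H"
    and v_sigma: "\<And>g n. g \<in> G \<Longrightarrow> v (\<sigma> g n) = \<pi> g (v n)"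
    and covariance: "\<And>i j. integrable L (\<lambda>x. x i * x j) \<and> (\<integral>x. x i * x j \<partial>L) = Re (ip H (v i) (v j))"
begin

text \<open>Finite real combinations are lists of coefficients and indices, which are concatenated, scaled
  and moved by the group without reference to a common index set. The map from \<open>lin l\<close> to
  \<open>gauss l\<close> is isometric.\<close>

primrec lin :: "(real \<times> nat) list \<Rightarrow> 'h" where
  "lin [] = \<zero>\<^bsub>H\<^esub>"
| "lin (p # l) = (complex_of_real (fst p) \<odot>\<^bsub>H\<^esub> v (snd p)) \<oplus>\<^bsub>H\<^esub> lin l"

primrec gauss :: "(real \<times> nat) list \<Rightarrow> 'x \<Rightarrow> real" where
  "gauss [] y = 0"
| "gauss (p # l) y = fst p * coord y (snd p) + gauss l y"

lemma lin_closed [simp]: "lin l \<in> carrier H"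
  by (induction l) auto

lemma gauss_isometry:
  "integrable M (\<lambda>y. gauss l y * gauss l' y) \<and> (\<integral>y. gauss l y * gauss l' y \<partial>M) = Re (ip H (lin l) (lin l'))"
proof -
  have cc: "integrable M (\<lambda>y. coord y i * coord y j)" "(\<integral>y. coord y i * coord y j \<partial>M) = Re (ip H (v i) (v j))" for i j
    using coord_moments[of i j] covariance[of i j] by auto
  have 1: "integrable M (\<lambda>y. coord y n * gauss l' y) \<and> (\<integral>y. coord y n * gauss l' y \<partial>M) = Re (ip H (v n) (lin l'))" for n
  proof (induction l')
    case (Cons p l')
    have "(\<lambda>y. coord y n * gauss (p # l') y) = (\<lambda>y. fst p * (coord y n * coord y (snd p)) + coord y n * gauss l' y)"
      by (simp add: fun_eq_iff algebra_simps)
    then show ?case using Cons cc[of n "snd p"] by (simp add: ip_linear)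
  qed simp
  show ?thesis
  proof (induction l)
    case (Cons p l)
    have "(\<lambda>y. gauss (p # l) y * gauss l' y) = (\<lambda>y. fst p * (coord y (snd p) * gauss l' y) + gauss l y * gauss l' y)"
      by (simp add: fun_eq_iff algebra_simps)
    then show ?case using Cons 1[of "snd p"] by (simp add: ip_linear)
  qed simp
qed

lemma measurable_gauss [measurable]: "gauss l \<in> borel_measurable M"
  by (induction l) auto

lemma gauss_integrable: "integrable M (gauss l)"
  using P.square_integrable_imp_integrable[OF measurable_gauss, of l] gauss_isometry[of l l]
  by (simp add: power2_eq_square)

text \<open>Let \<open>\<psi>\<close> be the integral over \<open>D\<close>, a functional bounded by the norm and unchanged by \<open>G\<^sub>C\<close>. The
  closure \<open>K\<close> of its kernel is \<open>G\<^sub>C\<close>-invariant and contains all differences \<open>\<pi>(g) v - v\<close> with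
  \<open>g\<close> in \<open>G\<^sub>C\<close>. So the component of \<open>v\<close> orthogonal to \<open>K\<close> is fixed by \<open>G\<^sub>C\<close>; if \<open>v\<close> is orthogonal to
  all fixed vectors, this component vanishes and \<open>v\<close> lies in \<open>K\<close>, where \<open>\<psi>\<close> is zero by
  boundedness.\<close>

lemma mean_zero_on_invariant_sets:
  assumes orth: "\<And>\<theta>. \<theta> \<in> fixed_vectors G H \<pi> C \<Longrightarrow> ip H (v n) \<theta> = 0"
    and C: "C \<subseteq> \<Omega>" and D: "D \<in> sets (fixed_algebra G M \<alpha> C)"
  shows "(\<integral>y. indicator D y * coord y n \<partial>M) = 0"
proof -
  have Di: "D \<in> A.inv_sets C" and Ds [measurable]: "D \<in> sets M"
    using D by (auto simp: A.sets_fixed A.inv_sets_def)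
  define \<psi> where "\<psi> l = (\<integral>y. indicator D y * gauss l y \<partial>M)" for l
  have stab: "g \<in> G" if "g \<in> pointwise_stabilizer G C" for g using that by (simp add: pointwise_stabilizer_def)
  have int: "integrable M (\<lambda>y. indicator D y * gauss l y)" for l
    using integrable_real_mult_indicator[OF Ds gauss_integrable[of l]] by (simp add: mult.commute)
  have lin_append: "lin (l @ l') = lin l \<oplus>\<^bsub>H\<^esub> lin l'" for l l'
    by (induction l) (auto intro!: vector_eqI simp: ip_linear)
  have gauss_append: "gauss (l @ l') y = gauss l y + gauss l' y" for l l' y
    by (induction l) auto
  have psi_append: "\<psi> (l @ l') = \<psi> l + \<psi> l'" for l l'
    unfolding \<psi>_def gauss_append using int[of l] int[of l'] by (simp add: distrib_left)
  let ?sc = "\<lambda>t. map (\<lambda>p. (t * fst p, snd p))"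
  have lin_scale: "lin (?sc t l) = complex_of_real t \<odot>\<^bsub>H\<^esub> lin l" for t l
    by (induction l) (auto intro!: vector_eqI simp: ip_linear algebra_simps)
  have gauss_scale: "gauss (?sc t l) y = t * gauss l y" for t l y
    by (induction l) (auto simp: algebra_simps)
  have psi_scale: "\<psi> (?sc t l) = t * \<psi> l" for t l
    unfolding \<psi>_def gauss_scale by (simp add: mult.left_commute)
  let ?mv = "\<lambda>g. map (\<lambda>p. (fst p, \<sigma> g (snd p)))"
  have lin_move: "lin (?mv g l) = \<pi> g (lin l)" if "g \<in> G" for g l
    using that by (induction l) (auto simp: pi_zero pi_add pi_smult v_sigma)
  have psi_move: "\<psi> (?mv g l) = \<psi> l" if g: "g \<in> pointwise_stabilizer G C" for g l
  proof -
    note gG = stab[OF g]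
    have "AE y in M. gauss l (A.rep_inv g y) = gauss (?mv g l) y"
    proof (induction l)
      case (Cons p l)
      then show ?case using coord_rep_inv[OF gG, of "snd p"] by eventually_elim simp
    qed simp
    moreover have "AE y in M. A.rep_inv g y \<in> D \<longleftrightarrow> y \<in> D" using Di g by (simp add: A.inv_sets_def)
    ultimately have ae: "AE y in M. indicator D y * gauss (?mv g l) y = indicator D (A.rep_inv g y) * gauss l (A.rep_inv g y)"
      by eventually_elim (auto simp: indicator_def)
    note bm [measurable] = A.rep_props(2)[OF gG]
    have "\<psi> (?mv g l) = (\<integral>y. indicator D (A.rep_inv g y) * gauss l (A.rep_inv g y) \<partial>M)"
      unfolding \<psi>_def using ae by (intro integral_cong_AE) auto
    also have "\<dots> = (\<integral>y. indicator D y * gauss l y \<partial>distr M M (A.rep_inv g))"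
      by (subst integral_distr) auto
    also have "\<dots> = \<psi> l" using A.rep_props(6)[OF gG] by (simp add: \<psi>_def)
    finally show ?thesis .
  qed
  have psi_bound: "\<bar>\<psi> l\<bar> \<le> hnorm H (lin l)" for l
  proof -
    let ?s = "\<psi> l"
    \<comment> \<open>The square of \<open>gauss l - \<psi> l * indicator D\<close> has nonnegative integral.\<close>
    have i2: "integrable M (\<lambda>y. gauss l y * gauss l y)" using gauss_isometry by blast
    have "(gauss l y - ?s * indicator D y)\<^sup>2
        = gauss l y * gauss l y - 2 * ?s * (indicator D y * gauss l y) + ?s\<^sup>2 * indicator D y" for y
      by (auto simp: power2_eq_square algebra_simps indicator_def)
    moreover have "integrable M (indicator D :: 'x \<Rightarrow> real)"
      by (rule integrable_real_indicator) (auto simp: less_top[symmetric])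
    moreover have "(\<integral>y. indicator D y \<partial>M) = measure M D"
      using sets.sets_into_space[OF Ds] by (simp add: Int_absorb2)
    ultimately have "(\<integral>y. (gauss l y - ?s * indicator D y)\<^sup>2 \<partial>M)
        = (\<integral>y. gauss l y * gauss l y \<partial>M) - 2 * ?s * (\<integral>y. indicator D y * gauss l y \<partial>M) + ?s\<^sup>2 * measure M D"
      using i2 int[of l] by simp
    then have "(\<integral>y. (gauss l y - ?s * indicator D y)\<^sup>2 \<partial>M)
        = (\<integral>y. gauss l y * gauss l y \<partial>M) - 2 * ?s * ?s + ?s\<^sup>2 * measure M D"
      by (simp only: \<psi>_def)
    moreover have "0 \<le> (\<integral>y. (gauss l y - ?s * indicator D y)\<^sup>2 \<partial>M)" by simp
    moreover have "?s\<^sup>2 * measure M D \<le> ?s\<^sup>2" by (simp add: mult_left_le P.prob_le_1)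
    ultimately have "?s * ?s \<le> Re (ip H (lin l) (lin l))"
      using gauss_isometry[of l l] by (simp add: power2_eq_square)
    then have "?s\<^sup>2 \<le> (hnorm H (lin l))\<^sup>2" by (simp add: power2_eq_square[of ?s])
    then show ?thesis using abs_le_square_iff[of ?s "hnorm H (lin l)"] by simp
  qed
  define S where "S = {lin l |l. \<psi> l = 0}"
  define K where "K = norm_closure S"
  have Kc: "closed_real_subspace K"
    unfolding K_def
  proof (rule norm_closure_subspace)
    show "\<zero>\<^bsub>H\<^esub> \<in> S" unfolding S_def by (rule CollectI, rule exI[of _ "[]"]) (simp add: \<psi>_def)
    show "x \<oplus>\<^bsub>H\<^esub> y \<in> S" if xy: "x \<in> S" "y \<in> S" for x y
    proof -
      obtain l l' where "x = lin l" "\<psi> l = 0" "y = lin l'" "\<psi> l' = 0" using xy by (auto simp: S_def)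
      then show ?thesis unfolding S_def by (intro CollectI exI[of _ "l @ l'"]) (simp add: lin_append psi_append)
    qed
    show "complex_of_real t \<odot>\<^bsub>H\<^esub> x \<in> S" if x: "x \<in> S" for t x
    proof -
      obtain l where "x = lin l" "\<psi> l = 0" using x by (auto simp: S_def)
      then show ?thesis unfolding S_def by (intro CollectI exI[of _ "?sc t l"]) (simp add: lin_scale psi_scale)
    qed
  qed (auto simp: S_def)
  have Ksub: "K \<subseteq> carrier H" and Kadd: "\<And>x y. x \<in> K \<Longrightarrow> y \<in> K \<Longrightarrow> x \<oplus>\<^bsub>H\<^esub> y \<in> K"
    and Ksc: "\<And>t x. x \<in> K \<Longrightarrow> complex_of_real t \<odot>\<^bsub>H\<^esub> x \<in> K"
    using Kc by (auto simp: closed_real_subspace_def)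
  have Kdiff: "x \<ominus>\<^bsub>H\<^esub> y \<in> K" if "x \<in> K" "y \<in> K" for x y
  proof -
    have c: "x \<in> carrier H" "y \<in> carrier H" using that Ksub by auto
    have "x \<ominus>\<^bsub>H\<^esub> y = x \<oplus>\<^bsub>H\<^esub> (complex_of_real (-1) \<odot>\<^bsub>H\<^esub> y)"
      by (rule vector_eqI) (use c in \<open>auto simp: ip_linear\<close>)
    then show ?thesis using Kadd[OF that(1) Ksc[OF that(2), of "-1"]] by simp
  qed
  have SK: "x \<in> K" if "x \<in> S" for x
  proof -
    have "S \<subseteq> carrier H" by (auto simp: S_def)
    then show ?thesis using norm_closure_superset[of S] that unfolding K_def by blast
  qed
  have Kmove: "\<pi> g x \<in> K" if g: "g \<in> pointwise_stabilizer G C" and x: "x \<in> K" for g x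
    unfolding K_def norm_closure_def
  proof (intro CollectI conjI allI impI)
    note gG = stab[OF g]
    have xc: "x \<in> carrier H" using x Ksub by auto
    show "\<pi> g x \<in> carrier H" using gG xc by simp
    fix e :: real assume "0 < e"
    then obtain l where l: "\<psi> l = 0" "hnorm H (x \<ominus>\<^bsub>H\<^esub> lin l) < e"
      using x unfolding K_def norm_closure_def S_def by blast
    have "hnorm H (\<pi> g x \<ominus>\<^bsub>H\<^esub> lin (?mv g l)) = hnorm H (\<pi> g (x \<ominus>\<^bsub>H\<^esub> lin l))"
      using gG xc by (simp add: lin_move pi_diff)
    also have "\<dots> < e" using gG xc l(2) by (simp add: hnorm_pi)
    finally show "\<exists>s\<in>S. hnorm H (\<pi> g x \<ominus>\<^bsub>H\<^esub> s) < e"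
      using psi_move[OF g, of l] l(1) unfolding S_def by (intro bexI[of _ "lin (?mv g l)"]) auto
  qed
  obtain \<kappa>' where k: "\<kappa>' \<in> K" and ok: "\<And>x. x \<in> K \<Longrightarrow> Re (ip H (v n \<ominus>\<^bsub>H\<^esub> \<kappa>') x) = 0"
    using projection_exists[OF Kc v_carrier[of n]] by blast
  have kc: "\<kappa>' \<in> carrier H" using k Ksub by auto
  define \<eta> where "\<eta> = v n \<ominus>\<^bsub>H\<^esub> \<kappa>'"
  have ec: "\<eta> \<in> carrier H" using kc by (simp add: \<eta>_def)
  have "\<eta> \<in> fixed_vectors G H \<pi> C"
    unfolding fixed_vectors_iff
  proof (intro conjI ballI ec)
    fix g assume g: "g \<in> pointwise_stabilizer G C"
    note gG = stab[OF g]
    have gi: "inv\<^bsub>BijGroup \<Omega>\<^esub> g \<in> pointwise_stabilizer G C"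
      using g C G_inv[OF gG] BijGroup_inv_apply[OF G_carr[OF gG]]
      by (fastforce simp: pointwise_stabilizer_def)
    define d where "d = \<pi> g \<eta> \<ominus>\<^bsub>H\<^esub> \<eta>"
    have dc: "d \<in> carrier H" using gG ec by (simp add: d_def)
    have "lin [(1, \<sigma> g n), (-1, n)] \<in> S"
      using psi_move[OF g, of "[(1, n)]"] psi_append[of "[(1, \<sigma> g n)]" "[(-1, n)]"] psi_scale[of "-1" "[(1, n)]"]
      unfolding S_def by (intro CollectI exI[of _ "[(1, \<sigma> g n), (-1, n)]"]) simp
    moreover have "lin [(1, \<sigma> g n), (-1, n)] = \<pi> g (v n) \<ominus>\<^bsub>H\<^esub> v n"
      by (rule vector_eqI) (use gG in \<open>auto simp: ip_linear v_sigma\<close>)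
    ultimately have "\<pi> g (v n) \<ominus>\<^bsub>H\<^esub> v n \<in> K" using SK by simp
    moreover have "d = (\<pi> g (v n) \<ominus>\<^bsub>H\<^esub> v n) \<ominus>\<^bsub>H\<^esub> (\<pi> g \<kappa>' \<ominus>\<^bsub>H\<^esub> \<kappa>')"
      unfolding d_def \<eta>_def by (rule vector_eqI) (use gG kc in \<open>auto simp: pi_diff\<close>)
    ultimately have dK: "d \<in> K" using Kdiff Kmove[OF g k] k by simp
    have "Re (ip H (\<pi> g \<eta>) d) = Re (ip H (\<pi> g \<eta>) (\<pi> g (\<pi> (inv\<^bsub>BijGroup \<Omega>\<^esub> g) d)))"
      using pi_inv(2)[OF gG dc] by simp
    also have "\<dots> = Re (ip H \<eta> (\<pi> (inv\<^bsub>BijGroup \<Omega>\<^esub> g) d))"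
      using gG ec dc G_inv[OF gG] by simp
    also have "\<dots> = 0" using ok[OF Kmove[OF gi dK]] by (simp add: \<eta>_def)
    finally have "Re (ip H d d) = 0"
      using ok[OF dK] gG ec dc by (subst (1) d_def) (simp add: \<eta>_def[symmetric])
    then show "\<pi> g \<eta> = \<eta>"
      using ip_self_eq_0[OF dc] diff_eq_zero_iff[of "\<pi> g \<eta>" \<eta>] gG ec by (simp add: d_def)
  qed
  then have "ip H (v n) \<eta> = 0" by (rule orth)
  moreover have "Re (ip H \<kappa>' \<eta>) = 0" using ok[OF k] Re_ip_commute[OF ec kc] by (simp add: \<eta>_def)
  ultimately have "Re (ip H \<eta> \<eta>) = 0" using kc ec by (subst (1) \<eta>_def) simp
  then have "\<eta> = \<zero>\<^bsub>H\<^esub>" by (rule ip_self_eq_0[OF ec])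
  then have "v n = \<kappa>'" using kc diff_eq_zero_iff by (simp add: \<eta>_def)
  then have vK: "v n \<in> K" using k by simp
  have "\<bar>\<psi> [(1, n)]\<bar> \<le> e" if e: "e > 0" for e
  proof -
    obtain l where l: "\<psi> l = 0" "hnorm H (v n \<ominus>\<^bsub>H\<^esub> lin l) < e"
      using vK e unfolding K_def norm_closure_def S_def by blast
    have "lin ([(1, n)] @ ?sc (-1) l) = v n \<ominus>\<^bsub>H\<^esub> lin l"
      unfolding lin_append lin_scale by (rule vector_eqI) (auto simp: ip_linear)
    moreover have "\<psi> ([(1, n)] @ ?sc (-1) l) = \<psi> [(1, n)]"
      unfolding psi_append psi_scale using l(1) by simp
    ultimately show ?thesis using psi_bound[of "[(1, n)] @ ?sc (-1) l"] l(2) by simp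
  qed
  then have "\<psi> [(1, n)] = 0" using field_le_epsilon[of "\<bar>\<psi> [(1, n)]\<bar>" 0] by simp
  then show ?thesis by (simp add: \<psi>_def)
qed

text \<open>The covariance of the two variables is computed with the conditional expectation of the
  \<open>n\<close>-th on \<open>F\<^sub>A\<close>, which by dissociation is the one on \<open>F\<^sub>A\<^sub>\<inter>\<^sub>B\<close>, which is zero.\<close>

lemma dissociated_orth:
  assumes dis: "dissociated_action \<Omega> G M \<alpha>" and A: "finite A" "A \<subseteq> \<Omega>" and B: "finite B" "B \<subseteq> \<Omega>"
    and m: "\<And>g. g \<in> pointwise_stabilizer G A \<Longrightarrow> \<sigma> g m = m"
    and n: "\<And>g. g \<in> pointwise_stabilizer G B \<Longrightarrow> \<sigma> g n = n"
    and orth: "\<And>\<theta>. \<theta> \<in> fixed_vectors G H \<pi> (A \<inter> B) \<Longrightarrow> ip H (v n) \<theta> = 0"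
  shows "Re (ip H (v n) (v m)) = 0"
proof -
  let ?F = "fixed_algebra G M \<alpha>"
  have C: "A \<inter> B \<subseteq> \<Omega>" using A by auto
  interpret FA: sigma_finite_subalgebra M "?F A" by (rule A.sigma_finite_fixed)
  interpret FC: sigma_finite_subalgebra M "?F (A \<inter> B)" by (rule A.sigma_finite_fixed)
  have meas: "(\<lambda>y. coord y k) \<in> borel_measurable (?F E)"
    if "\<And>g. g \<in> pointwise_stabilizer G E \<Longrightarrow> \<sigma> g k = k" for k E
  proof (rule A.measurable_fixed)
    show "AE y in M. coord (A.rep_inv g y) k = coord y k" if "g \<in> pointwise_stabilizer G E" for g
      using coord_rep_inv[OF A.stab_G[OF that], of k] \<open>\<And>g. g \<in> pointwise_stabilizer G E \<Longrightarrow> \<sigma> g k = k\<close>[OF that] by simp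
  qed simp
  have cov: "integrable M (\<lambda>y. coord y i * coord y j)" "(\<integral>y. coord y i * coord y j \<partial>M) = Re (ip H (v i) (v j))" for i j
    using coord_moments[of i j] covariance[of i j] by auto
  have ci: "integrable M (\<lambda>y. coord y k)" for k
  proof -
    have "gauss [(1, k)] = (\<lambda>y. coord y k)" by (simp add: fun_eq_iff)
    then show ?thesis using gauss_integrable[of "[(1, k)]"] by simp
  qed
  have sq: "integrable M (\<lambda>y. (coord y n)\<^sup>2)" using cov(1)[of n n] by (simp add: power2_eq_square)
  have ae: "AE y in M. real_cond_exp M (?F A) (\<lambda>y. coord y n) y = real_cond_exp M (?F (A \<inter> B)) (\<lambda>y. coord y n) y"
    using dis[unfolded dissociated_action_def, rule_format, OF A B meas[OF n] sq] by simp
  have zero: "AE y in M. real_cond_exp M (?F (A \<inter> B)) (\<lambda>y. coord y n) y = 0"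
  proof (rule FC.real_cond_exp_charact)
    fix D assume D: "D \<in> sets (?F (A \<inter> B))"
    show "(\<integral>y\<in>D. coord y n \<partial>M) = (\<integral>y\<in>D. 0 \<partial>M)"
      using mean_zero_on_invariant_sets[OF orth C D] by (simp add: set_lebesgue_integral_def)
  qed (use ci in auto)
  have "Re (ip H (v m) (v n)) = (\<integral>y. coord y m * coord y n \<partial>M)" using cov(2) by simp
  also have "\<dots> = (\<integral>y. coord y m * real_cond_exp M (?F A) (\<lambda>y. coord y n) y \<partial>M)"
    using FA.real_cond_exp_intg(2)[OF cov(1) meas[OF m] measurable_coord_n] by simp
  also have "\<dots> = (\<integral>y. 0 \<partial>M)"
  proof (rule integral_cong_AE)
    show "AE y in M. coord y m * real_cond_exp M (?F A) (\<lambda>y. coord y n) y = 0"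
      using ae zero by eventually_elim simp
  qed auto
  finally show ?thesis using Re_ip_commute[of "v m" "v n"] by simp
qed

end

context unitary_rep
begin

text \<open>The vectors of a countable invariant set are indexed by naturals and \<open>\<sigma>\<close> is the induced
  permutation of indices. Indices without a vector get the zero vector and are fixed, so finite
  and infinite sets are treated alike.\<close>

lemma gaussian_action_exists:
  assumes I: "countable I" "I \<subseteq> carrier H" and inv: "\<And>g x. g \<in> G \<Longrightarrow> x \<in> I \<Longrightarrow> \<pi> g x \<in> I"
    and smooth: "\<And>x. x \<in> I \<Longrightarrow> \<exists>F. finite F \<and> F \<subseteq> \<Omega> \<and> x \<in> fixed_vectors G H \<pi> F"
    and card: "(UNIV :: real set) \<lesssim> (UNIV :: 'x set)"
  shows "\<exists>\<sigma> L v. \<exists>\<kappa> :: (nat \<Rightarrow> real) \<Rightarrow> 'x. gaussian_action H \<Omega> G \<pi> \<sigma> L \<kappa> v \<and>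
    (\<forall>x\<in>I. \<exists>n. v n = x \<and> (\<forall>g\<in>G. \<pi> g x = x \<longrightarrow> \<sigma> g n = n))"
proof -
  define e where "e = to_nat_on I"
  have inj: "inj_on e I" unfolding e_def using I(1) by (rule inj_on_to_nat_on)
  define v where "v n = (if n \<in> e ` I then inv_into I e n else \<zero>\<^bsub>H\<^esub>)" for n
  define \<sigma> where "\<sigma> g n = (if n \<in> e ` I then e (\<pi> g (v n)) else n)" for g n
  have ve: "v (e x) = x" if "x \<in> I" for x using that inj by (simp add: v_def)
  have sig: "\<sigma> g (e x) = e (\<pi> g x)" if "x \<in> I" for g x using that by (simp add: \<sigma>_def ve)
  have vc: "v n \<in> carrier H" for n using I(2) by (auto simp: v_def inv_into_into subset_iff)
  have vs: "v (\<sigma> g n) = \<pi> g (v n)" if g: "g \<in> G" for g n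
  proof (cases "n \<in> e ` I")
    case True
    then obtain x where x: "x \<in> I" "n = e x" by auto
    then show ?thesis using inv[OF g] by (simp add: sig ve)
  next
    case False
    then show ?thesis using g by (simp add: \<sigma>_def v_def pi_zero)
  qed
  obtain a where a': "(\<forall>i k. i < k \<longrightarrow> a i k = 0) \<and> (\<forall>i j. Re (ip H (v i) (v j)) = (\<Sum>k\<le>i. a i k * a j k))"
    using gram_factor[OF vc] ..
  have a: "Re (ip H (v i) (v j)) = (\<Sum>k\<le>i. a i k * a j k)" for i j using conjunct2[OF a'] by simp
  obtain L where L: "prob_space L" "sets L = sets seq_borel"
    "\<forall>i j. integrable L (\<lambda>x. x i * x j) \<and> (\<integral>x. x i * x j \<partial>L) = Re (ip H (v i) (v j))"
    "\<forall>\<tau>. (\<forall>i j. Re (ip H (v (\<tau> i)) (v (\<tau> j))) = Re (ip H (v i) (v j))) \<longrightarrow> distr L L (\<lambda>x n. x (\<tau> n)) = L"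
    using gaussian_law_exists[of a "\<lambda>i j. Re (ip H (v i) (v j))", OF conjunct1[OF a'] a] by (elim exE conjE) (rule that)
  obtain \<kappa> :: "(nat \<Rightarrow> real) \<Rightarrow> 'x" where k: "inj \<kappa>"
    using lepoll_trans[OF nat_fun_real_lepoll card] by (auto simp: lepoll_def)
  have "gaussian_action H \<Omega> G \<pi> \<sigma> L \<kappa> v"
  proof (intro gaussian_action.intro unitary_rep_axioms sequence_action.intro gaussian_action_axioms.intro
      subgroup_G L(1,2) vc vs L(3)[rule_format] k)
    fix g h n assume g: "g \<in> G" and h: "h \<in> G"
    show "\<sigma> (g \<otimes>\<^bsub>BijGroup \<Omega>\<^esub> h) n = \<sigma> g (\<sigma> h n)"
    proof (cases "n \<in> e ` I")
      case True
      then obtain x where x: "x \<in> I" "n = e x" by auto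
      then have "x \<in> carrier H" using I(2) by auto
      then show ?thesis using x inv[OF h x(1)] pi_mult[OF g h] by (simp add: sig)
    next
      case False
      then show ?thesis by (simp add: \<sigma>_def)
    qed
  next
    fix n
    show "\<sigma> \<one>\<^bsub>BijGroup \<Omega>\<^esub> n = n"
    proof (cases "n \<in> e ` I")
      case True
      then obtain x where x: "x \<in> I" "n = e x" by auto
      then have "x \<in> carrier H" using I(2) by auto
      then show ?thesis using x by (simp add: sig pi_one)
    next
      case False
      then show ?thesis by (simp add: \<sigma>_def)
    qed
  next
    fix n
    show "\<exists>F. finite F \<and> F \<subseteq> \<Omega> \<and> (\<forall>g\<in>pointwise_stabilizer G F. \<sigma> g n = n)"
    proof (cases "n \<in> e ` I")
      case True
      then obtain x where x: "x \<in> I" "n = e x" by auto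
      obtain F where F: "finite F" "F \<subseteq> \<Omega>" "x \<in> fixed_vectors G H \<pi> F" using smooth[OF x(1)] by blast
      then have "\<forall>g\<in>pointwise_stabilizer G F. \<sigma> g n = n"
        by (simp add: x(2) sig[OF x(1)] fixed_vectors_iff)
      then show ?thesis using F(1,2) by blast
    next
      case False
      then show ?thesis by (intro exI[of _ "{}"]) (simp add: \<sigma>_def)
    qed
  next
    fix g assume g: "g \<in> G"
    show "distr L L (\<lambda>x m. x (\<sigma> g m)) = L"
      by (rule L(4)[rule_format]) (simp add: vs g vc)
  qed
  moreover have "\<forall>x\<in>I. \<exists>n. v n = x \<and> (\<forall>g\<in>G. \<pi> g x = x \<longrightarrow> \<sigma> g n = n)"
  proof
    fix x assume "x \<in> I"
    then show "\<exists>n. v n = x \<and> (\<forall>g\<in>G. \<pi> g x = x \<longrightarrow> \<sigma> g n = n)"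
      by (intro exI[of _ "e x"]) (simp add: ve sig)
  qed
  ultimately show ?thesis by blast
qed

lemma dissociated_rep_of_actions:
  assumes cnt: "countable \<Omega>" and card: "(UNIV :: real set) \<lesssim> (UNIV :: 'x set)"
    and dis: "\<And>(M :: 'x measure) \<alpha>. standard_prob_space M \<Longrightarrow> boolean_pmp_action \<Omega> G M \<alpha> \<Longrightarrow> dissociated_action \<Omega> G M \<alpha>"
  shows "dissociated_rep \<Omega> G H \<pi>"
proof (rule dissociated_repI)
  fix A B \<xi> \<zeta> assume A: "finite A" "A \<subseteq> \<Omega>" and B: "finite B" "B \<subseteq> \<Omega>"
    and xi: "\<xi> \<in> fixed_vectors G H \<pi> A" and zeta: "\<zeta> \<in> fixed_vectors G H \<pi> B"
    and orth: "\<And>\<theta>. \<theta> \<in> fixed_vectors G H \<pi> (A \<inter> B) \<Longrightarrow> ip H \<zeta> \<theta> = 0"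
  have c: "\<xi> \<in> carrier H" "\<zeta> \<in> carrier H" using xi zeta by (auto simp: fixed_vectors_iff)
  define I where "I = (\<lambda>g. \<pi> g \<xi>) ` G \<union> (\<lambda>g. \<pi> g \<zeta>) ` G"
  have I1: "countable I"
    using countable_orbit[OF xi A cnt] countable_orbit[OF zeta B cnt] by (simp add: I_def)
  have I2: "I \<subseteq> carrier H" using c by (auto simp: I_def)
  have inv: "\<pi> g x \<in> I" if g: "g \<in> G" and x: "x \<in> I" for g x
  proof -
    obtain h \<theta> where h: "h \<in> G" "\<theta> = \<xi> \<or> \<theta> = \<zeta>" "x = \<pi> h \<theta>" using x by (auto simp: I_def)
    then have "\<pi> g x = \<pi> (g \<otimes>\<^bsub>BijGroup \<Omega>\<^esub> h) \<theta>" using pi_mult[OF g h(1)] c by auto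
    then show ?thesis using h(2) G_mult[OF g h(1)] by (auto simp: I_def)
  qed
  have fin: "finite (h ` F) \<and> h ` F \<subseteq> \<Omega>" if "h \<in> G" "finite F" "F \<subseteq> \<Omega>" for h F
  proof -
    have "bij_betw h \<Omega> \<Omega>" using G_carr[OF that(1)] by (simp add: BijGroup_def Bij_def)
    then show ?thesis using that by (auto dest: bij_betwE)
  qed
  have smooth: "\<exists>F. finite F \<and> F \<subseteq> \<Omega> \<and> x \<in> fixed_vectors G H \<pi> F" if x: "x \<in> I" for x
  proof -
    consider h where "h \<in> G" "x = \<pi> h \<xi>" | h where "h \<in> G" "x = \<pi> h \<zeta>"
      using x by (auto simp: I_def)
    then show ?thesis
    proof cases
      case 1
      then show ?thesis using fixed_translate[OF xi A(2) 1(1)] fin[OF 1(1) A] by (intro exI[of _ "h ` A"]) simp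
    next
      case 2
      then show ?thesis using fixed_translate[OF zeta B(2) 2(1)] fin[OF 2(1) B] by (intro exI[of _ "h ` B"]) simp
    qed
  qed
  obtain \<sigma> L v and \<kappa> :: "(nat \<Rightarrow> real) \<Rightarrow> 'x" where ga: "gaussian_action H \<Omega> G \<pi> \<sigma> L \<kappa> v"
    and idx: "\<forall>x\<in>I. \<exists>n. v n = x \<and> (\<forall>g\<in>G. \<pi> g x = x \<longrightarrow> \<sigma> g n = n)"
    using gaussian_action_exists[OF I1 I2 inv smooth card] by blast
  interpret ga: gaussian_action H \<Omega> G \<pi> \<sigma> L \<kappa> v by (rule ga)
  have "\<one>\<^bsub>BijGroup \<Omega>\<^esub> \<in> G" by (rule subgroup.one_closed[OF subgroup_G])
  then have "\<xi> \<in> I" "\<zeta> \<in> I" unfolding I_def using pi_one[OF c(1)] pi_one[OF c(2)] by force+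
  then obtain m n where m: "v m = \<xi>" "\<And>g. g \<in> G \<Longrightarrow> \<pi> g \<xi> = \<xi> \<Longrightarrow> \<sigma> g m = m"
    and n: "v n = \<zeta>" "\<And>g. g \<in> G \<Longrightarrow> \<pi> g \<zeta> = \<zeta> \<Longrightarrow> \<sigma> g n = n"
    using idx by metis
  have "Re (ip H (v n) (v m)) = 0"
  proof (rule ga.dissociated_orth[OF dis[OF ga.standard_M ga.action] A B])
    show "\<sigma> g m = m" if "g \<in> pointwise_stabilizer G A" for g
      using that xi m(2) by (simp add: fixed_vectors_iff pointwise_stabilizer_def)
    show "\<sigma> g n = n" if "g \<in> pointwise_stabilizer G B" for g
      using that zeta n(2) by (simp add: fixed_vectors_iff pointwise_stabilizer_def)
  qed (simp add: n(1) orth)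
  then show "Re (ip H \<zeta> \<xi>) = 0" by (simp add: m(1) n(1))
qed

end

section \<open>The equivalence\<close>

theorem theorem1p5:
  fixes \<Omega> :: "'w set" and G :: "('w \<Rightarrow> 'w) set"
  assumes "countable \<Omega>" and "infinite \<Omega>"
    and "closed_permutation_group \<Omega> G"
    and "(UNIV :: real set) \<lesssim> (UNIV :: 'h set)"
    and "(UNIV :: real set) \<lesssim> (UNIV :: 'x set)"
  shows "(\<forall>(H :: 'h hilbert) \<pi>. complex_hilbert_space H \<longrightarrow> unitary_representation \<Omega> G H \<pi> \<longrightarrow>
            dissociated_rep \<Omega> G H \<pi>)
     \<longleftrightarrow> (\<forall>(M :: 'x measure) \<alpha>. standard_prob_space M \<longrightarrow> boolean_pmp_action \<Omega> G M \<alpha> \<longrightarrow>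
            dissociated_action \<Omega> G M \<alpha>)"
proof
  have G: "subgroup G (BijGroup \<Omega>)"
    using assms(3) by (simp add: closed_permutation_group_def)
  {
    assume reps: "\<forall>(H :: 'h hilbert) \<pi>. complex_hilbert_space H \<longrightarrow> unitary_representation \<Omega> G H \<pi> \<longrightarrow>
        dissociated_rep \<Omega> G H \<pi>"
    show "\<forall>(M :: 'x measure) \<alpha>. standard_prob_space M \<longrightarrow> boolean_pmp_action \<Omega> G M \<alpha> \<longrightarrow> dissociated_action \<Omega> G M \<alpha>"
    proof (intro allI impI)
      fix M :: "'x measure" and \<alpha>
      assume M: "standard_prob_space M" and act: "boolean_pmp_action \<Omega> G M \<alpha>"
      obtain enc :: "('x \<Rightarrow> complex) \<Rightarrow> 'h" where enc: "L2_space M enc"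
        using L2_space_exists[OF M assms(4)] by blast
      have "boolean_action \<Omega> G M \<alpha>"
        using M by (intro boolean_action.intro G act) (simp add: standard_prob_space_def)
      then interpret koopman \<Omega> G M \<alpha> enc
        using enc by (rule koopman.intro)
      show "dissociated_action \<Omega> G M \<alpha>"
        using reps hilbert_LH unitary_koop by (intro dissociated_action_of_rep) blast
    qed
  next
    assume acts: "\<forall>(M :: 'x measure) \<alpha>. standard_prob_space M \<longrightarrow> boolean_pmp_action \<Omega> G M \<alpha> \<longrightarrow> dissociated_action \<Omega> G M \<alpha>"
    show "\<forall>(H :: 'h hilbert) \<pi>. complex_hilbert_space H \<longrightarrow> unitary_representation \<Omega> G H \<pi> \<longrightarrow> dissociated_rep \<Omega> G H \<pi>"
    proof (intro allI impI)
      fix H :: "'h hilbert" and \<pi>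
      assume "complex_hilbert_space H" "unitary_representation \<Omega> G H \<pi>"
      then interpret unitary_rep H \<Omega> G \<pi>
        by (intro unitary_rep.intro unitary_rep_axioms.intro G)
      show "dissociated_rep \<Omega> G H \<pi>"
        using acts by (intro dissociated_rep_of_actions[OF assms(1,5)]) blast
    qed
  }
qed

end
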